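(* Let $T$ be an LR tableau with shape $\lambda/\mu$ and right LR companion tableau $G=\iota(T)$. Then (a) $\iota(T^e)=G^{\mathrm a}$, $\iota(\rho(T))=\iota(T^{e\bullet})=G^{\mathrm a\bullet}=\mathrm{evac}\,G$, and $\iota(\varrho(T))=\iota(T^{e\bullet\,\mathrm{ot}})=\mathrm{ot}\,\mathrm{evac}\,G$, i.e. the diagram $T\overset{e}{\leftrightarrow}T^e\overset{\bullet}{\leftrightarrow}T^{e\bullet}\overset{\mathrm{ot}}{\leftrightarrow}T^{e\bullet\,\mathrm{ot}}$ over $G\leftrightarrow G^{\mathrm a}\leftrightarrow \mathrm{evac}\,G\leftrightarrow\mathrm{ot}\,\mathrm{evac}\,G$ with vertical maps $\iota$ commutes; (b) on companion tableaux the involutions translate as $\rho:\mathrm{LR}_{\nu,\lambda/\mu}\to\mathrm{LR}_{\nu,(\lambda/\mu)^\bullet}$, $G\mapsto\mathrm{evac}\,G$, with $\mathrm{evac}\,\iota(T)=\iota(\rho(T))$; and $\varrho:\mathrm{LR}_{\nu,\lambda/\mu}\to\mathrm{LR}_{\nu^t,(\lambda/\mu)^t}$, $G\mapsto\mathrm{ot}\,\mathrm{evac}\,G=\mathrm{evac}\,\mathrm{ot}\,G$, with $\mathrm{evac}\,\mathrm{ot}\,\iota(T)=\iota(\varrho(T))$.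
   Context: For an LR tableau $T$ of shape $\lambda/\mu$ and content $\nu$ inside a $d\times(n-d)$ rectangle, its right LR companion $G=\iota(T)$ is the semistandard tableau of shape $\nu$ and content $\lambda/\mu$ whose $i$-th row lists the rows of $T$ containing the entries $i$ (its recording matrix is the transpose of that of $T$); $\mathrm{LR}_{\nu,\lambda/\mu}$ denotes the set of such companions, and $\iota$ is a linear bijection. For opposite LR tableaux the companion is defined analogously (an anti-normal-shape tableau). $G^{\mathrm a}$ is the anti-normal form of $G$, $\mathrm{evac}$ is Schützenberger evacuation ($\mathrm{evac}\,G=G^{\mathrm a\bullet}$), $\bullet$ is rotation by $\pi$ with entries $i\mapsto d-i+1$, and $e$ is the reversal of $T$ (the unique tableau dual Knuth equivalent to $T$ and Knuth equivalent to $\bullet T$). $\mathrm{ot}$ is the orthogonal transpose: on an LR tableau $T$ of shape $\lambda/\mu$ with Yamanouchi word $w$ of weight $\nu$ it gives the LR tableau of shape $(\lambda/\mu)^{t\bullet}$ whose column word replaces, for each $i$, the subword of letters $i$ by $12\cdots\nu_i$; on companion tableaux $\mathrm{ot}$ is the map with $\mathrm{ot}(\iota(T))=\iota(\mathrm{ot}(T))$ (explicitly: transpose $G$, then for each $i$ relabel the vertical strip of $i$'s from southeast to northwest by consecutive integers starting at $\lambda_{d-i+1}+1$). $\rho=\bullet e$ is the LR commuter $\mathrm{LR}(\mu,\nu,\lambda)\to\mathrm{LR}(\lambda,\nu,\mu)$ and $\varrho=\mathrm{ot}\,\rho$ the LR transposer $\mathrm{LR}(\mu,\nu,\lambda)\to\mathrm{LR}(\mu^t,\nu^t,\lambda^t)$.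 The proof uses Lascoux's double crystal structure: the crystal reflection operators $\sigma_i$ acting on $T$ correspond under $\iota$ to cocrystal operators $\theta_i$ on $G$, with $\iota(\sigma_0T)=\theta_0 G=G^{\mathrm a}$. *)

theory Defs
  imports Main
begin

text \<open>
  English convention, everything indexed from 1: the ambient box has \<open>d\<close> rows (numbered from top to
  bottom) and \<open>m\<close> columns, and cells are pairs (row, column).  A partition is a function whose value
  at \<open>i \<ge> 1\<close> is its \<open>i\<close>-th part; the junk value at 0 is fixed to be 0, so that equality of
  partitions is equality of functions.
\<close>

definition partition_in :: "nat \<Rightarrow> nat \<Rightarrow> (nat \<Rightarrow> nat) \<Rightarrow> bool" where
  "partition_in d m p \<longleftrightarrow>
     (\<forall>i j. 1 \<le> i \<and> i \<le> j \<longrightarrow> p j \<le> p i) \<and> (\<forall>i. i \<notin> {1..d} \<longrightarrow> p i = 0) \<and> (\<forall>i. p i \<le> m)"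

text \<open>The partition \<open>p\<^sup>\<or>\<close>, whose diagram is the rotated complement of \<open>p\<close> in the \<open>d \<times> m\<close> box.
  Hence \<open>(lam/mu)\<^sup>\<bullet> = mu\<^sup>\<or>/lam\<^sup>\<or>\<close>.\<close>

definition complement :: "nat \<Rightarrow> nat \<Rightarrow> (nat \<Rightarrow> nat) \<Rightarrow> nat \<Rightarrow> nat" where
  "complement d m p = (\<lambda>i. if i \<in> {1..d} then m - p (d + 1 - i) else 0)"

definition conjugate :: "(nat \<Rightarrow> nat) \<Rightarrow> nat \<Rightarrow> nat" where
  "conjugate p = (\<lambda>j. if j = 0 then 0 else card {i. j \<le> p i})"

definition cells :: "(nat \<Rightarrow> nat) \<Rightarrow> (nat \<Rightarrow> nat) \<Rightarrow> (nat \<times> nat) set" where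
  "cells lam mu = {(i, j). mu i < j \<and> j \<le> lam i}"

definition normal_shape :: "(nat \<Rightarrow> nat) \<Rightarrow> (nat \<times> nat) set" where
  "normal_shape nu = cells nu (\<lambda>_. 0)"

text \<open>The normal shape \<open>nu\<close> rotated by \<open>\<pi>\<close> inside the box, i.e. pushed into its south-east corner.\<close>

definition antinormal_shape :: "nat \<Rightarrow> nat \<Rightarrow> (nat \<Rightarrow> nat) \<Rightarrow> (nat \<times> nat) set" where
  "antinormal_shape d m nu = cells (\<lambda>i. if i \<in> {1..d} then m else 0) (complement d m nu)"

type_synonym tableau = "nat \<times> nat \<rightharpoonup> nat"

definition ssyt :: "nat \<Rightarrow> (nat \<times> nat) set \<Rightarrow> tableau \<Rightarrow> bool" where
  "ssyt d S T \<longleftrightarrow> dom T = S \<and> ran T \<subseteq> {1..d} \<and>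
     (\<forall>i j j' x y. T (i, j) = Some x \<and> T (i, j') = Some y \<and> j < j' \<longrightarrow> x \<le> y) \<and>
     (\<forall>i i' j x y. T (i, j) = Some x \<and> T (i', j) = Some y \<and> i < i' \<longrightarrow> x < y)"

definition content :: "tableau \<Rightarrow> nat \<Rightarrow> nat" where
  "content T k = card {c. T c = Some k}"

text \<open>Row word: rows from bottom to top, each from left to right.\<close>

definition row_word :: "nat \<Rightarrow> nat \<Rightarrow> tableau \<Rightarrow> nat list" where
  "row_word d m T = [the (T (i, j)). i \<leftarrow> rev [1..<d + 1], j \<leftarrow> [1..<m + 1], (i, j) \<in> dom T]"

definition yamanouchi :: "nat list \<Rightarrow> bool" where
  "yamanouchi w \<longleftrightarrow>
     (\<forall>k. \<forall>i\<ge>1. count_list (take k w) (i + 1) \<le> count_list (take k w) i)"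

text \<open>The Littlewood-Richardson condition is imposed on the reverse of the row word, that is, on the
  reading from right to left and from top to bottom.\<close>

definition LR_tableaux ::
    "nat \<Rightarrow> nat \<Rightarrow> (nat \<Rightarrow> nat) \<Rightarrow> (nat \<Rightarrow> nat) \<Rightarrow> (nat \<Rightarrow> nat) \<Rightarrow> tableau set" where
  "LR_tableaux d m lam mu nu = {T.
     partition_in d m lam \<and> partition_in d m mu \<and> (\<forall>i. mu i \<le> lam i) \<and> partition_in d m nu \<and>
     ssyt d (cells lam mu) T \<and> yamanouchi (rev (row_word d m T)) \<and> content T = nu}"

inductive knuth_step :: "nat list \<Rightarrow> nat list \<Rightarrow> bool" where
  "x < y \<Longrightarrow> y \<le> z \<Longrightarrow> knuth_step (u @ [y, x, z] @ v) (u @ [y, z, x] @ v)"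
| "x \<le> y \<Longrightarrow> y < z \<Longrightarrow> knuth_step (u @ [x, z, y] @ v) (u @ [z, x, y] @ v)"

definition knuth_equiv :: "nat list \<Rightarrow> nat list \<Rightarrow> bool" where
  "knuth_equiv = equivclp knuth_step"

text \<open>The inverse permutation of the standardization of a word: the positions of the letters
  1 from left to right, then those of the letters 2, and so on (\<open>sort_key\<close> is stable).
  Two words are dual Knuth equivalent if these inverses are Knuth equivalent.\<close>

definition inverse_std :: "nat list \<Rightarrow> nat list" where
  "inverse_std w = map Suc (sort_key (\<lambda>p. w ! p) [0..<length w])"

definition dual_knuth_equiv :: "nat list \<Rightarrow> nat list \<Rightarrow> bool" where
  "dual_knuth_equiv w w' \<longleftrightarrow> knuth_equiv (inverse_std w) (inverse_std w')"

text \<open>The map \<open>\<bullet>\<close>: rotation of the box by \<open>\<pi>\<close> together with \<open>x \<mapsto> d - x + 1\<close> on entries.\<close>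

definition rot :: "nat \<Rightarrow> nat \<Rightarrow> tableau \<Rightarrow> tableau" where
  "rot d m T = (\<lambda>(i, j). if i \<in> {1..d} \<and> j \<in> {1..m}
     then map_option (\<lambda>x. d + 1 - x) (T (d + 1 - i, m + 1 - j)) else None)"

definition normal_form :: "nat \<Rightarrow> nat \<Rightarrow> tableau \<Rightarrow> tableau" where
  "normal_form d m G = (THE H. (\<exists>nu. partition_in d m nu \<and> ssyt d (normal_shape nu) H) \<and>
     knuth_equiv (row_word d m G) (row_word d m H))"

definition antinormal_form :: "nat \<Rightarrow> nat \<Rightarrow> tableau \<Rightarrow> tableau" where
  "antinormal_form d m G = (THE H. (\<exists>nu. partition_in d m nu \<and> ssyt d (antinormal_shape d m nu) H) \<and>
     knuth_equiv (row_word d m G) (row_word d m H))"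

text \<open>Schuetzenberger evacuation, as the rectification of the rotated tableau.\<close>

definition evac :: "nat \<Rightarrow> nat \<Rightarrow> tableau \<Rightarrow> tableau" where
  "evac d m G = normal_form d m (rot d m G)"

text \<open>The reversal \<open>T\<^sup>e\<close>.  Dual Knuth equivalence is a relation between tableaux of the same shape.\<close>

definition reversal :: "nat \<Rightarrow> nat \<Rightarrow> tableau \<Rightarrow> tableau" where
  "reversal d m T = (THE R. ssyt d (dom T) R \<and>
     dual_knuth_equiv (row_word d m T) (row_word d m R) \<and>
     knuth_equiv (row_word d m (rot d m T)) (row_word d m R))"

text \<open>The weakly increasing list of the rows of \<open>T\<close> containing the entries \<open>k\<close>, with multiplicity.\<close>

definition rows_of_entry :: "nat \<Rightarrow> tableau \<Rightarrow> nat \<Rightarrow> nat list" where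
  "rows_of_entry d T k = concat (map (\<lambda>r. replicate (card {j. T (r, j) = Some k}) r) [1..<d + 1])"

text \<open>The companion of an LR tableau is left-justified (normal shape), that of an opposite LR
  tableau is right-justified in the box (anti-normal shape).  A tableau can be both LR and opposite
  LR, so these are two different maps.\<close>

definition companion :: "nat \<Rightarrow> tableau \<Rightarrow> tableau" where
  "companion d T = (\<lambda>(k, j). let L = rows_of_entry d T k in
     if k \<in> {1..d} \<and> j \<in> {1..length L} then Some (L ! (j - 1)) else None)"

definition opposite_companion :: "nat \<Rightarrow> nat \<Rightarrow> tableau \<Rightarrow> tableau" where
  "opposite_companion d m T = (\<lambda>(k, j). let L = rows_of_entry d T k; s = m - length L in
     if k \<in> {1..d} \<and> s < j \<and> j \<le> m then Some (L ! (j - s - 1)) else None)"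

definition LR_companions ::
    "nat \<Rightarrow> nat \<Rightarrow> (nat \<Rightarrow> nat) \<Rightarrow> (nat \<Rightarrow> nat) \<Rightarrow> (nat \<Rightarrow> nat) \<Rightarrow> tableau set" where
  "LR_companions d m nu lam mu = companion d ` LR_tableaux d m lam mu nu"

text \<open>Orthogonal transpose of a tableau in the \<open>d \<times> m\<close> box; the result lives in the \<open>m \<times> d\<close> box.
  Cell \<open>(i, j)\<close> is sent to \<open>(m - j + 1, d - i + 1)\<close>.  This carries the right-to-left, top-to-bottom
  row reading of \<open>T\<close> to the right-to-left, top-to-bottom column reading of the image, so replacing
  the subword of letters \<open>k\<close> by 1, 2, 3, ... means counting the letters \<open>k\<close> read so far.\<close>

definition otrans :: "nat \<Rightarrow> nat \<Rightarrow> tableau \<Rightarrow> tableau" where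
  "otrans d m T = (\<lambda>(r, c). if r \<in> {1..m} \<and> c \<in> {1..d}
     then let i = d + 1 - c; j = m + 1 - r in
       map_option (\<lambda>k. card {(i', j'). T (i', j') = Some k \<and> (i' < i \<or> i' = i \<and> j \<le> j')}) (T (i, j))
     else None)"

text \<open>Orthogonal transpose of the companion \<open>G\<close> of a tableau of outer shape \<open>lam\<close>: in the transpose of
  \<open>G\<close> the cells with entry \<open>i\<close> form a vertical strip, which is relabelled by consecutive integers
  starting at \<open>lam\<^sup>\<or>\<^sub>j + 1\<close> with \<open>j = d - i + 1\<close>.  (In the notation \<open>LR(mu, nu, lam)\<close> the outer
  shape is \<open>lam\<^sup>\<or>\<close>, so there the formula appears without the complement.)  In the English
  convention the strip is traversed downwards, from north-east to south-west.\<close>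

definition otrans_companion :: "nat \<Rightarrow> nat \<Rightarrow> (nat \<Rightarrow> nat) \<Rightarrow> tableau \<Rightarrow> tableau" where
  "otrans_companion d m lam G = (\<lambda>(r, c).
     map_option (\<lambda>i. complement d m lam (d + 1 - i) + card {(r', c'). G (c', r') = Some i \<and> r' \<le> r})
       (G (c, r)))"

definition LR_commuter :: "nat \<Rightarrow> nat \<Rightarrow> tableau \<Rightarrow> tableau" where
  "LR_commuter d m T = rot d m (reversal d m T)"

definition LR_transposer :: "nat \<Rightarrow> nat \<Rightarrow> tableau \<Rightarrow> tableau" where
  "LR_transposer d m T = otrans d m (LR_commuter d m T)"

end

theory Submission
  imports Defs "HOL-Library.Multiset" "HOL-Combinatorics.Transposition"
begin

text \<open>
  An LR tableau \<open>T\<close> of shape \<open>lam/mu\<close> and content \<open>nu\<close> is the same thing as a picture in the sense of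
  Zelevinsky, a bijection between the cells of \<open>lam/mu\<close> and those of \<open>nu\<close> that is suitably monotone in
  both directions: \<open>T\<close> is the row coordinate of the picture, its companion \<open>G\<close> is the row coordinate of
  the inverse picture, and the orthogonal transpose exchanges the two coordinates.  So \<open>G\<close> ranges over
  the semistandard tableaux of shape \<open>nu\<close> whose row word, read from the right and added to \<open>mu\<close>, passes
  through partitions only and ends in \<open>lam\<close>, and this condition is invariant under Knuth equivalence.

  The row word of \<open>G\<close> is a rotated destandardization of the inverse standardization of the row word of
  \<open>T\<close>; hence dual Knuth equivalence of fillings of \<open>lam/mu\<close> is Knuth equivalence of companions.  As all
  Yamanouchi words of content \<open>nu\<close> are Knuth equivalent, the reversal of \<open>T\<close> is \<open>T'\<^sup>\<bullet>\<close> where \<open>T'\<close> is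
  the LR tableau with companion \<open>evac G\<close>.  Rectifications exist by row insertion; they are unique, and
  rotation keeps their shape, by Greene's theorem.

  Evacuation commutes with orthogonal transposition because a Knuth move on a word compatible with \<open>mu\<close>
  becomes a Knuth move again after each letter, a row of \<open>lam/mu\<close>, is replaced by the column of the cell
  that it adds to that row and the order of reading and the columns are reversed.
\<close>

section \<open>Words and Knuth equivalence\<close>

text \<open>\<open>reversal\<close>, \<open>normal_form\<close> and \<open>antinormal_form\<close>
  are definite descriptions, so existence and uniqueness must precede every computation with them.
  Row insertion gives existence without control of the shape, whereas \<open>normal_form\<close>
  asks for a shape inside the box. Greene's invariants are therefore treated for arbitrary reading
  words of a tableau, and this generality serves three times: a rectification is unique, evacuation
  keeps the shape and hence the box, and a column word is Knuth equivalent to the row word. The last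
  point gives access to transposition, because the row word of a transposed companion is computed
  from the column word of the original one. The starting shape of a lattice condition is a parameter
  throughout: 0 for an LR tableau, \<open>mu\<close> for its companion,
  \<open>complement d m lam\<close> after evacuation. In this way one statement about
  \<open>rec_map\<close> covers both directions of a picture, and one statement about dominant words
  covers a companion and its evacuation.\<close>

lemma knuth_equiv_refl [simp]: "knuth_equiv w w"
  by (simp add: knuth_equiv_def)

lemma knuth_equiv_sym: "knuth_equiv w w' \<Longrightarrow> knuth_equiv w' w"
  by (simp add: knuth_equiv_def equivclp_sym)

lemma knuth_equiv_trans [trans]: "knuth_equiv u v \<Longrightarrow> knuth_equiv v w \<Longrightarrow> knuth_equiv u w"
  unfolding knuth_equiv_def by (rule equivclp_trans)

lemma knuth_step_imp_equiv: "knuth_step w w' \<Longrightarrow> knuth_equiv w w'"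
  by (simp add: knuth_equiv_def r_into_equivclp)

text \<open>The device for maps \<open>F\<close> that respect Knuth moves only on a class
  \<open>P\<close> of words, such as words over \<open>{1..d}\<close> or dominant words. Since an
  equivalence runs through moves and inverse moves, \<open>P\<close> has to be invariant in both
  directions; \<open>P w'\<close> belongs to the conclusion because the induction carries it along
  the chain.\<close>

lemma knuth_equiv_transfer:
  assumes "knuth_equiv w w'" and "P w"
    and "\<And>v v'. knuth_step v v' \<Longrightarrow> P v \<longleftrightarrow> P v'"
    and "\<And>v v'. knuth_step v v' \<Longrightarrow> P v \<Longrightarrow> P v' \<Longrightarrow> knuth_equiv (F v) (F v')"
  shows "P w' \<and> knuth_equiv (F w) (F w')"
  using assms(1) unfolding knuth_equiv_def
proof (induction rule: equivclp_induct)
  case base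
  show ?case using assms(2) by simp
next
  case (step y z)
  then have "P z" using assms(3)[of y z] assms(3)[of z y] by blast
  moreover have "knuth_equiv (F y) (F z)"
    using step \<open>P z\<close> assms(4)[of y z] assms(4)[of z y, THEN knuth_equiv_sym] by blast
  ultimately show ?case
    using step knuth_equiv_trans[of "F w" "F y" "F z"] by (simp add: knuth_equiv_def)
qed

lemma knuth_equiv_invariant:
  assumes "knuth_equiv w w'" and "\<And>v v'. knuth_step v v' \<Longrightarrow> P v = P v'"
  shows "P w = P w'"
  using assms(1) unfolding knuth_equiv_def
proof (induction rule: equivclp_induct)
  case (step y z)
  then show ?case using assms(2)[of y z] assms(2)[of z y] by auto
qed simp

lemma knuth_step_context: "knuth_step w w' \<Longrightarrow> knuth_step (a @ w @ b) (a @ w' @ b)"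
proof (induction rule: knuth_step.induct)
  case (1 x y z u v)
  then show ?case using knuth_step.intros(1)[of x y z "a @ u" "v @ b"] by simp
next
  case (2 x y z u v)
  then show ?case using knuth_step.intros(2)[of x y z "a @ u" "v @ b"] by simp
qed

lemma knuth_equiv_context: "knuth_equiv w w' \<Longrightarrow> knuth_equiv (a @ w @ b) (a @ w' @ b)"
  using knuth_equiv_transfer[of w w' "\<lambda>_. True" "\<lambda>w. a @ w @ b"]
    knuth_step_context knuth_step_imp_equiv by blast

lemma knuth_step_mset: "knuth_step w w' \<Longrightarrow> mset w = mset w'"
  by (induction rule: knuth_step.induct) auto

lemma knuth_equiv_mset: "knuth_equiv w w' \<Longrightarrow> mset w = mset w'"
  using knuth_equiv_invariant[of w w' mset] knuth_step_mset by blast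

lemma knuth_equiv_set: "knuth_equiv w w' \<Longrightarrow> set w = set w'"
  by (metis knuth_equiv_mset set_mset_mset)

lemma knuth_equiv_count: "knuth_equiv w w' \<Longrightarrow> count_list w = count_list w'"
  by (metis knuth_equiv_mset count_mset ext)

text \<open>Each relation interchanges \<open>x\<close> and \<open>z\<close>, where \<open>z\<close>
  is a largest letter of the triple. If the filter removes any of the three letters, it removes
  \<open>z\<close>, and then the two filtered words coincide.\<close>

lemma knuth_equiv_filter_le:
  "knuth_equiv w w' \<Longrightarrow> knuth_equiv (filter (\<lambda>x. x \<le> b) w) (filter (\<lambda>x. x \<le> b) w')"
proof -
  have *: "knuth_equiv (filter (\<lambda>x. x \<le> b) v) (filter (\<lambda>x. x \<le> b) v')" if "knuth_step v v'" for v v'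
    using that
  proof cases
    case (1 x y z p q)
    then show ?thesis
      using knuth_step.intros(1)[of x y z "filter (\<lambda>x. x \<le> b) p" "filter (\<lambda>x. x \<le> b) q"]
      by (auto intro: knuth_step_imp_equiv)
  next
    case (2 x y z p q)
    then show ?thesis
      using knuth_step.intros(2)[of x y z "filter (\<lambda>x. x \<le> b) p" "filter (\<lambda>x. x \<le> b) q"]
      by (auto intro: knuth_step_imp_equiv)
  qed
  show "knuth_equiv w w' \<Longrightarrow> ?thesis"
    using knuth_equiv_transfer[of w w' "\<lambda>_. True" "filter (\<lambda>x. x \<le> b)"] * by blast
qed

section \<open>Reversed complements of words, the effect of rotation on row words\<close>

definition rev_compl :: "nat \<Rightarrow> nat list \<Rightarrow> nat list" where
  "rev_compl d w = rev (map (\<lambda>x. d + 1 - x) w)"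

lemma rev_compl_append: "rev_compl d (u @ v) = rev_compl d v @ rev_compl d u"
  by (simp add: rev_compl_def)

lemma rev_compl_rev_compl: "set w \<subseteq> {1..d} \<Longrightarrow> rev_compl d (rev_compl d w) = w"
  unfolding rev_compl_def rev_map[symmetric] by (auto intro!: map_idI)

lemma set_rev_compl: "set w \<subseteq> {1..d} \<Longrightarrow> set (rev_compl d w) \<subseteq> {1..d}"
  by (fastforce simp: rev_compl_def)

lemma count_rev_compl:
  assumes "set w \<subseteq> {1..d}" "x \<in> {1..d}"
  shows "count_list (rev_compl d w) x = count_list w (d + 1 - x)"
proof -
  have "count_list (map (\<lambda>x. d + 1 - x) w) x = count_list w (d + 1 - x)"
    using assms by (induction w) auto
  then show ?thesis by (simp add: rev_compl_def)
qed

text \<open>Reversing a word and complementing its letters interchanges the two kinds of Knuth move.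
  The bound on the letters makes the truncated subtraction strictly order reversing.\<close>

lemma knuth_step_rev_compl:
  assumes "knuth_step w w'" "set w \<subseteq> {1..d}"
  shows "knuth_step (rev_compl d w) (rev_compl d w')"
  using assms(1)
proof cases
  case (1 x y z u v)
  then have "d + 1 - z \<le> d + 1 - y" "d + 1 - y < d + 1 - x"
    using assms(2) by auto
  from knuth_step.intros(2)[OF this, of "rev_compl d v" "rev_compl d u"] show ?thesis
    using 1 by (simp add: rev_compl_def)
next
  case (2 x y z u v)
  then have "d + 1 - z < d + 1 - y" "d + 1 - y \<le> d + 1 - x"
    using assms(2) by auto
  from knuth_step.intros(1)[OF this, of "rev_compl d v" "rev_compl d u"] show ?thesis
    using 2 by (simp add: rev_compl_def)
qed

lemma knuth_equiv_rev_compl: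
  assumes "knuth_equiv w w'" "set w \<subseteq> {1..d}"
  shows "knuth_equiv (rev_compl d w) (rev_compl d w')"
proof -
  have "set w' \<subseteq> {1..d} \<and> ?thesis"
  proof (rule knuth_equiv_transfer[OF assms(1), of "\<lambda>w. set w \<subseteq> {1..d}" "rev_compl d", OF assms(2)])
    show "set v \<subseteq> {1..d} \<longleftrightarrow> set v' \<subseteq> {1..d}" if "knuth_step v v'" for v v'
      using knuth_equiv_set[OF knuth_step_imp_equiv[OF that]] by simp
    show "knuth_equiv (rev_compl d v) (rev_compl d v')" if "knuth_step v v'" "set v \<subseteq> {1..d}" for v v'
      using knuth_step_imp_equiv[OF knuth_step_rev_compl[OF that]] .
  qed
  then show ?thesis ..
qed

section \<open>Words that, added to a shape from the right, pass through partitions only\<close>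

definition dominant :: "(nat \<Rightarrow> nat) \<Rightarrow> nat list \<Rightarrow> bool" where
  "dominant g w \<longleftrightarrow>
     (\<forall>u v. w = u @ v \<longrightarrow> (\<forall>i\<ge>1. g (i + 1) + count_list v (i + 1) \<le> g i + count_list v i))"

lemma dominant_Nil: "dominant g [] \<longleftrightarrow> (\<forall>i\<ge>1. g (i + 1) \<le> g i)"
  by (simp add: dominant_def)

lemma dominant_Cons:
  "dominant g (x # w) \<longleftrightarrow> dominant g w \<and>
     (\<forall>i\<ge>1. g (i + 1) + count_list (x # w) (i + 1) \<le> g i + count_list (x # w) i)"
proof -
  have "(\<forall>u v. x # w = u @ v \<longrightarrow> P v) \<longleftrightarrow> P (x # w) \<and> (\<forall>u v. w = u @ v \<longrightarrow> P v)" for P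
    unfolding Cons_eq_append_conv by auto
  from this[of "\<lambda>v. \<forall>i\<ge>1. g (i + 1) + count_list v (i + 1) \<le> g i + count_list v i"]
  show ?thesis unfolding dominant_def by (simp only: conj_commute)
qed

lemma dominant_append:
  "dominant g (u @ v) \<longleftrightarrow> dominant g v \<and> dominant (\<lambda>i. g i + count_list v i) u"
proof (induction u)
  case Nil
  have "dominant g v \<Longrightarrow> dominant (\<lambda>i. g i + count_list v i) []"
    unfolding dominant_Nil by (auto simp: dominant_def)
  then show ?case by auto
next
  case (Cons a u)
  have *: "g i + count_list (a # u @ v) i = g i + count_list v i + count_list (a # u) i" for i by simp
  show ?case unfolding append_Cons dominant_Cons[of _ a] Cons.IH * by (rule conj_assoc)
qed

lemma dominant_antimono:
  assumes "dominant g (u @ v)" "1 \<le> x" "x \<le> y"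
  shows "g y + count_list v y \<le> g x + count_list v x"
  using assms(3,2)
proof (induction y rule: dec_induct)
  case (step n)
  moreover have "g (Suc n) + count_list v (Suc n) \<le> g n + count_list v n"
    using assms(1) step unfolding dominant_def by auto
  ultimately show ?case by simp
qed simp

text \<open>By \<open>dominant_append\<close> only the three letters matter. Adding to row
  \<open>x\<close> and adding to row \<open>z\<close> influence each other only if
  \<open>z = x + 1\<close>. Then \<open>y\<close> equals \<open>z\<close> in the first relation and
  \<open>x\<close> in the second, and the condition that comes with adding \<open>y\<close> makes
  both orders of \<open>x\<close> and \<open>z\<close> admissible.\<close>

lemma dominant_step:
  assumes "knuth_step w w'"
  shows "dominant g w \<longleftrightarrow> dominant g w'"
proof -
  have cong: "dominant g (u @ a @ v) \<longleftrightarrow> dominant g (u @ b @ v)"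
    if "mset a = mset b" "dominant (\<lambda>i. g i + count_list v i) a \<longleftrightarrow> dominant (\<lambda>i. g i + count_list v i) b"
    for u a b v
  proof -
    have "count_list a = count_list b" using that(1) by (metis count_mset ext)
    then show ?thesis using that(2) by (simp add: dominant_append)
  qed
  show ?thesis using assms
  proof cases
    case (1 x y z u v)
    have "dominant h [y, x, z] \<longleftrightarrow> dominant h [y, z, x]" for h
      unfolding dominant_Cons dominant_Nil using 1(3,4)
      apply (simp only: all_conj_distrib[symmetric] imp_conjR[symmetric] conj_assoc[symmetric])
      apply (rule all_cong1)
      by (auto split: if_splits)
    then show ?thesis unfolding 1(1,2) by (intro cong) auto
  next
    case (2 x y z u v)
    have "dominant h [x, z, y] \<longleftrightarrow> dominant h [z, x, y]" for h
      unfolding dominant_Cons dominant_Nil using 2(3,4)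
      apply (simp only: all_conj_distrib[symmetric] imp_conjR[symmetric] conj_assoc[symmetric])
      apply (rule all_cong1)
      by (auto split: if_splits)
    then show ?thesis unfolding 2(1,2) by (intro cong) auto
  qed
qed

lemma dominant_knuth: "knuth_equiv w w' \<Longrightarrow> dominant g w \<longleftrightarrow> dominant g w'"
  using knuth_equiv_invariant[of w w' "dominant g"] dominant_step by blast

text \<open>A suffix of the reversed complement comes from a prefix of \<open>w\<close>. Taking this
  prefix away from \<open>lam\<close> leaves \<open>mu\<close> plus a suffix of \<open>w\<close>,
  which is a partition by assumption, and the rotated complement of a partition in the box is a
  partition.\<close>

lemma dominant_rev_compl:
  assumes "dominant mu w" "set w \<subseteq> {1..d}" "\<And>x. lam x = mu x + count_list w x" "\<And>x. lam x \<le> m"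
  shows "dominant (complement d m lam) (rev_compl d w)"
  unfolding dominant_def
proof (intro allI impI)
  fix u v i assume *: "rev_compl d w = u @ v" "1 \<le> (i::nat)"
  define a b where "a = rev_compl d v" "b = rev_compl d u"
  have w: "w = a @ b" using * rev_compl_rev_compl[OF assms(2)] by (simp add: rev_compl_append a_b_def)
  have sv: "set v \<subseteq> {1..d}" using set_rev_compl[OF assms(2)] * by auto
  show "complement d m lam (i + 1) + count_list v (i + 1) \<le> complement d m lam i + count_list v i"
  proof (cases "i + 1 \<le> d")
    case True
    have "count_list v (i + 1) = count_list a (d - i)" "count_list v i = count_list a (d + 1 - i)"
      using count_rev_compl[of a d "i+1"] count_rev_compl[of a d i] True *
        set_rev_compl[OF sv] rev_compl_rev_compl[OF sv] by (auto simp: a_b_def)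
    moreover have "mu (d - i + 1) + count_list b (d - i + 1) \<le> mu (d - i) + count_list b (d - i)"
      using assms(1) True unfolding w dominant_def by auto
    moreover have "d - i + 1 = d + 1 - i" using True by simp
    ultimately have "m - lam (d - i) + count_list a (d - i) \<le> m - lam (d + 1 - i) + count_list a (d + 1 - i)"
      using assms(3)[of "d - i"] assms(3)[of "d + 1 - i"] assms(4)[of "d - i"] assms(4)[of "d + 1 - i"]
      unfolding w count_list_append by simp linarith
    then show ?thesis
      using True *(2) \<open>count_list v (i + 1) = _\<close> \<open>count_list v i = _\<close>
      by (simp add: complement_def)
  next
    case False
    then have "count_list v (i + 1) = 0" using sv by (auto simp: count_list_0_iff)
    then show ?thesis using False by (simp add: complement_def)
  qed
qed

section \<open>Columns of the added cells, and orthogonal transposition of words\<close>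

fun col_word :: "(nat \<Rightarrow> nat) \<Rightarrow> nat list \<Rightarrow> nat list" where
  "col_word g [] = []"
| "col_word g (x # w) = (g x + count_list w x + 1) # col_word g w"

lemma col_word_append: "col_word g (u @ v) = col_word (\<lambda>i. g i + count_list v i) u @ col_word g v"
  by (induction u) auto

lemma col_word_bounds:
  "j \<in> set (col_word g w) \<Longrightarrow> \<exists>x\<in>set w. 1 \<le> j \<and> j \<le> g x + count_list w x"
proof (induction w)
  case (Cons a w)
  then consider "j = g a + count_list w a + 1" | "j \<in> set (col_word g w)" by auto
  then show ?case
  proof cases
    case 2
    then show ?thesis using Cons.IH by (auto intro: le_SucI)
  qed auto
qed simp

definition ot_word :: "nat \<Rightarrow> (nat \<Rightarrow> nat) \<Rightarrow> nat list \<Rightarrow> nat list" where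
  "ot_word m g w = rev_compl m (col_word g w)"

text \<open>In a dominant word a letter of the triple in a lower row adds its cell weakly further to
  the left, so passing from rows to columns reverses the order of the letters.
  \<open>rev_compl m\<close> restores this order and reverses the word, whence a move of one kind
  becomes the inverse of a move of the other kind. The inequalities between the columns are
  dominance at suffixes of the triple; the bound \<open>m\<close> keeps the complement order
  reversing.\<close>

lemma ot_word_step:
  assumes "knuth_step w w'" "dominant g w" "dominant g w'" "0 \<notin> set w"
    "\<And>x. x \<in> set w \<Longrightarrow> g x + count_list w x \<le> m"
  shows "knuth_step (ot_word m g w') (ot_word m g w)"
  using assms(1)
proof cases
  case (1 x y z u v)
  define h where "h = (\<lambda>i. g i + count_list v i)"
  have xyz: "0 < x" "x < y" "y \<le> z" using 1 assms(4) by auto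
  have dom: "dominant h [y, x, z]" "dominant h [y, z, x]"
    using assms(2,3) unfolding 1 by (simp_all add: dominant_append h_def del: append_Cons append_Nil)
  \<comment> \<open>In both words \<open>z\<close> is read before \<open>y\<close> and may be equal
    to it, whence the summand \<open>count_list [z] y\<close>. As \<open>x\<close> and
    \<open>z\<close> differ, their own columns do not depend on the order in which they are
    read.\<close>
  let ?jy = "h y + count_list [z] y + 1"
  have lt: "h z + 1 < ?jy"
    using dominant_antimono[of h "[y]" "[z, x]" y z] dom(2) xyz by auto
  have le: "?jy \<le> h x + 1"
    using dominant_antimono[of h "[]" "[y, x, z]" x y] dom(1) xyz by auto
  have bd: "h x + 1 \<le> m"
    using assms(5)[of x] xyz unfolding 1 h_def by auto
  have q: "count_list ([y, x, z] @ v) = count_list ([y, z, x] @ v)" by auto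
  let ?u = "rev_compl m (col_word (\<lambda>i. g i + count_list ([y, x, z] @ v) i) u)"
  have "ot_word m g w = rev_compl m (col_word g v) @ [m + 1 - (h z + 1), m + 1 - (h x + 1), m + 1 - ?jy] @ ?u"
    "ot_word m g w' = rev_compl m (col_word g v) @ [m + 1 - (h x + 1), m + 1 - (h z + 1), m + 1 - ?jy] @ ?u"
    unfolding ot_word_def 1 col_word_append[of _ u] col_word_append[of _ "[_,_,_]"] q h_def rev_compl_append append_assoc
    using xyz
    by (auto simp: rev_compl_def)
  then show ?thesis
    using knuth_step.intros(2)[of "m + 1 - (h x + 1)" "m + 1 - ?jy" "m + 1 - (h z + 1)"] lt le bd by simp
next
  case (2 x y z u v)
  define h where "h = (\<lambda>i. g i + count_list v i)"
  have xyz: "0 < x" "x \<le> y" "y < z" using 2 assms(4) by auto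
  have dom: "dominant h [x, z, y]" "dominant h [z, x, y]"
    using assms(2,3) unfolding 2 by (simp_all add: dominant_append h_def del: append_Cons append_Nil)
  \<comment> \<open>Here \<open>y\<close> is read first and may be equal to
    \<open>x\<close>.\<close>
  let ?jx = "h x + count_list [y] x + 1"
  have lt: "h y + 1 < ?jx"
    using dominant_antimono[of h "[x, z]" "[y]" x y] dom(1) xyz by auto
  have le: "h z + 1 \<le> h y + 1"
    using dominant_antimono[of h "[x]" "[z, y]" y z] dom(1) xyz by auto
  have bd: "?jx \<le> m"
    using assms(5)[of x] xyz unfolding 2 h_def by auto
  have q: "count_list ([x, z, y] @ v) = count_list ([z, x, y] @ v)" by auto
  let ?u = "rev_compl m (col_word (\<lambda>i. g i + count_list ([x, z, y] @ v) i) u)"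
  have "ot_word m g w = rev_compl m (col_word g v) @ [m + 1 - (h y + 1), m + 1 - (h z + 1), m + 1 - ?jx] @ ?u"
    "ot_word m g w' = rev_compl m (col_word g v) @ [m + 1 - (h y + 1), m + 1 - ?jx, m + 1 - (h z + 1)] @ ?u"
    unfolding ot_word_def 2 col_word_append[of _ u] col_word_append[of _ "[_,_,_]"] q h_def rev_compl_append append_assoc
    using xyz
    by (auto simp: rev_compl_def)
  then show ?thesis
    using knuth_step.intros(1)[of "m + 1 - ?jx" "m + 1 - (h y + 1)" "m + 1 - (h z + 1)"] lt le bd by simp
qed

lemma ot_word_knuth:
  assumes "knuth_equiv w w'" "dominant g w" "0 \<notin> set w" "\<And>x. x \<in> set w \<Longrightarrow> g x + count_list w x \<le> m"
  shows "knuth_equiv (ot_word m g w) (ot_word m g w')"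
proof -
  let ?P = "\<lambda>w. dominant g w \<and> 0 \<notin> set w \<and> (\<forall>x\<in>set w. g x + count_list w x \<le> m)"
  have "?P v \<longleftrightarrow> ?P v'" if "knuth_step v v'" for v v'
    using knuth_equiv_set[OF knuth_step_imp_equiv[OF that]]
      knuth_equiv_count[OF knuth_step_imp_equiv[OF that]] dominant_step[OF that] by simp
  moreover have "knuth_equiv (ot_word m g v) (ot_word m g v')" if "knuth_step v v'" "?P v" "?P v'" for v v'
    using ot_word_step[OF that(1)] that(2,3) knuth_step_imp_equiv knuth_equiv_sym by blast
  ultimately show ?thesis
    using knuth_equiv_transfer[OF assms(1), of ?P "ot_word m g"] assms(2-4) by blast
qed

text \<open>Read from the right, the reversed complement takes the cells of \<open>w\<close> away
  from the final shape, last added first removed, in rotated coordinates: column \<open>j\<close> of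
  row \<open>x\<close> turns into column \<open>m + 1 - j\<close> of row \<open>d + 1 - x\<close>.
  Hence both sides equal \<open>col_word mu w\<close>. The value of \<open>g\<close> is prescribed
  only at rows that occur, a condition that the induction on \<open>w\<close> can maintain.\<close>

lemma ot_word_rev_compl:
  assumes "set w \<subseteq> {1..d}"
    and "\<And>x. x \<in> set w \<Longrightarrow> mu x + count_list w x \<le> m \<and> g (d + 1 - x) = m - (mu x + count_list w x)"
  shows "ot_word m g (rev_compl d w) = rev_compl m (ot_word m mu w)"
proof -
  have "set (col_word mu w) \<subseteq> {1..m}"
  proof
    fix j assume "j \<in> set (col_word mu w)"
    then obtain x where "x \<in> set w" "1 \<le> j" "j \<le> mu x + count_list w x"
      using col_word_bounds by blast
    then show "j \<in> {1..m}" using assms(2)[of x] by auto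
  qed
  moreover have "ot_word m g (rev_compl d w) = col_word mu w"
    using assms
  proof (induction w arbitrary: g)
    case Nil
    show ?case by (simp add: ot_word_def rev_compl_def)
  next
    case (Cons x w)
    \<comment> \<open>The first letter of \<open>x # w\<close> becomes the last letter of the
      reversed complement and is read first; \<open>?g\<close> is the shape after reading
      it.\<close>
    let ?g = "\<lambda>i. g i + count_list [d + 1 - x] i"
    have x: "mu x + count_list w x + 1 \<le> m" "g (d + 1 - x) = m - (mu x + count_list w x + 1)" "x \<in> {1..d}"
      using Cons.prems(2)[of x] Cons.prems(1) by auto
    have "mu y + count_list w y \<le> m \<and> ?g (d + 1 - y) = m - (mu y + count_list w y)" if "y \<in> set w" for y
    proof -
      have "d + 1 - y = d + 1 - x \<longleftrightarrow> y = x" using that Cons.prems(1) x(3) by auto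
      then show ?thesis using Cons.prems(2)[of y] that x by auto
    qed
    then have IH: "ot_word m ?g (rev_compl d w) = col_word mu w"
      using Cons.prems(1) by (intro Cons.IH) auto
    have "ot_word m g (rev_compl d (x # w)) = ot_word m g (rev_compl d w @ [d + 1 - x])"
      by (simp add: rev_compl_def)
    also have "\<dots> = (m + 1 - (g (d + 1 - x) + 1)) # ot_word m ?g (rev_compl d w)"
      unfolding ot_word_def col_word_append by (simp add: rev_compl_def)
    finally show ?case unfolding IH using x by simp
  qed
  ultimately show ?thesis using rev_compl_rev_compl by (simp add: ot_word_def)
qed

section \<open>Standardization: Knuth equivalence under a monotone identification of letters\<close>

lemma knuth_destandardize:
  fixes f :: "nat \<Rightarrow> nat"
  assumes "mono f" "knuth_equiv p q" "sorted_wrt (\<lambda>a b. f a = f b \<longrightarrow> a < b) p"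
  shows "knuth_equiv (map f p) (map f q)"
proof -
  let ?P = "\<lambda>p. distinct p \<and> sorted_wrt (\<lambda>a b. f a = f b \<longrightarrow> a < b) p"
  have d: "distinct p" if "sorted_wrt (\<lambda>a b. f a = f b \<longrightarrow> a < b) p" for p
    using that by (induction p) auto
  have f: "f a \<le> f b" if "a \<le> b" for a b using assms(1) that by (rule monoD)
  have key: "?P v \<longleftrightarrow> ?P v'" "?P v \<Longrightarrow> knuth_step (map f v) (map f v')" if "knuth_step v v'" for v v'
  proof -
    from that have "(?P v \<longleftrightarrow> ?P v') \<and> (?P v \<longrightarrow> knuth_step (map f v) (map f v'))"
    proof cases
      case (1 x y z a b)
      \<comment> \<open>\<open>y\<close> stands before \<open>x\<close>, so sortedness demands
        \<open>y < x\<close> as soon as \<open>f\<close> identifies the two. Since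
        \<open>x < y\<close>, either \<open>f\<close> separates them and the images form a Knuth
        triple again, or neither word satisfies \<open>?P\<close>.\<close>
      have *: "f x < f y" "f x < f z" if "f x = f y \<longrightarrow> y < x"
        using that f[of x y] f[of y z] 1(3,4) by auto
      show ?thesis
      proof (cases "f x = f y \<longrightarrow> y < x")
        case True
        then show ?thesis unfolding 1(1,2) using *[OF True] 1(3,4) f[of y z]
            knuth_step.intros(1)[of "f x" "f y" "f z" "map f a" "map f b"]
          by (auto simp: sorted_wrt_append)
      next
        case False
        then show ?thesis unfolding 1(1,2) by (auto simp: sorted_wrt_append)
      qed
    next
      case (2 x y z a b)
      have *: "f y < f z" "f x < f z" if "f z = f y \<longrightarrow> z < y"
        using that f[of x y] f[of y z] 2(3,4) by auto
      show ?thesis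
      proof (cases "f z = f y \<longrightarrow> z < y")
        case True
        then show ?thesis unfolding 2(1,2) using *[OF True] 2(3,4) f[of x y]
            knuth_step.intros(2)[of "f x" "f y" "f z" "map f a" "map f b"]
          by (auto simp: sorted_wrt_append)
      next
        case False
        then show ?thesis unfolding 2(1,2) by (auto simp: sorted_wrt_append)
      qed
    qed
    then show "?P v \<longleftrightarrow> ?P v'" "?P v \<Longrightarrow> knuth_step (map f v) (map f v')" by auto
  qed
  have "?P p" using d[OF assms(3)] assms(3) by simp
  then have "?P q \<and> knuth_equiv (map f p) (map f q)"
  proof (rule knuth_equiv_transfer[OF assms(2)])
    show "?P v \<longleftrightarrow> ?P v'" if "knuth_step v v'" for v v' using that by (rule key(1))
    show "knuth_equiv (map f v) (map f v')" if "knuth_step v v'" "?P v" for v v'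
      using key(2)[OF that] by (rule knuth_step_imp_equiv)
  qed
  then show ?thesis by (rule conjunct2)
qed

lemma standardization_unique:
  fixes f :: "nat \<Rightarrow> nat"
  assumes "mset p = mset q" "map f p = map f q" "sorted_wrt (\<lambda>a b. f a = f b \<longrightarrow> a < b) p"
    "sorted_wrt (\<lambda>a b. f a = f b \<longrightarrow> a < b) q"
  shows "p = q"
  using assms
proof (induction p arbitrary: q)
  case (Cons a p)
  then obtain b q' where q: "q = b # q'" by (cases q) auto
  have "a = b"
  proof (rule ccontr)
    assume "a \<noteq> b"
    moreover have "set (a # p) = set (b # q')" using Cons.prems(1) q by (metis set_mset_mset)
    ultimately have "a \<in> set q'" "b \<in> set p" by auto
    then show False using Cons.prems q by fastforce
  qed
  then show ?case using Cons q by auto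
qed simp

text \<open>Converse of \<open>knuth_destandardize\<close>. A Knuth move on images lifts to the
  letters above them: a smaller image belongs to a smaller letter, and letters with equal images
  stand in increasing order. The lifted chain ends in a rearrangement of \<open>q\<close> with the
  same image as \<open>q\<close>, which \<open>standardization_unique\<close> identifies with
  \<open>q\<close>.\<close>

lemma knuth_standardize:
  fixes f :: "nat \<Rightarrow> nat"
  assumes "mono f" "knuth_equiv (map f p) (map f q)" "mset p = mset q"
    and "sorted_wrt (\<lambda>a b. f a = f b \<longrightarrow> a < b) p" "sorted_wrt (\<lambda>a b. f a = f b \<longrightarrow> a < b) q"
  shows "knuth_equiv p q"
proof -
  have lt: "a < b" if "f a < f b" for a b
  proof (rule ccontr)
    assume "\<not> a < b"
    then have "f b \<le> f a" by (intro monoD[OF assms(1)]) simp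
    then show False using that by simp
  qed
  have lift: "\<exists>r'. v' = map f r' \<and> sorted_wrt (\<lambda>a b. f a = f b \<longrightarrow> a < b) r' \<and> knuth_equiv r r'"
    if st: "knuth_step v v' \<or> knuth_step v' v" and v: "v = map f r"
      and sr: "sorted_wrt (\<lambda>a b. f a = f b \<longrightarrow> a < b) r" for v v' r
    using st
  proof
    assume "knuth_step v v'"
    then show ?thesis
    proof cases
      case (1 x y z a b)
      then obtain A X Y Z B where r: "r = A @ [Y, X, Z] @ B" "f X = x" "f Y = y" "f Z = z" "map f A = a" "map f B = b"
        using v by (auto simp: append_eq_map_conv Cons_eq_map_conv map_eq_append_conv map_eq_Cons_conv)
      have "X < Y" "Y \<le> Z" using lt[of X Y] lt[of Y Z] 1 r sr by (auto simp: sorted_wrt_append le_less)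
      then have "knuth_step r (A @ [Y, Z, X] @ B)" unfolding r by (rule knuth_step.intros)
      moreover have "sorted_wrt (\<lambda>a b. f a = f b \<longrightarrow> a < b) (A @ [Y, Z, X] @ B)"
        using sr 1 r by (auto simp: sorted_wrt_append)
      ultimately show ?thesis using 1 r knuth_step_imp_equiv by (intro exI[of _ "A @ [Y, Z, X] @ B"]) auto
    next
      case (2 x y z a b)
      then obtain A X Y Z B where r: "r = A @ [X, Z, Y] @ B" "f X = x" "f Y = y" "f Z = z" "map f A = a" "map f B = b"
        using v by (auto simp: append_eq_map_conv Cons_eq_map_conv map_eq_append_conv map_eq_Cons_conv)
      have "X \<le> Y" "Y < Z" using lt[of X Y] lt[of Y Z] 2 r sr by (auto simp: sorted_wrt_append le_less)
      then have "knuth_step r (A @ [Z, X, Y] @ B)" unfolding r by (rule knuth_step.intros)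
      moreover have "sorted_wrt (\<lambda>a b. f a = f b \<longrightarrow> a < b) (A @ [Z, X, Y] @ B)"
        using sr 2 r by (auto simp: sorted_wrt_append)
      ultimately show ?thesis using 2 r knuth_step_imp_equiv by (intro exI[of _ "A @ [Z, X, Y] @ B"]) auto
    qed
  next
    assume "knuth_step v' v"
    then show ?thesis
    proof cases
      case (1 x y z a b)
      then obtain A X Y Z B where r: "r = A @ [Y, Z, X] @ B" "f X = x" "f Y = y" "f Z = z" "map f A = a" "map f B = b"
        using v by (auto simp: append_eq_map_conv Cons_eq_map_conv map_eq_append_conv map_eq_Cons_conv)
      have "X < Y" "Y \<le> Z" using lt[of X Y] lt[of Y Z] 1 r sr by (auto simp: sorted_wrt_append le_less)
      then have "knuth_step (A @ [Y, X, Z] @ B) r" unfolding r by (rule knuth_step.intros)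
      moreover have "sorted_wrt (\<lambda>a b. f a = f b \<longrightarrow> a < b) (A @ [Y, X, Z] @ B)"
        using sr 1 r by (auto simp: sorted_wrt_append)
      ultimately show ?thesis using 1 r knuth_step_imp_equiv knuth_equiv_sym
        by (intro exI[of _ "A @ [Y, X, Z] @ B"]) auto
    next
      case (2 x y z a b)
      then obtain A X Y Z B where r: "r = A @ [Z, X, Y] @ B" "f X = x" "f Y = y" "f Z = z" "map f A = a" "map f B = b"
        using v by (auto simp: append_eq_map_conv Cons_eq_map_conv map_eq_append_conv map_eq_Cons_conv)
      have "X \<le> Y" "Y < Z" using lt[of X Y] lt[of Y Z] 2 r sr by (auto simp: sorted_wrt_append le_less)
      then have "knuth_step (A @ [X, Z, Y] @ B) r" unfolding r by (rule knuth_step.intros)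
      moreover have "sorted_wrt (\<lambda>a b. f a = f b \<longrightarrow> a < b) (A @ [X, Z, Y] @ B)"
        using sr 2 r by (auto simp: sorted_wrt_append)
      ultimately show ?thesis using 2 r knuth_step_imp_equiv knuth_equiv_sym
        by (intro exI[of _ "A @ [X, Z, Y] @ B"]) auto
    qed
  qed
  have "\<exists>r. map f q = map f r \<and> sorted_wrt (\<lambda>a b. f a = f b \<longrightarrow> a < b) r \<and> knuth_equiv p r"
    using assms(2) unfolding knuth_equiv_def[THEN fun_cong, THEN fun_cong, of "map f p" "map f q"]
  proof (induction rule: equivclp_induct)
    case base
    then show ?case using assms(4) by auto
  next
    case (step y z)
    then obtain r where "y = map f r" "sorted_wrt (\<lambda>a b. f a = f b \<longrightarrow> a < b) r" "knuth_equiv p r"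
      by blast
    then show ?case using lift[OF step(2)] knuth_equiv_trans by blast
  qed
  then obtain r where r: "map f q = map f r" "sorted_wrt (\<lambda>a b. f a = f b \<longrightarrow> a < b) r" "knuth_equiv p r"
    by blast
  have "q = r" using standardization_unique[OF _ r(1) assms(5) r(2)] assms(3) knuth_equiv_mset[OF r(3)] by simp
  then show ?thesis using r by simp
qed

section \<open>Greene's invariants and uniqueness of rectification\<close>

definition order_ideal :: "(nat \<times> nat) set \<Rightarrow> bool" where
  "order_ideal S \<longleftrightarrow> finite S \<and> (\<forall>(i, j)\<in>S. 1 \<le> i \<and> 1 \<le> j \<and> {1..i} \<times> {1..j} \<subseteq> S)"

lemma order_idealD:
  assumes "order_ideal S" "(i, j) \<in> S"
  shows "1 \<le> i" "1 \<le> j" "1 \<le> i' \<Longrightarrow> i' \<le> i \<Longrightarrow> 1 \<le> j' \<Longrightarrow> j' \<le> j \<Longrightarrow> (i', j') \<in> S"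
proof -
  have "1 \<le> i \<and> 1 \<le> j \<and> {1..i} \<times> {1..j} \<subseteq> S" using assms unfolding order_ideal_def by blast
  then show "1 \<le> i" "1 \<le> j" "1 \<le> i' \<Longrightarrow> i' \<le> i \<Longrightarrow> 1 \<le> j' \<Longrightarrow> j' \<le> j \<Longrightarrow> (i', j') \<in> S" by auto
qed

lemma order_ideal_finite: "order_ideal S \<Longrightarrow> finite S"
  by (simp add: order_ideal_def)

text \<open>More general than row words on purpose: the column word of a tableau is a reading as
  well and has to be compared with its row word.\<close>

definition reading :: "(nat \<times> nat) set \<Rightarrow> (nat \<times> nat) list \<Rightarrow> bool" where
  "reading S L \<longleftrightarrow> distinct L \<and> set L = S \<and>
     sorted_wrt (\<lambda>(i, j) (i', j'). (i = i' \<longrightarrow> j < j') \<and> (j = j' \<longrightarrow> i' < i)) L"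

abbreviation word_of :: "tableau \<Rightarrow> (nat \<times> nat) list \<Rightarrow> nat list" where
  "word_of T L \<equiv> map (\<lambda>c. the (T c)) L"

abbreviation coloring :: "nat \<Rightarrow> (nat \<times> nat) list \<Rightarrow> bool" where
  "coloring k \<equiv> sorted_wrt (\<lambda>p q. snd p = snd q \<and> snd p < k \<longrightarrow> fst p \<le> fst q)"

text \<open>A colouring of the letters of a word, where only the colours below \<open>k\<close> count, splits off \<open>k\<close>
  disjoint weakly increasing subwords; \<open>n\<close> is their total length, as in Greene's theorem.\<close>

definition greene :: "nat \<Rightarrow> nat list \<Rightarrow> nat \<Rightarrow> bool" where
  "greene k w n \<longleftrightarrow>
     (\<exists>ps. map fst ps = w \<and> coloring k ps \<and> length (filter (\<lambda>p. snd p < k) ps) = n)"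

lemma coloring_swap:
  assumes "coloring k ps" "a < k" "b < k"
  shows "coloring k (map (map_prod id (transpose a b)) ps)"
    and "length (filter (\<lambda>p. snd p < k) (map (map_prod id (transpose a b)) ps))
       = length (filter (\<lambda>p. snd p < k) ps)"
proof -
  have lt: "transpose a b c < k \<longleftrightarrow> c < k" for c using assms(2,3) by (auto simp: transpose_def)
  have eq: "transpose a b c = transpose a b c' \<longleftrightarrow> c = c'" for c c'
    by (metis transpose_involutory)
  show "coloring k (map (map_prod id (transpose a b)) ps)"
    using assms(1) by (simp add: sorted_wrt_map lt eq)
  show "length (filter (\<lambda>p. snd p < k) (map (map_prod id (transpose a b)) ps))
       = length (filter (\<lambda>p. snd p < k) ps)"
    by (simp add: filter_map o_def lt)
qed

text \<open>The two colours \<open>a\<close> and \<open>b\<close> exchange their tails behind the three letters of the Knuth relation.\<close>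

lemma coloring_exchange:
  assumes "coloring k (pu @ pm @ pv)" "set pm = {(x, a), (y, b), (z, a)}" "a < k" "b < k" "x \<le> y" "y \<le> z"
    and "coloring k pm'" "set pm' = {(x, a), (y, c), (z, b)}" "c = a \<or> c = b"
  shows "coloring k (pu @ pm' @ map (map_prod id (transpose a b)) pv)"
proof -
  let ?pv = "map (map_prod id (transpose a b)) pv"
  have col: "coloring k pu" "coloring k pv"
    and um: "\<And>p q. p \<in> set pu \<Longrightarrow> q \<in> set pm \<Longrightarrow> snd p = snd q \<Longrightarrow> snd p < k \<Longrightarrow> fst p \<le> fst q"
    and mv: "\<And>p q. p \<in> set pm \<Longrightarrow> q \<in> set pv \<Longrightarrow> snd p = snd q \<Longrightarrow> snd p < k \<Longrightarrow> fst p \<le> fst q"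
    and uv: "\<And>p q. p \<in> set pu \<Longrightarrow> q \<in> set pv \<Longrightarrow> snd p = snd q \<Longrightarrow> snd p < k \<Longrightarrow> fst p \<le> fst q"
    using assms(1) by (auto simp: sorted_wrt_append)
  have pu: "fst p \<le> x" if "p \<in> set pu" "snd p = a" for p using um[of p "(x, a)"] that assms(2,3) by simp
  have pu': "fst p \<le> y" if "p \<in> set pu" "snd p = b" for p using um[of p "(y, b)"] that assms(2,4) by simp
  have pv: "y \<le> fst q" if "q \<in> set ?pv" "snd q = a" for q
  proof -
    from that(1) obtain r where r: "r \<in> set pv" "q = map_prod id (transpose a b) r" by auto
    then have "snd r = b" using that(2) by (auto simp: transpose_def split: if_splits)
    then show ?thesis using mv[of "(y, b)" r] r assms(2,4) by simp
  qed
  have pv': "z \<le> fst q" if "q \<in> set ?pv" "snd q = b" for q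
  proof -
    from that(1) obtain r where r: "r \<in> set pv" "q = map_prod id (transpose a b) r" by auto
    then have "snd r = a" using that(2) by (auto simp: transpose_def split: if_splits)
    then show ?thesis using mv[of "(z, a)" r] r assms(2,3) by simp
  qed
  have "fst p \<le> fst q" if "p \<in> set pu" "q \<in> set ?pv" "snd p = snd q" "snd p < k" for p q
  proof -
    consider "snd q = a" | "snd q = b" | "snd q \<noteq> a" "snd q \<noteq> b" by blast
    then show ?thesis
    proof cases
      case 1
      then show ?thesis using pu[OF that(1)] pv[OF that(2)] that(3) assms(5) by simp
    next
      case 2
      then show ?thesis using pu'[OF that(1)] pv'[OF that(2)] that(3) assms(6) by simp
    next
      case 3
      from that(2) obtain r where r: "r \<in> set pv" "q = map_prod id (transpose a b) r" by auto
      then have "snd q = snd r" using 3 by (auto simp: transpose_def split: if_splits)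
      then show ?thesis using uv[OF that(1) r(1)] r(2) that(3,4) by simp
    qed
  qed
  moreover have "fst p \<le> fst q" if "p \<in> set pu" "q \<in> set pm'" "snd p = snd q" for p q
    using that(2,3) pu[OF that(1)] pu'[OF that(1)] assms(5,6,9) unfolding assms(8) by auto
  moreover have "fst p \<le> fst q" if "p \<in> set pm'" "q \<in> set ?pv" "snd p = snd q" for p q
    using that(1,3) pv[OF that(2)] pv'[OF that(2)] assms(5,6,9) unfolding assms(8) by auto
  ultimately show ?thesis
    using col(1) coloring_swap(1)[OF col(2) assms(3,4)] assms(7) unfolding sorted_wrt_append set_append
    by blast
qed

text \<open>Exchanging \<open>x\<close> and \<open>z\<close> breaks a colouring only if they share a
  counted colour. If \<open>y\<close> is uncounted, it takes over this colour from \<open>x\<close>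
  (first relation) or from \<open>z\<close> (second relation), and the number of counted letters is
  unchanged. If \<open>y\<close> has another counted colour, \<open>coloring_exchange\<close>
  reroutes the two subwords.\<close>

lemma greene_step_imp:
  assumes "knuth_step w w'" "greene k w n"
  shows "greene k w' n"
proof -
  obtain ps where ps: "map fst ps = w" "coloring k ps" "length (filter (\<lambda>p. snd p < k) ps) = n"
    using assms(2) unfolding greene_def by blast
  let ?t = "\<lambda>a b. map_prod id (transpose a b)"
  have I: "greene k w' n" if "map fst q = w'" "coloring k q" "length (filter (\<lambda>p. snd p < k) q) = n" for q
    using that unfolding greene_def by blast
  show ?thesis using assms(1)
  proof cases
    case (1 x y z u v)
    then obtain pu cy cx cz pv where p: "ps = pu @ [(y, cy), (x, cx), (z, cz)] @ pv" "map fst pu = u" "map fst pv = v"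
      using ps(1) by (auto simp: map_eq_append_conv map_eq_Cons_conv)
    have col: "coloring k pv" using ps(2) unfolding p by (auto simp: sorted_wrt_append)
    consider "cx \<noteq> cz \<or> k \<le> cx" | "cx = cz" "cx < k" "k \<le> cy" | "cx = cz" "cx < k" "cy < k" by linarith
    then show ?thesis
    proof cases
      case c: 1
      show ?thesis by (rule I[of "pu @ [(y, cy), (z, cz), (x, cx)] @ pv"])
        (use ps p 1 c in \<open>auto simp: sorted_wrt_append\<close>)
    next
      case c: 2
      \<comment> \<open>\<open>y\<close> lies between \<open>x\<close> and \<open>z\<close>, so it
        fits into the subword that \<open>x\<close> leaves; the colour \<open>k\<close> is not
        counted.\<close>
      have "coloring k (pu @ [(y, cx), (z, cx), (x, k)] @ pv)"
        using ps(2) c 1(3,4) unfolding p by (fastforce simp: sorted_wrt_append)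
      then show ?thesis by (rule I[rotated]) (use ps p 1 c in auto)
    next
      case c: 3
      \<comment> \<open>\<open>y\<close> stands before the smaller letter \<open>x\<close>, so the
        two cannot share a counted colour.\<close>
      have ne: "cy \<noteq> cx" using ps(2) c 1(3) unfolding p by (auto simp: sorted_wrt_append)
      have "coloring k (pu @ [(y, cy), (z, cy), (x, cx)] @ map (?t cx cy) pv)"
        by (rule coloring_exchange[OF ps(2)[unfolded p], of x _ y _ z _ cy]) (use c ne 1(3,4) in auto)
      then show ?thesis
        by (rule I[rotated]) (use ps p 1 c coloring_swap(2)[OF col c(2,3)] in auto)
    qed
  next
    case (2 x y z u v)
    then obtain pu cy cx cz pv where p: "ps = pu @ [(x, cx), (z, cz), (y, cy)] @ pv" "map fst pu = u" "map fst pv = v"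
      using ps(1) by (auto simp: map_eq_append_conv map_eq_Cons_conv)
    have col: "coloring k pv" using ps(2) unfolding p by (auto simp: sorted_wrt_append)
    consider "cx \<noteq> cz \<or> k \<le> cx" | "cx = cz" "cx < k" "k \<le> cy" | "cx = cz" "cx < k" "cy < k" by linarith
    then show ?thesis
    proof cases
      case c: 1
      show ?thesis by (rule I[of "pu @ [(z, cz), (x, cx), (y, cy)] @ pv"])
        (use ps p 2 c in \<open>auto simp: sorted_wrt_append\<close>)
    next
      case c: 2
      have "coloring k (pu @ [(z, k), (x, cx), (y, cx)] @ pv)"
        using ps(2) c 2(3,4) unfolding p by (fastforce simp: sorted_wrt_append)
      then show ?thesis by (rule I[rotated]) (use ps p 2 c in auto)
    next
      case c: 3
      have ne: "cy \<noteq> cx" using ps(2) c 2(4) unfolding p by (auto simp: sorted_wrt_append)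
      have "coloring k (pu @ [(z, cy), (x, cx), (y, cx)] @ map (?t cx cy) pv)"
        by (rule coloring_exchange[OF ps(2)[unfolded p], of x _ y _ z _ cx]) (use c ne 2(3,4) in auto)
      then show ?thesis
        by (rule I[rotated]) (use ps p 2 c coloring_swap(2)[OF col c(2,3)] in auto)
    qed
  qed
qed

text \<open>In \<open>w'\<close> the larger letter \<open>z\<close> stands before \<open>x\<close>,
  so the two never share a counted colour and can be exchanged together with their colours.\<close>

lemma greene_step_rev:
  assumes "knuth_step w w'" "greene k w' n"
  shows "greene k w n"
proof -
  obtain ps where ps: "map fst ps = w'" "coloring k ps" "length (filter (\<lambda>p. snd p < k) ps) = n"
    using assms(2) unfolding greene_def by blast
  show ?thesis using assms(1)
  proof cases
    case (1 x y z u v)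
    then obtain pu cy cx cz pv where p: "ps = pu @ [(y, cy), (z, cz), (x, cx)] @ pv" "map fst pu = u" "map fst pv = v"
      using ps(1) by (auto simp: map_eq_append_conv map_eq_Cons_conv)
    let ?q = "pu @ [(y, cy), (x, cx), (z, cz)] @ pv"
    have "coloring k ?q" using ps(2) 1(3,4) unfolding p by (auto simp: sorted_wrt_append)
    moreover have "length (filter (\<lambda>p. snd p < k) ?q) = n" using ps(3) unfolding p by auto
    ultimately show ?thesis unfolding greene_def 1 using p by (intro exI[of _ ?q]) auto
  next
    case (2 x y z u v)
    then obtain pu cy cx cz pv where p: "ps = pu @ [(z, cz), (x, cx), (y, cy)] @ pv" "map fst pu = u" "map fst pv = v"
      using ps(1) by (auto simp: map_eq_append_conv map_eq_Cons_conv)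
    let ?q = "pu @ [(x, cx), (z, cz), (y, cy)] @ pv"
    have "coloring k ?q" using ps(2) 2(3,4) unfolding p by (auto simp: sorted_wrt_append)
    moreover have "length (filter (\<lambda>p. snd p < k) ?q) = n" using ps(3) unfolding p by auto
    ultimately show ?thesis unfolding greene_def 2 using p by (intro exI[of _ ?q]) auto
  qed
qed

lemma greene_knuth: "knuth_equiv w w' \<Longrightarrow> greene k w n \<longleftrightarrow> greene k w' n"
  using knuth_equiv_invariant[of w w' "\<lambda>w. greene k w n"] greene_step_imp greene_step_rev by blast

lemma greene_rev_compl_imp:
  assumes "set w \<subseteq> {1..d}" "greene k w n"
  shows "greene k (rev_compl d w) n"
proof -
  obtain ps where ps: "map fst ps = w" "coloring k ps" "length (filter (\<lambda>p. snd p < k) ps) = n"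
    using assms(2) unfolding greene_def by blast
  let ?q = "rev (map (map_prod (\<lambda>x. d + 1 - x) id) ps)"
  have "coloring k ?q"
    unfolding sorted_wrt_rev sorted_wrt_map
    by (rule sorted_wrt_mono_rel[OF _ ps(2)]) auto
  moreover have "map fst ?q = rev_compl d w" using ps(1) by (auto simp: rev_compl_def rev_map o_def)
  moreover have "length (filter (\<lambda>p. snd p < k) ?q) = n"
    using ps(3) by (simp add: rev_filter[symmetric] filter_map o_def)
  ultimately show ?thesis unfolding greene_def by blast
qed

lemma greene_rev_compl:
  "set w \<subseteq> {1..d} \<Longrightarrow> greene k (rev_compl d w) n \<longleftrightarrow> greene k w n"
  using greene_rev_compl_imp[of w d] greene_rev_compl_imp[of "rev_compl d w" d]
    set_rev_compl[of w d] rev_compl_rev_compl[of w d] by metis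

lemma ssytD:
  assumes "ssyt d S T"
  shows "dom T = S"
    and "c \<in> S \<Longrightarrow> T c = Some (the (T c))"
    and "c \<in> S \<Longrightarrow> the (T c) \<in> {1..d}"
    and "(i, j) \<in> S \<Longrightarrow> (i, j') \<in> S \<Longrightarrow> j \<le> j' \<Longrightarrow> the (T (i, j)) \<le> the (T (i, j'))"
    and "(i, j) \<in> S \<Longrightarrow> (i', j) \<in> S \<Longrightarrow> i < i' \<Longrightarrow> the (T (i, j)) < the (T (i', j))"
proof -
  show S: "dom T = S" using assms by (simp add: ssyt_def)
  show eq: "T c = Some (the (T c))" if "c \<in> S" for c using that S by auto
  show "c \<in> S \<Longrightarrow> the (T c) \<in> {1..d}"
    using assms eq[of c] unfolding ssyt_def by (metis ranI subsetD)
  show "(i, j) \<in> S \<Longrightarrow> (i, j') \<in> S \<Longrightarrow> j \<le> j' \<Longrightarrow> the (T (i, j)) \<le> the (T (i, j'))"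
    using assms eq unfolding ssyt_def by (metis le_neq_implies_less order_refl)
  show "(i, j) \<in> S \<Longrightarrow> (i', j) \<in> S \<Longrightarrow> i < i' \<Longrightarrow> the (T (i, j)) < the (T (i', j))"
    using assms eq unfolding ssyt_def by metis
qed

lemma reading_filter: "reading S L \<Longrightarrow> reading {c \<in> S. P c} (filter P L)"
  by (auto simp: reading_def sorted_wrt_filter)

text \<open>Each row is itself a weakly increasing subword. Row \<open>i\<close> receives the colour
  \<open>i - 1\<close>, because colours start at 0.\<close>

lemma greene_lower:
  assumes "ssyt d S T" "order_ideal S" "reading S L"
  shows "greene k (word_of T L) (card {c \<in> S. fst c \<le> k})"
proof -
  let ?ps = "map (\<lambda>c. (the (T c), fst c - 1)) L"
  have pos: "1 \<le> fst c" if "c \<in> S" for c using assms(2) that unfolding order_ideal_def by auto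
  have "coloring k ?ps"
    unfolding sorted_wrt_map
  proof (rule sorted_wrt_mono_rel)
    show "sorted_wrt (\<lambda>(i, j) (i', j'). (i = i' \<longrightarrow> j < j') \<and> (j = j' \<longrightarrow> i' < i)) L"
      using assms(3) by (simp add: reading_def)
    fix c c' assume c: "c \<in> set L" "c' \<in> set L"
      "(\<lambda>(i, j) (i', j'). (i = i' \<longrightarrow> j < j') \<and> (j = j' \<longrightarrow> i' < i)) c c'"
    obtain i j i' j' where cc: "c = (i, j)" "c' = (i', j')" by fastforce
    have S: "(i, j) \<in> S" "(i', j') \<in> S" using c cc assms(3) by (auto simp: reading_def)
    show "snd (the (T c), fst c - 1) = snd (the (T c'), fst c' - 1) \<and> snd (the (T c), fst c - 1) < k \<longrightarrow>
           fst (the (T c), fst c - 1) \<le> fst (the (T c'), fst c' - 1)"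
    proof (cases "i = i'")
      case True
      then show ?thesis using c S ssytD(4)[OF assms(1), of i j j'] unfolding cc by auto
    next
      case False
      then show ?thesis using pos[OF S(1)] pos[OF S(2)] unfolding cc by auto
    qed
  qed
  moreover have "length (filter (\<lambda>p. snd p < k) ?ps) = card {c \<in> S. fst c \<le> k}"
  proof -
    have "length (filter (\<lambda>p. snd p < k) ?ps) = length (filter (\<lambda>c. fst c - 1 < k) L)"
      by (simp add: filter_map o_def)
    also have "filter (\<lambda>c. fst c - 1 < k) L = filter (\<lambda>c. fst c \<le> k) L"
      using pos assms(3) by (intro filter_cong) (fastforce simp: reading_def)+
    also have "length \<dots> = card {c \<in> S. fst c \<le> k}"
      using assms(3) by (auto simp: reading_def distinct_card[symmetric])
    finally show ?thesis .
  qed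
  moreover have "map fst ?ps = word_of T L" by simp
  ultimately show ?thesis unfolding greene_def by blast
qed

text \<open>A column is strictly decreasing in every reading word, so a colour occurs at most once in it;
  hence pushing the coloured cells of each column upwards puts them into the first \<open>k\<close> rows.\<close>

lemma greene_upper:
  assumes "ssyt d S T" "order_ideal S" "reading S L" "greene k (word_of T L) n"
  shows "n \<le> card {c \<in> S. fst c \<le> k}"
proof -
  obtain ps where ps: "map fst ps = word_of T L" "coloring k ps" "length (filter (\<lambda>p. snd p < k) ps) = n"
    using assms(4) unfolding greene_def by blast
  have len: "length ps = length L" using arg_cong[OF ps(1), of length] by simp
  have L: "distinct L" "set L = S" using assms(3) by (auto simp: reading_def)
  define f where "f c = the (map_of (zip L (map snd ps)) c)" for c
  have f: "f (L ! p) = snd (ps ! p)" if "p < length L" for p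
    using that L len unfolding f_def by (simp add: map_of_zip_nth)
  have "ps = map (\<lambda>c. (the (T c), f c)) L"
  proof (rule nth_equalityI)
    fix p assume p: "p < length ps"
    have "fst (ps ! p) = the (T (L ! p))" using arg_cong[OF ps(1), of "\<lambda>l. l ! p"] p len by simp
    then show "ps ! p = map (\<lambda>c. (the (T c), f c)) L ! p" using f[of p] p len by (simp add: prod_eq_iff)
  qed (simp add: len)
  then have psf: "ps = map (\<lambda>c. (the (T c), f c)) L" .
  define C where "C = {c \<in> S. f c < k}"
  have fin: "finite S" using assms(2) by (simp add: order_ideal_def)
  have n: "n = card C"
    using ps(3) L unfolding psf C_def by (auto simp: filter_map o_def distinct_card[symmetric])
  have col: "i = i'" if "(i, j) \<in> C" "(i', j) \<in> C" "f (i, j) = f (i', j)" for i i' j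
  proof -
    have *: False if c: "(i, j) \<in> C" "(i', j) \<in> C" "f (i, j) = f (i', j)" "i < i'" for i i'
    proof -
      obtain p q where pq: "p < length L" "q < length L" "L ! p = (i, j)" "L ! q = (i', j)"
        using c L unfolding C_def by (metis (no_types, lifting) in_set_conv_nth mem_Collect_eq)
      have sw: "sorted_wrt (\<lambda>(i, j) (i', j'). (i = i' \<longrightarrow> j < j') \<and> (j = j' \<longrightarrow> i' < i)) L"
        using assms(3) by (simp add: reading_def)
      have "q < p"
      proof (rule ccontr)
        assume "\<not> q < p"
        then have "p < q" using pq c(4) by (metis less_irrefl linorder_neqE_nat prod.inject)
        then show False using sorted_wrt_nth_less[OF sw, of p q] pq c(4) by auto
      qed
      then have "the (T (i', j)) \<le> the (T (i, j))"
        using sorted_wrt_nth_less[OF ps(2), of q p] pq c len unfolding psf C_def by auto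
      then show False using ssytD(5)[OF assms(1), of i j i'] c unfolding C_def by auto
    qed
    show ?thesis using *[of i i'] *[of i' i] that by (metis linorder_neqE_nat)
  qed
  define r where "r = (\<lambda>(i, j). (card {i'. i' \<le> i \<and> (i', j) \<in> C}, j::nat))"
  have "inj_on r C"
  proof (rule inj_onI, clarify)
    fix i j i' j' assume c: "(i, j) \<in> C" "(i', j') \<in> C" "r (i, j) = r (i', j')"
    then have j: "j' = j" by (simp add: r_def)
    have "card {l. l \<le> a \<and> (l, j) \<in> C} < card {l. l \<le> b \<and> (l, j) \<in> C}" if "a < b" "(b, j) \<in> C" for a b
    proof (rule psubset_card_mono)
      show "{l. l \<le> a \<and> (l, j) \<in> C} \<subset> {l. l \<le> b \<and> (l, j) \<in> C}"
        using that by (intro psubsetI) (auto simp: set_eq_iff intro!: exI[of _ b])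
    qed simp
    from this[of i i'] this[of i' i] show "i = i' \<and> j = j'"
      using c j unfolding r_def by (cases i i' rule: linorder_cases) auto
  qed
  moreover have "r ` C \<subseteq> {c \<in> S. fst c \<le> k}"
  proof (rule image_subsetI)
    fix c' assume "c' \<in> C"
    then obtain i j where c': "c' = (i, j)" and c: "(i, j) \<in> C" by (cases c') auto
    let ?R = "{i'. i' \<le> i \<and> (i', j) \<in> C}"
    have "?R \<subseteq> {1..i}" using order_idealD(1)[OF assms(2)] unfolding C_def by auto
    then have "card ?R \<le> i" using card_mono[of "{1..i}" ?R] by simp
    moreover have "card ?R \<ge> 1"
    proof -
      have "i \<in> ?R" using c by simp
      then have "card ?R > 0" by (subst card_gt_0_iff) auto
      then show ?thesis by simp
    qed
    moreover have "(i, j) \<in> S" using c by (simp add: C_def)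
    ultimately have "(card ?R, j) \<in> S" using order_idealD[OF assms(2)] by blast
    moreover have "card ?R \<le> card {..<k}"
      using col by (intro card_inj_on_le[of "\<lambda>l. f (l, j)"]) (auto simp: inj_on_def C_def)
    ultimately show "r c' \<in> {c \<in> S. fst c \<le> k}" by (simp add: r_def c')
  qed
  ultimately show ?thesis using card_inj_on_le[of r C] fin n by simp
qed

text \<open>Row lengths are differences of consecutive cardinalities, and an order ideal is
  determined by its row lengths.\<close>

lemma order_ideal_eqI:
  assumes "order_ideal S" "order_ideal S'"
    and "\<And>k. card {c \<in> S. fst c \<le> k} = card {c \<in> S'. fst c \<le> k}"
  shows "S = S'"
proof -
  have row: "{j. (k, j) \<in> S} = {1..card {c \<in> S. fst c \<le> k} - card {c \<in> S. fst c \<le> k - 1}}"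
    if S: "order_ideal S" and "1 \<le> k" for S k
  proof -
    have fin: "finite {j. (k, j) \<in> S}"
    proof (rule finite_subset)
      show "{j. (k, j) \<in> S} \<subseteq> snd ` S" by force
      show "finite (snd ` S)" using S by (simp add: order_ideal_def)
    qed
    have "{c \<in> S. fst c \<le> k} = {c \<in> S. fst c \<le> k - 1} \<union> Pair k ` {j. (k, j) \<in> S}"
      using that(2) by (auto simp: le_less)
    moreover have "card (Pair k ` {j. (k, j) \<in> S}) = card {j. (k, j) \<in> S}"
      by (intro card_image) (auto simp: inj_on_def)
    moreover have "{c \<in> S. fst c \<le> k - 1} \<inter> Pair k ` {j. (k, j) \<in> S} = {}" using that(2) by auto
    ultimately have c: "card {c \<in> S. fst c \<le> k} - card {c \<in> S. fst c \<le> k - 1} = card {j. (k, j) \<in> S}"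
      using S fin by (simp add: card_Un_disjoint order_ideal_def)
    have "{j. (k, j) \<in> S} = {1..card {j. (k, j) \<in> S}}"
    proof (cases "{j. (k, j) \<in> S} = {}")
      case False
      then obtain M where M: "(k, M) \<in> S" "\<And>j. (k, j) \<in> S \<Longrightarrow> j \<le> M"
        using Max_in[OF fin False] Max_ge[OF fin] by blast
      have "(k, j) \<in> S \<longleftrightarrow> j \<in> {1..M}" for j
        using M(2)[of j] order_idealD(2)[OF S, of k j] order_idealD(3)[OF S M(1), of k j] that(2) by auto
      then have "{j. (k, j) \<in> S} = {1..M}" by blast
      then show ?thesis by simp
    qed simp
    then show ?thesis using c by simp
  qed
  have "(k, j) \<in> S \<longleftrightarrow> (k, j) \<in> S'" for k j
  proof (cases "1 \<le> k")
    case True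
    then have "{j. (k, j) \<in> S} = {j. (k, j) \<in> S'}"
      by (simp only: row[OF assms(1) True] row[OF assms(2) True] assms(3))
    then show ?thesis by blast
  next
    case False
    then show ?thesis using assms(1,2) unfolding order_ideal_def by auto
  qed
  then show ?thesis by auto
qed

text \<open>By \<open>greene_lower\<close> and \<open>greene_upper\<close>, the number of cells in
  the first \<open>k\<close> rows is the largest \<open>n\<close> with \<open>greene k\<close>. The
  invariants thus determine all partial sums of the row lengths.\<close>

lemma greene_shape:
  assumes "ssyt d S T" "order_ideal S" "reading S L"
    and "ssyt d' S' T'" "order_ideal S'" "reading S' L'"
    and "\<And>k n. greene k (word_of T L) n \<longleftrightarrow> greene k (word_of T' L') n"
  shows "S = S'"
proof (rule order_ideal_eqI)
  fix k
  have "greene k (word_of T' L') (card {c \<in> S. fst c \<le> k})"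
    using greene_lower[OF assms(1-3)] assms(7) by blast
  moreover have "greene k (word_of T L) (card {c \<in> S'. fst c \<le> k})"
    using greene_lower[OF assms(4-6)] assms(7) by blast
  ultimately show "card {c \<in> S. fst c \<le> k} = card {c \<in> S'. fst c \<le> k}"
    using greene_upper[OF assms(1-3)] greene_upper[OF assms(4-6)] by (intro antisym)
qed fact+

lemma ssyt_restrict:
  fixes b :: nat
  assumes "ssyt d S T" "order_ideal S"
  defines "S' \<equiv> {c \<in> S. the (T c) \<le> b}"
  shows "ssyt d S' (T |` S')" "order_ideal S'"
proof -
  have "dom (T |` S') = S'" using ssytD(1)[OF assms(1)] by (auto simp: S'_def)
  then show "ssyt d S' (T |` S')" using assms(1) unfolding ssyt_def restrict_map_def
    by (auto simp: ran_def split: if_splits)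
  have "the (T (i', j')) \<le> the (T (i, j))" if "(i, j) \<in> S" "i' \<in> {1..i}" "j' \<in> {1..j}" for i j i' j'
  proof -
    have "(i', j') \<in> S" "(i', j) \<in> S"
      using that order_idealD(3)[OF assms(2) that(1), of i'] order_idealD(2)[OF assms(2) that(1)] by auto
    then show ?thesis
      using ssytD(4)[OF assms(1), of i' j' j] ssytD(5)[OF assms(1), of i' j i] that by (cases "i' = i") auto
  qed
  note le = this
  show "order_ideal S'" unfolding order_ideal_def
  proof (intro conjI ballI)
    show "finite S'" using order_ideal_finite[OF assms(2)] by (simp add: S'_def)
    fix c assume "c \<in> S'"
    then obtain i j where c: "c = (i, j)" "(i, j) \<in> S" "the (T (i, j)) \<le> b" by (cases c) (auto simp: S'_def)
    have "(i', j') \<in> S'" if "i' \<in> {1..i}" "j' \<in> {1..j}" for i' j'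
      using le[OF c(2) that] c(3) order_idealD(3)[OF assms(2) c(2), of i' j'] that by (simp add: S'_def)
    then show "case c of (i, j) \<Rightarrow> 1 \<le> i \<and> 1 \<le> j \<and> {1..i} \<times> {1..j} \<subseteq> S'"
      using order_idealD(1,2)[OF assms(2) c(2)] unfolding c(1) by auto
  qed
qed

text \<open>A tableau amounts to the chain of shapes occupied by its letters up to \<open>b\<close>.
  Restriction to these letters preserves Knuth equivalence, so Greene's invariants give the same
  shape for every \<open>b\<close>. As \<open>L\<close> and \<open>L'\<close> are arbitrary
  readings, one of them may be a column reading and the other a row reading.\<close>

theorem ssyt_unique:
  assumes "ssyt d S T" "order_ideal S" "reading S L"
    and "ssyt d' S' T'" "order_ideal S'" "reading S' L'"
    and "knuth_equiv (word_of T L) (word_of T' L')"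
  shows "T = T'"
proof -
  have eq: "{c \<in> S. the (T c) \<le> b} = {c \<in> S'. the (T' c) \<le> b}" for b
  proof (rule greene_shape)
    let ?S = "{c \<in> S. the (T c) \<le> b}" and ?S' = "{c \<in> S'. the (T' c) \<le> b}"
    let ?L = "filter (\<lambda>c. the (T c) \<le> b) L" and ?L' = "filter (\<lambda>c. the (T' c) \<le> b) L'"
    show "ssyt d ?S (T |` ?S)" "order_ideal ?S" by (rule ssyt_restrict[OF assms(1,2)])+
    show "ssyt d' ?S' (T' |` ?S')" "order_ideal ?S'" by (rule ssyt_restrict[OF assms(4,5)])+
    show "reading ?S ?L" "reading ?S' ?L'" by (rule reading_filter, fact)+
    have w: "word_of (T |` {c \<in> S. the (T c) \<le> b}) (filter (\<lambda>c. the (T c) \<le> b) L)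
        = filter (\<lambda>x. x \<le> b) (word_of T L)" if "set L = S" for T L and S :: "(nat \<times> nat) set"
      using that by (auto simp: filter_map o_def)
    have "word_of (T |` ?S) ?L = filter (\<lambda>x. x \<le> b) (word_of T L)"
      by (rule w) (use assms(3) in \<open>simp add: reading_def\<close>)
    moreover have "word_of (T' |` ?S') ?L' = filter (\<lambda>x. x \<le> b) (word_of T' L')"
      by (rule w) (use assms(6) in \<open>simp add: reading_def\<close>)
    ultimately show "greene k (word_of (T |` ?S) ?L) n \<longleftrightarrow> greene k (word_of (T' |` ?S') ?L') n" for k n
      using greene_knuth[OF knuth_equiv_filter_le[OF assms(7)]] by (simp only:)
  qed
  have eq': "c \<in> S \<and> the (T c) \<le> b \<longleftrightarrow> c \<in> S' \<and> the (T' c) \<le> b" for c b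
    using eqset_imp_iff[OF eq[of b], of c] by simp
  \<comment> \<open>For \<open>b\<close> the maximum of both values the two inequalities hold,
    whatever \<open>the\<close> returns outside the domains, and only the memberships
    remain.\<close>
  have S: "S = S'"
  proof (rule set_eqI)
    show "c \<in> S \<longleftrightarrow> c \<in> S'" for c using eq'[of c "max (the (T c)) (the (T' c))"] by simp
  qed
  have "the (T c) = the (T' c)" if "c \<in> S" for c
    using that eq'[of c "the (T c)"] eq'[of c "the (T' c)"] S by simp
  then show ?thesis
    using ssytD(1)[OF assms(1)] ssytD(1)[OF assms(4)] S
    by (intro ext) (metis domIff option.expand)
qed

section \<open>Row insertion\<close>

definition row_less :: "nat \<times> nat \<Rightarrow> nat \<times> nat \<Rightarrow> bool" where
  "row_less c c' \<longleftrightarrow> fst c' < fst c \<or> fst c = fst c' \<and> snd c < snd c'"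

definition row_reading :: "(nat \<times> nat) set \<Rightarrow> (nat \<times> nat) list \<Rightarrow> bool" where
  "row_reading S L \<longleftrightarrow> set L = S \<and> sorted_wrt row_less L"

lemma row_reading_reading:
  assumes "row_reading S L"
  shows "reading S L"
proof -
  have "sorted_wrt row_less L" using assms by (simp add: row_reading_def)
  then have "distinct L" "sorted_wrt (\<lambda>(i, j) (i', j'). (i = i' \<longrightarrow> j < j') \<and> (j = j' \<longrightarrow> i' < i)) L"
    by (induction L) (auto simp: row_less_def)
  then show ?thesis using assms by (simp add: reading_def row_reading_def)
qed

lemma sorted_wrt_unique:
  assumes "sorted_wrt P xs" "sorted_wrt P ys" "set xs = set ys" "\<And>x y. P x y \<Longrightarrow> \<not> P y x"
  shows "xs = ys"
  using assms(1-3)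
proof (induction xs arbitrary: ys)
  case (Cons a xs)
  then obtain b ys' where ys: "ys = b # ys'" by (cases ys) auto
  have "a = b"
  proof (rule ccontr)
    assume "a \<noteq> b"
    then have "a \<in> set ys'" "b \<in> set xs" using Cons.prems(3) ys by auto
    then show False using Cons.prems ys assms(4)[of a b] by auto
  qed
  moreover have "a \<notin> set xs" "b \<notin> set ys'"
    using Cons.prems ys assms(4)[of a a] assms(4)[of b b] by auto
  ultimately show ?case using Cons ys by (metis insert_ident list.simps(15) sorted_wrt.simps(2))
qed simp

lemma row_reading_unique: "row_reading S L \<Longrightarrow> row_reading S L' \<Longrightarrow> L = L'"
  by (rule sorted_wrt_unique[of row_less]) (auto simp: row_reading_def row_less_def)

fun bump :: "nat \<Rightarrow> nat list \<Rightarrow> nat list \<times> nat option" where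
  "bump x [] = ([x], None)"
| "bump x (y # r) = (if x < y then (x # r, Some y) else map_prod (Cons y) id (bump x r))"

fun insertion :: "nat \<Rightarrow> nat list list \<Rightarrow> nat list list" where
  "insertion x [] = [[x]]"
| "insertion x (r # rs) =
     (case bump x r of (r', None) \<Rightarrow> r' # rs | (r', Some y) \<Rightarrow> r' # insertion y rs)"

text \<open>Recursive along both rows, as \<open>bump\<close> is along one, so that an insertion and
  the comparison with the next row go through a single induction; \<open>below_nth\<close> is the
  usual form.\<close>

fun below :: "nat list \<Rightarrow> nat list \<Rightarrow> bool" where
  "below r [] \<longleftrightarrow> True"
| "below [] (b # s) \<longleftrightarrow> False"
| "below (a # r) (b # s) \<longleftrightarrow> a < b \<and> below r s"

lemma below_nth: "below r s \<longleftrightarrow> length s \<le> length r \<and> (\<forall>j<length s. r ! j < s ! j)"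
  by (induction r s rule: below.induct) (auto simp: less_Suc_eq_0_disj)

lemma transp_below: "transp below"
  by (rule transpI, unfold below_nth) (meson less_le_trans less_trans le_trans)

definition row_tableau :: "nat list list \<Rightarrow> bool" where
  "row_tableau rs \<longleftrightarrow> (\<forall>r\<in>set rs. sorted r \<and> r \<noteq> []) \<and> sorted_wrt below rs"

lemma row_tableau_simps:
  "row_tableau []"
  "row_tableau [r] \<longleftrightarrow> sorted r \<and> r \<noteq> []"
  "row_tableau (r # s # rs) \<longleftrightarrow> sorted r \<and> r \<noteq> [] \<and> below r s \<and> row_tableau (s # rs)"
  unfolding row_tableau_def sorted_wrt2[OF transp_below] by auto

lemma bump_None:
  "bump x r = (r', None) \<Longrightarrow> r' = r @ [x] \<and> (\<forall>y\<in>set r. y \<le> x)"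
proof (induction r arbitrary: r')
  case (Cons a r)
  then show ?case by (cases "bump x r") (auto split: if_splits)
qed simp

text \<open>The bounds on \<open>hd r'\<close> serve twice: \<open>hd r'\<close> is the middle
  letter of the Knuth move by which \<open>y\<close> passes an entry on its left, and it lies above
  \<open>y\<close> when \<open>y\<close> opens a new row.\<close>

lemma bump_Some:
  "bump x r = (r', Some y) \<Longrightarrow> sorted r \<Longrightarrow>
     sorted r' \<and> r' \<noteq> [] \<and> hd r' \<le> x \<and> hd r' \<le> hd r \<and> x < y \<and> set r' \<subseteq> insert x (set r)"
proof (induction r arbitrary: r')
  case (Cons a r)
  show ?case
  proof (cases "x < a")
    case False
    with Cons.prems obtain r0 where "bump x r = (r0, Some y)" "r' = a # r0" by (cases "bump x r") auto
    then show ?thesis using Cons False by fastforce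
  next
    case True
    then show ?thesis using Cons.prems by auto (meson less_imp_le order_trans)
  qed
qed simp

text \<open>The small letter \<open>x\<close> passes the entries of the row one at a time, the left
  neighbour of the passed entry acting as the middle letter of the move. It comes to a halt behind
  \<open>a\<close>, which has no left neighbour.\<close>

lemma knuth_equiv_move_left:
  "sorted (a # r) \<Longrightarrow> x < a \<Longrightarrow> knuth_equiv (a # r @ [x]) (a # x # r)"
proof (induction r rule: rev_induct)
  case (snoc b r)
  obtain s c where s: "a # r = s @ [c]" by (metis list.discI rev_exhaust)
  have c: "x < c" "c \<le> b"
  proof -
    have "c \<in> set (a # r)" using s by simp
    then show "x < c" "c \<le> b" using snoc.prems by (auto simp: sorted_append)
  qed
  have k: "knuth_equiv (s @ [c, b, x] @ []) (s @ [c, x, b] @ [])"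
    by (rule knuth_equiv_sym, rule knuth_step_imp_equiv, rule knuth_step.intros) (use c in auto)
  moreover have e: "s @ [c, b, x] @ [] = a # (r @ [b]) @ [x]" "s @ [c, x, b] @ [] = (a # r @ [x]) @ [b]"
    using arg_cong[OF s, of "\<lambda>w. w @ [b, x]"] arg_cong[OF s, of "\<lambda>w. w @ [x, b]"] by simp_all
  moreover have "knuth_equiv ([] @ (a # r @ [x]) @ [b]) ([] @ (a # x # r) @ [b])"
    using snoc by (intro knuth_equiv_context) (auto simp: sorted_append)
  ultimately show ?case
    using knuth_equiv_trans[OF k[unfolded e], of "[] @ (a # x # r) @ [b]"] by simp
qed simp

text \<open>\<open>x\<close> moves left until it stands directly behind the entry \<open>y\<close>
  that it bumps; then \<open>y\<close> moves to the front, past the entries not exceeding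
  \<open>x\<close>.\<close>

lemma bump_knuth:
  "bump x r = (r', Some y) \<Longrightarrow> sorted r \<Longrightarrow> knuth_equiv (r @ [x]) (y # r')"
proof (induction r arbitrary: r')
  case (Cons a r)
  show ?case
  proof (cases "x < a")
    case True
    then show ?thesis using Cons knuth_equiv_move_left[of a r x] by auto
  next
    case False
    with Cons.prems obtain r0 where r0: "bump x r = (r0, Some y)" "r' = a # r0" by (cases "bump x r") auto
    have s: "sorted r" using Cons.prems by simp
    note * = bump_Some[OF r0(1) s]
    obtain h t where h: "r0 = h # t" using * by (cases r0) auto
    have "knuth_equiv ([a] @ (r @ [x]) @ []) ([a] @ (y # r0) @ [])"
      using Cons.IH[OF r0(1) s] by (rule knuth_equiv_context)
    \<comment> \<open>An instance of the second relation, with \<open>a \<le> h\<close> and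
      \<open>h < y\<close>; the latter holds since \<open>h \<le> x\<close> and
      \<open>x < y\<close>.\<close>
    moreover have "knuth_equiv ([] @ [a, y, h] @ t) ([] @ [y, a, h] @ t)"
      using * h Cons.prems False by (intro knuth_step_imp_equiv knuth_step.intros) auto
    ultimately show ?thesis unfolding r0(2) h using knuth_equiv_trans by simp
  qed
qed simp

lemma below_mono: "below r s \<Longrightarrow> bump x r = (r', Some y) \<Longrightarrow> below r' s"
proof (induction r s arbitrary: r' rule: below.induct)
  case (3 a r b s)
  then show ?case by (cases "bump x r") (auto split: if_splits)
qed auto

text \<open>\<open>y\<close> is smaller than the entry of \<open>s\<close> under its old place, if
  there is one, so it lands weakly to the left of that place. The entry of \<open>r'\<close> above
  its new place is at most \<open>x\<close>, hence smaller than \<open>y\<close>.\<close>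

lemma below_bump:
  "below r s \<Longrightarrow> sorted r \<Longrightarrow> sorted s \<Longrightarrow> bump x r = (r', Some y) \<Longrightarrow> below r' (fst (bump y s))"
proof (induction r s arbitrary: r' rule: below.induct)
  case (1 r)
  then obtain h t where "r' = h # t" using bump_Some by (cases r') auto
  then show ?case using bump_Some[OF 1(4,2)] by auto
next
  case (3 a r b s)
  show ?case
  proof (cases "x < a")
    case True
    then show ?thesis using 3 by auto
  next
    case False
    with 3 obtain r0 where r0: "bump x r = (r0, Some y)" "r' = a # r0" by (cases "bump x r") auto
    have "x < y" using bump_Some[OF r0(1)] 3 by auto
    then show ?thesis using 3 r0 False below_mono[of r s x r0 y] by auto
  qed
qed simp

lemma row_tableau_insertion: "row_tableau rs \<Longrightarrow> row_tableau (insertion x rs)"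
proof (induction rs arbitrary: x)
  case (Cons r rs)
  have r: "sorted r" "row_tableau rs" using Cons.prems by (auto simp: row_tableau_def)
  show ?case
  proof (cases "bump x r")
    case (Pair r' o')
    show ?thesis
    proof (cases o')
      case None
      then have r': "r' = r @ [x]" "\<forall>y\<in>set r. y \<le> x" using bump_None Pair by auto
      have "below (r @ [x]) s" if "below r s" for s using that by (auto simp: below_nth nth_append)
      then show ?thesis using Pair None r' Cons.prems
        by (cases rs) (auto simp: row_tableau_simps sorted_append)
    next
      case (Some y)
      note b = bump_Some[OF Pair[unfolded Some] r(1)]
      have t: "row_tableau (insertion y rs)" using Cons.IH r(2) .
      show ?thesis
      proof (cases rs)
        case Nil
        obtain h u where "r' = h # u" using b by (cases r') auto
        then show ?thesis using Nil Pair Some b by (auto simp: row_tableau_simps)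
      next
        case (Cons s rs')
        then have s: "below r s" "sorted s" using \<open>row_tableau (r # rs)\<close> by (auto simp: row_tableau_def)
        obtain q where "insertion y rs = fst (bump y s) # q"
          by (cases "bump y s"; cases "snd (bump y s)") (auto simp: Cons)
        then show ?thesis using Pair Some b t below_bump[OF s(1) r(1) s(2) Pair[unfolded Some]]
          by (auto simp: row_tableau_simps)
      qed
    qed
  qed
qed (simp add: row_tableau_simps)

lemma insertion_knuth:
  "row_tableau rs \<Longrightarrow> knuth_equiv (concat (rev rs) @ [x]) (concat (rev (insertion x rs)))"
proof (induction rs arbitrary: x)
  case (Cons r rs)
  have r: "sorted r" "row_tableau rs" using Cons.prems by (auto simp: row_tableau_def)
  show ?case
  proof (cases "bump x r")
    case (Pair r' o')
    show ?thesis
    proof (cases o')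
      case None
      then show ?thesis using Pair bump_None by auto
    next
      case (Some y)
      have "knuth_equiv (concat (rev rs) @ (r @ [x]) @ []) (concat (rev rs) @ (y # r') @ [])"
        using bump_knuth[OF Pair[unfolded Some] r(1)] by (rule knuth_equiv_context)
      moreover have "knuth_equiv ([] @ (concat (rev rs) @ [y]) @ r') ([] @ concat (rev (insertion y rs)) @ r')"
        using Cons.IH[OF r(2)] by (rule knuth_equiv_context)
      ultimately show ?thesis using Pair Some knuth_equiv_trans by simp
    qed
  qed
qed simp

lemma ex_row_tableau: "\<exists>rs. row_tableau rs \<and> knuth_equiv w (concat (rev rs))"
proof (induction w rule: rev_induct)
  case Nil
  show ?case by (intro exI[of _ "[]"]) (simp add: row_tableau_simps)
next
  case (snoc x w)
  then obtain rs where rs: "row_tableau rs" "knuth_equiv w (concat (rev rs))" by blast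
  have "knuth_equiv ([] @ w @ [x]) ([] @ concat (rev rs) @ [x])" using rs(2) by (rule knuth_equiv_context)
  then show ?case using row_tableau_insertion[OF rs(1), of x] insertion_knuth[OF rs(1), of x] knuth_equiv_trans
    by (metis append_Nil)
qed

section \<open>From lists of rows to tableaux on sets of cells\<close>

fun row_cells :: "nat \<Rightarrow> nat list list \<Rightarrow> (nat \<times> nat) list" where
  "row_cells i [] = []"
| "row_cells i (r # rs) = row_cells (Suc i) rs @ map (Pair i) [1..<Suc (length r)]"

definition tableau_of :: "nat list list \<Rightarrow> tableau" where
  "tableau_of rs = (\<lambda>(i, j). if 1 \<le> i \<and> i \<le> length rs \<and> 1 \<le> j \<and> j \<le> length (rs ! (i - 1))
     then Some (rs ! (i - 1) ! (j - 1)) else None)"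

lemma set_row_cells:
  "set (row_cells i rs) = {(a, b). i \<le> a \<and> a < i + length rs \<and> 1 \<le> b \<and> b \<le> length (rs ! (a - i))}"
proof (induction rs arbitrary: i)
  case (Cons r rs)
  have "(a, b) \<in> set (row_cells i (r # rs)) \<longleftrightarrow>
      i \<le> a \<and> a < i + length (r # rs) \<and> 1 \<le> b \<and> b \<le> length ((r # rs) ! (a - i))" for a b
    by (cases "a = i") (auto simp: Cons nth_Cons' image_iff)
  then show ?case by auto
qed simp

lemma sorted_row_cells: "sorted_wrt row_less (row_cells i rs)"
proof (induction rs arbitrary: i)
  case (Cons r rs)
  have "sorted_wrt row_less (map (Pair i) [1..<Suc (length r)])"
    unfolding sorted_wrt_map row_less_def using sorted_wrt_upt[of 1 "Suc (length r)"]
    by (simp del: upt_Suc)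
  then show ?case using Cons[of "Suc i"] unfolding row_cells.simps sorted_wrt_append set_row_cells
    by (auto simp: row_less_def[of "(_, _)"] simp del: upt_Suc)
qed simp

text \<open>\<open>pre\<close> collects the rows already passed, so that the induction can move
  downwards while row numbers remain absolute.\<close>

lemma word_row_cells:
  "word_of (tableau_of (pre @ rs)) (row_cells (Suc (length pre)) rs) = concat (rev rs)"
proof (induction rs arbitrary: pre)
  case (Cons r rs)
  have "word_of (tableau_of (pre @ r # rs)) (map (Pair (Suc (length pre))) [1..<Suc (length r)]) = r"
    by (rule nth_equalityI) (auto simp: tableau_of_def simp del: upt_Suc)
  then show ?case using Cons[of "pre @ [r]"] by (simp del: upt_Suc)
qed simp

text \<open>No bound on \<open>S\<close> is asserted; for evacuation, Greene's invariants show
  afterwards that \<open>S\<close> is the expected shape.\<close>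

theorem ex_rectification:
  assumes "set w \<subseteq> {1..d}"
  obtains S T L where "order_ideal S" "ssyt d S T" "row_reading S L" "knuth_equiv w (word_of T L)"
proof -
  obtain rs where rs: "row_tableau rs" "knuth_equiv w (concat (rev rs))" using ex_row_tableau by blast
  define T where "T = tableau_of rs"
  define L where "L = row_cells 1 rs"
  define S where "S = set L"
  have word: "word_of T L = concat (rev rs)"
    using word_row_cells[of "[]" rs] by (simp add: T_def L_def)
  have S: "(i, j) \<in> S \<longleftrightarrow> 1 \<le> i \<and> i \<le> length rs \<and> 1 \<le> j \<and> j \<le> length (rs ! (i - 1))" for i j
    by (auto simp: S_def L_def set_row_cells)
  have T: "T (i, j) = (if (i, j) \<in> S then Some (rs ! (i - 1) ! (j - 1)) else None)" for i j
    unfolding S by (simp add: T_def tableau_of_def)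
  have bl: "below (rs ! a) (rs ! b)" if "a < b" "b < length rs" for a b
    using rs(1) that by (auto simp: row_tableau_def sorted_wrt_nth_less)
  have so: "sorted (rs ! a)" if "a < length rs" for a
    using rs(1) that by (auto simp: row_tableau_def)
  have sub: "length (rs ! b) \<le> length (rs ! a)" if "a \<le> b" "b < length rs" for a b
    using bl[of a b] that by (cases "a = b") (auto simp: below_nth)
  have "order_ideal S" unfolding order_ideal_def
  proof (intro conjI ballI)
    show "finite S" by (simp add: S_def)
    fix c assume "c \<in> S"
    then obtain i j where c: "c = (i, j)" "(i, j) \<in> S" by (cases c) auto
    have "(i', j') \<in> S" if "i' \<in> {1..i}" "j' \<in> {1..j}" for i' j'
      using c(2) that sub[of "i' - 1" "i - 1"] unfolding S by fastforce
    then show "case c of (i, j) \<Rightarrow> 1 \<le> i \<and> 1 \<le> j \<and> {1..i} \<times> {1..j} \<subseteq> S"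
      using c(2)[unfolded S] unfolding c(1) by auto
  qed
  moreover have "ssyt d S T" unfolding ssyt_def
  proof (intro conjI allI impI)
    show "dom T = S" using T by (auto split: if_splits)
    have "set (word_of T L) \<subseteq> {1..d}"
      using assms knuth_equiv_set[OF rs(2)] unfolding word by simp
    then have "the (T c) \<in> {1..d}" if "c \<in> S" for c
      using that unfolding S_def set_map by blast
    then show "ran T \<subseteq> {1..d}" using \<open>dom T = S\<close> by (force simp: ran_def dom_def)
    fix i j j' x y assume "T (i, j) = Some x \<and> T (i, j') = Some y \<and> j < j'"
    then show "x \<le> y" using so[of "i - 1"] unfolding T S
      by (auto split: if_splits intro!: sorted_nth_mono)
  next
    fix i i' j x y assume "T (i, j) = Some x \<and> T (i', j) = Some y \<and> i < i'"
    then show "x < y" using bl[of "i - 1" "i' - 1"] unfolding T S below_nth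
      by (auto split: if_splits)
  qed
  moreover have "row_reading S L" using sorted_row_cells by (simp add: row_reading_def S_def L_def)
  ultimately show ?thesis using that rs(2) word by metis
qed

section \<open>Pictures\<close>

text \<open>The order of the Littlewood-Richardson reading, from right to left and from top to
  bottom, which is opposite to the order of the row word.\<close>

definition read_le :: "nat \<times> nat \<Rightarrow> nat \<times> nat \<Rightarrow> bool" where
  "read_le c' c \<longleftrightarrow> fst c' < fst c \<or> fst c' = fst c \<and> snd c \<le> snd c'"

lemma read_le_iff: "read_le c' c \<longleftrightarrow> c' = c \<or> row_less c c'"
  by (auto simp: read_le_def row_less_def prod_eq_iff)

lemma read_le_refl [simp]: "read_le c c"
  by (simp add: read_le_def)

lemma read_le_trans: "read_le a b \<Longrightarrow> read_le b c \<Longrightarrow> read_le a c"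
  by (auto simp: read_le_def)

lemma read_le_antisym: "read_le a b \<Longrightarrow> read_le b a \<Longrightarrow> a = b"
  by (auto simp: read_le_def prod_eq_iff)

lemma read_le_total: "read_le a b \<or> read_le b a"
  by (auto simp: read_le_def)

definition letters_read :: "tableau \<Rightarrow> nat \<Rightarrow> nat \<times> nat \<Rightarrow> nat" where
  "letters_read T k c = card {c'. T c' = Some k \<and> read_le c' c}"

lemma letters_read_mono:
  assumes "finite (dom T)" "read_le c' c"
  shows "letters_read T k c' \<le> letters_read T k c"
  unfolding letters_read_def
  by (rule card_mono) (use assms in \<open>auto intro: finite_subset[of _ "dom T"] read_le_trans\<close>)

lemma letters_read_less:
  assumes "finite (dom T)" "T c = Some k" "\<not> read_le c c'"
  shows "letters_read T k c' < letters_read T k c"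
  unfolding letters_read_def
proof (rule psubset_card_mono)
  show "finite {c'. T c' = Some k \<and> read_le c' c}"
    using assms(1) by (auto intro: finite_subset[of _ "dom T"])
  have "read_le c' c" using assms(3) read_le_total by blast
  then show "{a. T a = Some k \<and> read_le a c'} \<subset> {a. T a = Some k \<and> read_le a c}"
    using assms(2,3) by (auto intro: read_le_trans)
qed

lemma letters_read_le_content:
  "finite (dom T) \<Longrightarrow> letters_read T k c \<le> content T k"
  unfolding letters_read_def content_def
  by (rule card_mono) (auto intro: finite_subset[of _ "dom T"])

text \<open>With \<open>g = 0\<close> this is the picture of an LR tableau; with
  \<open>g = mu\<close>, applied to the companion, it is the inverse picture.\<close>

definition rec_map :: "(nat \<Rightarrow> nat) \<Rightarrow> tableau \<Rightarrow> nat \<times> nat \<Rightarrow> nat \<times> nat" where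
  "rec_map g T c = (the (T c), g (the (T c)) + letters_read T (the (T c)) c)"

text \<open>Convexity in the componentwise order, which is all that the arguments about
  \<open>rec_map\<close> use of a skew shape.\<close>

definition skew :: "(nat \<times> nat) set \<Rightarrow> bool" where
  "skew A \<longleftrightarrow> finite A \<and> (\<forall>i j i' j' a b. (i, j) \<in> A \<longrightarrow> (i', j') \<in> A \<longrightarrow>
     i \<le> a \<longrightarrow> a \<le> i' \<longrightarrow> j \<le> b \<longrightarrow> b \<le> j' \<longrightarrow> (a, b) \<in> A)"

lemma skewD:
  "skew A \<Longrightarrow> (i, j) \<in> A \<Longrightarrow> (i', j') \<in> A \<Longrightarrow> i \<le> a \<Longrightarrow> a \<le> i' \<Longrightarrow> j \<le> b \<Longrightarrow> b \<le> j' \<Longrightarrow> (a, b) \<in> A"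
  unfolding skew_def by blast

definition monotone_picture :: "(nat \<times> nat) set \<Rightarrow> (nat \<times> nat \<Rightarrow> nat \<times> nat) \<Rightarrow> bool" where
  "monotone_picture A f \<longleftrightarrow>
     (\<forall>i j j'. (i, j) \<in> A \<longrightarrow> (i, j') \<in> A \<longrightarrow> j < j' \<longrightarrow>
        fst (f (i, j)) \<le> fst (f (i, j')) \<and> snd (f (i, j')) < snd (f (i, j))) \<and>
     (\<forall>i i' j. (i, j) \<in> A \<longrightarrow> (i', j) \<in> A \<longrightarrow> i < i' \<longrightarrow>
        fst (f (i, j)) < fst (f (i', j)) \<and> snd (f (i', j)) \<le> snd (f (i, j)))"

lemma monotone_pictureD:
  assumes "monotone_picture A f"
  shows "(i, j) \<in> A \<Longrightarrow> (i, j') \<in> A \<Longrightarrow> j < j' \<Longrightarrow> fst (f (i, j)) \<le> fst (f (i, j'))"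
    and "(i, j) \<in> A \<Longrightarrow> (i, j') \<in> A \<Longrightarrow> j < j' \<Longrightarrow> snd (f (i, j')) < snd (f (i, j))"
    and "(i, j) \<in> A \<Longrightarrow> (i', j) \<in> A \<Longrightarrow> i < i' \<Longrightarrow> fst (f (i, j)) < fst (f (i', j))"
    and "(i, j) \<in> A \<Longrightarrow> (i', j) \<in> A \<Longrightarrow> i < i' \<Longrightarrow> snd (f (i', j)) \<le> snd (f (i, j))"
  using assms unfolding monotone_picture_def by blast+

text \<open>Zelevinsky's pictures, as pairs of mutually inverse bijections.\<close>

definition picture ::
    "(nat \<times> nat) set \<Rightarrow> (nat \<times> nat) set \<Rightarrow> (nat \<times> nat \<Rightarrow> nat \<times> nat) \<Rightarrow> (nat \<times> nat \<Rightarrow> nat \<times> nat) \<Rightarrow> bool"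
  where
  "picture A B f g \<longleftrightarrow> (\<forall>a\<in>A. f a \<in> B \<and> g (f a) = a) \<and> (\<forall>b\<in>B. g b \<in> A \<and> f (g b) = b) \<and>
     monotone_picture A f \<and> monotone_picture B g"

lemma picture_sym: "picture A B f g \<Longrightarrow> picture B A g f"
  by (auto simp: picture_def)

lemma pictureD:
  assumes "picture A B f g"
  shows "a \<in> A \<Longrightarrow> f a \<in> B" "a \<in> A \<Longrightarrow> g (f a) = a" "b \<in> B \<Longrightarrow> g b \<in> A" "b \<in> B \<Longrightarrow> f (g b) = b"
    "monotone_picture A f" "monotone_picture B g"
  using assms by (auto simp: picture_def)

definition is_partition :: "(nat \<Rightarrow> nat) \<Rightarrow> bool" where
  "is_partition p \<longleftrightarrow> (\<forall>i j. 1 \<le> i \<and> i \<le> j \<longrightarrow> p j \<le> p i) \<and> p 0 = 0 \<and> finite {i. p i \<noteq> 0}"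

lemma partition_inD:
  assumes "partition_in d m p"
  shows "is_partition p" "1 \<le> i \<Longrightarrow> i \<le> j \<Longrightarrow> p j \<le> p i" "p i \<le> m" "i \<notin> {1..d} \<Longrightarrow> p i = 0"
proof -
  have "finite {i. p i \<noteq> 0}"
    by (rule finite_subset[of _ "{1..d}"]) (use assms in \<open>auto simp: partition_in_def\<close>)
  then show "is_partition p" using assms by (simp add: partition_in_def is_partition_def)
qed (use assms in \<open>auto simp: partition_in_def\<close>)

lemma is_partitionD: "is_partition p \<Longrightarrow> 1 \<le> i \<Longrightarrow> i \<le> j \<Longrightarrow> p j \<le> p i"
  by (auto simp: is_partition_def)

lemma mem_cells [simp]: "(i, j) \<in> cells lam mu \<longleftrightarrow> mu i < j \<and> j \<le> lam i"
  by (simp add: cells_def)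

lemma mem_normal_shape [simp]: "(i, j) \<in> normal_shape nu \<longleftrightarrow> 0 < j \<and> j \<le> nu i"
  by (simp add: normal_shape_def)

lemma cells_row_pos: "is_partition lam \<Longrightarrow> (i, j) \<in> cells lam mu \<Longrightarrow> 1 \<le> i"
  by (cases i) (auto simp: is_partition_def)

lemma skew_cells:
  assumes "is_partition lam" "is_partition mu"
  shows "skew (cells lam mu)"
  unfolding skew_def
proof (intro conjI allI impI)
  have "lam i \<le> lam 1" for i using assms(1) by (cases i) (auto simp: is_partition_def)
  then have "cells lam mu \<subseteq> {i. lam i \<noteq> 0} \<times> {..lam 1}" by (auto simp: cells_def intro: le_trans)
  then show "finite (cells lam mu)"
    by (rule finite_subset) (use assms(1) in \<open>simp add: is_partition_def\<close>)
  fix i j i' j' a b assume *: "(i, j) \<in> cells lam mu" "(i', j') \<in> cells lam mu" "i \<le> a" "a \<le> i'" "j \<le> b" "b \<le> j'"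
  have "1 \<le> i" using cells_row_pos assms(1) * by blast
  then show "(a, b) \<in> cells lam mu"
    using * is_partitionD[OF assms(1), of a i'] is_partitionD[OF assms(2), of i a] by auto
qed

text \<open>The version of \<open>dominant\<close> on cells, free of the box and of the choice of a
  list. The monotonicity of \<open>g\<close> itself is kept apart, see
  \<open>dominant_row_reading\<close>.\<close>

definition dominated :: "(nat \<Rightarrow> nat) \<Rightarrow> tableau \<Rightarrow> bool" where
  "dominated g T \<longleftrightarrow> (\<forall>c\<in>dom T. \<forall>i\<ge>1. g (i + 1) + letters_read T (i + 1) c \<le> g i + letters_read T i c)"

lemma dominated_antimono:
  assumes "dominated g T" "c \<in> dom T" "1 \<le> k" "k \<le> l"
  shows "g l + letters_read T l c \<le> g k + letters_read T k c"
  using assms(4)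
proof (induction l rule: dec_induct)
  case (step n)
  then have "g (Suc n) + letters_read T (Suc n) c \<le> g n + letters_read T n c"
    using assms(1-3) by (auto simp: dominated_def)
  then show ?case using step by simp
qed simp

text \<open>Dominance compares two letters at one moment of the reading, whereas vertically adjacent
  cells are read at different moments. Their comparison is made at the leftmost of a run of equal
  letters in the upper row, and then carried to the right along the run, where the upper value falls
  by exactly one and the lower value by at least one in each step.\<close>

lemma monotone_picture_rec_map:
  assumes T: "ssyt d A T" and A: "skew A" and dom: "dominated g T"
  shows "monotone_picture A (rec_map g T)"
proof -
  have fin: "finite (dom T)" using A ssytD(1)[OF T] by (simp add: skew_def)
  have dA: "dom T = A" using ssytD(1)[OF T] .
  let ?f = "rec_map g T"
  have row: "snd (?f (i, j')) < snd (?f (i, j))" if c: "(i, j) \<in> A" "(i, j') \<in> A" "j < j'" for i j j'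
  proof -
    let ?k = "the (T (i, j))" and ?k' = "the (T (i, j'))"
    have "?k \<le> ?k'" "1 \<le> ?k" using ssytD(3,4)[OF T] c by auto
    then have "g ?k' + letters_read T ?k' (i, j') \<le> g ?k + letters_read T ?k (i, j')"
      using dominated_antimono[OF dom] c dA by blast
    moreover have "letters_read T ?k (i, j') < letters_read T ?k (i, j)"
      using c ssytD(2)[OF T c(1)] by (intro letters_read_less fin) (auto simp: read_le_def)
    ultimately show ?thesis by (simp add: rec_map_def)
  qed
  have col1: "snd (?f (Suc i, j)) \<le> snd (?f (i, j))" if "(i, j) \<in> A" "(Suc i, j) \<in> A" for i j
    using that
  proof (induction j rule: less_induct)
    case (less j)
    let ?k = "the (T (i, j))" and ?k' = "the (T (Suc i, j))"
    have k: "?k < ?k'" "1 \<le> ?k" using ssytD(3,5)[OF T] less.prems by auto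
    show ?case
    proof (cases "\<exists>b. j = Suc b \<and> (i, b) \<in> A \<and> T (i, b) = Some ?k")
      case True
      then obtain b where b: "j = Suc b" "(i, b) \<in> A" "T (i, b) = Some ?k" by blast
      have in': "(Suc i, b) \<in> A" using skewD[OF A b(2) less.prems(2), of "Suc i" b] b(1) by simp
      have "{c'. T c' = Some ?k \<and> read_le c' (i, b)} = insert (i, b) {c'. T c' = Some ?k \<and> read_le c' (i, j)}"
        using b by (auto simp: read_le_def)
      moreover have "finite {c'. T c' = Some ?k \<and> read_le c' (i, j)}"
        using fin by (auto intro: finite_subset[of _ "dom T"])
      ultimately have "snd (?f (i, b)) = Suc (snd (?f (i, j)))"
        using b by (simp add: rec_map_def letters_read_def read_le_def)
      then show ?thesis using less.IH[OF _ b(2) in'] b(1) row[OF in' less.prems(2)] by simp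
    next
      \<comment> \<open>\<open>(i, j)\<close> is the leftmost \<open>?k\<close> of its row, and
        every \<open>?k\<close> of row \<open>Suc i\<close> lies to the left of column
        \<open>j\<close>. So no \<open>?k\<close> is read between the two cells, and dominance at
        the lower cell gives the claim.\<close>
      case False
      have "j \<le> b" if b: "T (i, b) = Some ?k" for b
      proof (rule ccontr)
        assume "\<not> j \<le> b"
        then obtain j' where j': "j = Suc j'" "b \<le> j'" by (cases j) auto
        have bA: "(i, b) \<in> A" using b dA by blast
        then have jA: "(i, j') \<in> A" using skewD[OF A _ less.prems(1), of i b i j'] j' by simp
        have "the (T (i, j')) = ?k"
          using ssytD(4)[OF T bA jA j'(2)] ssytD(4)[OF T jA less.prems(1)] b j'(1) by simp
        then show False using False j'(1) jA ssytD(2)[OF T jA] by auto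
      qed
      moreover have "b < j" if b: "T (Suc i, b) = Some ?k" for b
      proof (rule ccontr)
        assume "\<not> b < j"
        moreover have "(Suc i, b) \<in> A" using b dA by blast
        ultimately show False using ssytD(4)[OF T less.prems(2), of b] b k by simp
      qed
      ultimately have "{c'. T c' = Some ?k \<and> read_le c' (Suc i, j)} = {c'. T c' = Some ?k \<and> read_le c' (i, j)}"
        by (fastforce simp: read_le_def less_Suc_eq)
      moreover have "g ?k' + letters_read T ?k' (Suc i, j) \<le> g ?k + letters_read T ?k (Suc i, j)"
        using dominated_antimono[OF dom _ k(2)] less.prems(2) dA k(1) by simp
      ultimately show ?thesis by (simp add: rec_map_def letters_read_def)
    qed
  qed
  have col: "snd (?f (i', j)) \<le> snd (?f (i, j))" if c: "(i, j) \<in> A" "(i', j) \<in> A" "i \<le> i'" for i i' j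
  proof -
    have "l \<le> i' \<longrightarrow> snd (?f (l, j)) \<le> snd (?f (i, j))" if "i \<le> l" for l
      using that
    proof (induction l rule: dec_induct)
      case (step n)
      show ?case
      proof
        assume "Suc n \<le> i'"
        then have "(n, j) \<in> A" "(Suc n, j) \<in> A" using skewD[OF A c(1,2)] step by auto
        then show "snd (?f (Suc n, j)) \<le> snd (?f (i, j))" using col1[of n j] step \<open>Suc n \<le> i'\<close> by simp
      qed
    qed simp
    then show ?thesis using c(3) by blast
  qed
  show ?thesis unfolding monotone_picture_def
  proof (intro conjI allI impI)
    fix i j j' assume "(i, j) \<in> A" "(i, j') \<in> A" "j < j'"
    then show "fst (?f (i, j)) \<le> fst (?f (i, j'))" "snd (?f (i, j')) < snd (?f (i, j))"
      using ssytD(4)[OF T, of i j j'] row by (auto simp: rec_map_def)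
  next
    fix i i' j assume "(i, j) \<in> A" "(i', j) \<in> A" "i < i'"
    then show "fst (?f (i, j)) < fst (?f (i', j))" "snd (?f (i', j)) \<le> snd (?f (i, j))"
      using ssytD(5)[OF T, of i j i'] col by (auto simp: rec_map_def)
  qed
qed

text \<open>The letters \<open>k\<close> are numbered consecutively in reading order and thus fill
  row \<open>k\<close> of the target exactly. The inverse is monotone because a misplaced cell
  would, by convexity, put the corner \<open>(i, j')\<close> into \<open>A\<close>, against
  semistandardness or against the monotonicity of \<open>rec_map\<close>.\<close>

lemma picture_rec_map:
  assumes T: "ssyt d A T" and A: "skew A" and dom: "dominated g T"
    and delta: "\<And>i. delta i = g i + content T i"
  shows "picture A (cells delta g) (rec_map g T) (inv_into A (rec_map g T))"
proof -
  have dA: "dom T = A" using ssytD(1)[OF T] .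
  have fin: "finite (dom T)" using A dA by (simp add: skew_def)
  let ?f = "rec_map g T" and ?B = "cells delta g"
  let ?g = "inv_into A ?f"
  have inj: "inj_on ?f A"
  proof (rule inj_onI)
    fix c c' assume c: "c \<in> A" "c' \<in> A" "?f c = ?f c'"
    then have "the (T c) = the (T c')" "letters_read T (the (T c)) c = letters_read T (the (T c)) c'"
      by (auto simp: rec_map_def)
    then have "read_le c c'" "read_le c' c"
      using letters_read_less[OF fin, of c "the (T c)" c'] letters_read_less[OF fin, of c' "the (T c)" c]
        ssytD(2)[OF T c(1)] ssytD(2)[OF T c(2)] by auto
    then show "c = c'" by (rule read_le_antisym)
  qed
  have into: "?f c \<in> ?B" if "c \<in> A" for c
  proof -
    have "0 < letters_read T (the (T c)) c"
      unfolding letters_read_def card_gt_0_iff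
    proof
      have "c \<in> {c'. T c' = Some (the (T c)) \<and> read_le c' c}" using ssytD(2)[OF T that] by simp
      then show "{c'. T c' = Some (the (T c)) \<and> read_le c' c} \<noteq> {}" by blast
      show "finite {c'. T c' = Some (the (T c)) \<and> read_le c' c}"
        by (rule finite_subset[OF _ fin]) blast
    qed
    then show ?thesis using letters_read_le_content[OF fin, of "the (T c)" c] by (auto simp: rec_map_def delta)
  qed
  have onto: "?B \<subseteq> ?f ` A"
  proof
    fix b assume "b \<in> ?B"
    then obtain k q where b: "b = (k, q)" "q \<in> {g k<..delta k}" by (cases b) auto
    let ?C = "{c. T c = Some k}"
    have C: "?C \<subseteq> A" using dA by blast
    have "(\<lambda>c. g k + letters_read T k c) ` ?C = {g k<..delta k}"
    proof (rule card_subset_eq)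
      show "(\<lambda>c. g k + letters_read T k c) ` ?C \<subseteq> {g k<..delta k}"
        using into C by (fastforce simp: rec_map_def)
      have "inj_on (\<lambda>c. g k + letters_read T k c) ?C"
      proof (rule inj_onI)
        fix c c' assume c: "c \<in> ?C" "c' \<in> ?C" "g k + letters_read T k c = g k + letters_read T k c'"
        then have "?f c = ?f c'" by (simp add: rec_map_def)
        then show "c = c'" using inj_onD[OF inj] c C by blast
      qed
      then show "card ((\<lambda>c. g k + letters_read T k c) ` ?C) = card {g k<..delta k}"
        by (simp add: card_image delta content_def)
    qed simp
    then obtain c where "T c = Some k" "q = g k + letters_read T k c" using b by blast
    then show "b \<in> ?f ` A" using b C by (auto intro!: image_eqI[of _ _ c] simp: rec_map_def)
  qed
  have gA: "?g b \<in> A" "?f (?g b) = b" if "b \<in> ?B" for b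
    using onto that by (auto intro: inv_into_into f_inv_into_f)
  have T': "T (?g (k, q)) = Some k" "g k + letters_read T k (?g (k, q)) = q" if "(k, q) \<in> ?B" for k q
    using gA[OF that] ssytD(2)[OF T gA(1)[OF that]] by (auto simp: rec_map_def)
  note mf = monotone_picture_rec_map[OF T A dom]
  have "monotone_picture ?B ?g" unfolding monotone_picture_def
  proof (intro allI conjI impI)
    fix k q q' assume B: "(k, q) \<in> ?B" "(k, q') \<in> ?B" "q < q'"
    obtain i j i' j' where c: "?g (k, q) = (i, j)" "?g (k, q') = (i', j')" by fastforce
    have inA: "(i, j) \<in> A" "(i', j') \<in> A" using gA B c by metis+
    have Tc: "T (i, j) = Some k" "T (i', j') = Some k" using T' B c by metis+
    have "letters_read T k (i, j) < letters_read T k (i', j')"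
      using T'(2)[OF B(1)] T'(2)[OF B(2)] B(3) c by simp
    then have "\<not> read_le (i', j') (i, j)"
      using letters_read_mono[OF fin, of "(i', j')" "(i, j)" k] by linarith
    then have r: "i < i' \<or> i = i' \<and> j' < j" by (auto simp: read_le_def)
    have "j' < j"
    proof (rule ccontr)
      assume "\<not> j' < j"
      then have *: "i < i'" "j \<le> j'" using r by auto
      then have "(i, j') \<in> A" using skewD[OF A inA, of i j'] by auto
      then show False using ssytD(4)[OF T inA(1) _ *(2)] ssytD(5)[OF T _ inA(2) *(1)] Tc by fastforce
    qed
    then show "fst (?g (k, q)) \<le> fst (?g (k, q'))" "snd (?g (k, q')) < snd (?g (k, q))"
      using c r by auto
  next
    fix k k' q assume B: "(k, q) \<in> ?B" "(k', q) \<in> ?B" "k < k'"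
    obtain i j i' j' where c: "?g (k, q) = (i, j)" "?g (k', q) = (i', j')" by fastforce
    have inA: "(i, j) \<in> A" "(i', j') \<in> A" using gA B c by metis+
    have Tc: "T (i, j) = Some k" "T (i', j') = Some k'" using T' B c by metis+
    have "1 \<le> k" using ssytD(3)[OF T inA(1)] Tc by auto
    \<comment> \<open>Both cells have the same second coordinate \<open>q\<close>, so dominance at
      the cell of \<open>k'\<close> shows that the cell of \<open>k\<close> has been read by
      then.\<close>
    then have "g k' + letters_read T k' (i', j') \<le> g k + letters_read T k (i', j')"
      using dominated_antimono[OF dom, of "(i', j')" k k'] inA dA B by auto
    then have "letters_read T k (i, j) \<le> letters_read T k (i', j')" using T'(2)[OF B(1)] T'(2)[OF B(2)] c by simp
    then have "read_le (i, j) (i', j')" using letters_read_less[OF fin Tc(1), of "(i', j')"] by force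
    moreover have "\<not> (i = i' \<and> j' \<le> j)" using ssytD(4)[OF T inA(2), of j] Tc inA B(3) by fastforce
    ultimately have "i < i'" by (auto simp: read_le_def)
    moreover have "j' \<le> j"
    proof (rule ccontr)
      assume j: "\<not> j' \<le> j"
      then have *: "(i, j') \<in> A" using skewD[OF A inA, of i j'] \<open>i < i'\<close> by auto
      have "snd (?f (i', j')) \<le> snd (?f (i, j'))" using monotone_pictureD(4)[OF mf * inA(2) \<open>i < i'\<close>] .
      moreover have "snd (?f (i, j')) < snd (?f (i, j))" using monotone_pictureD(2)[OF mf inA(1) *] j by simp
      ultimately show False using gA(2)[OF B(1)] gA(2)[OF B(2)] c by simp
    qed
    ultimately show "fst (?g (k, q)) < fst (?g (k', q))" "snd (?g (k', q)) \<le> snd (?g (k, q))"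
      using c by auto
  qed
  then show ?thesis unfolding picture_def using into gA mf inv_into_f_f[OF inj] by auto
qed

section \<open>Tableaux recovered from pictures\<close>

definition fst_tableau :: "(nat \<times> nat) set \<Rightarrow> (nat \<times> nat \<Rightarrow> nat \<times> nat) \<Rightarrow> tableau" where
  "fst_tableau A f = (\<lambda>c. if c \<in> A then Some (fst (f c)) else None)"

lemma fst_tableau_rec_map: "ssyt d A T \<Longrightarrow> fst_tableau A (rec_map g T) = T"
  using ssytD(1)[of d A T] by (auto simp: fst_tableau_def rec_map_def fun_eq_iff domIff)

lemma ssyt_fst_tableau:
  assumes "picture A B f g" "\<And>k q. (k, q) \<in> B \<Longrightarrow> k \<in> {1..d}"
  shows "ssyt d A (fst_tableau A f)"
proof -
  have "fst (f c) \<in> {1..d}" if "c \<in> A" for c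
    using pictureD(1)[OF assms(1) that] assms(2)[of "fst (f c)" "snd (f c)"] by simp
  then show ?thesis
    using monotone_pictureD[OF pictureD(5)[OF assms(1)]]
    unfolding ssyt_def fst_tableau_def by (auto simp: dom_def ran_def split: if_splits)
qed

text \<open>\<open>P\<close> is left free because the same count is made for all letters
  \<open>k\<close>, for those in one row of the tableau, and for those read up to a given
  cell.\<close>

lemma picture_letters:
  assumes "picture A (cells delta gamma) f g"
  shows "{c. fst_tableau A f c = Some k \<and> P c} = (\<lambda>q. g (k, q)) ` {q. gamma k < q \<and> q \<le> delta k \<and> P (g (k, q))}"
proof -
  note p = pictureD[OF assms]
  show ?thesis
  proof (intro equalityI subsetI)
    fix c assume "c \<in> {c. fst_tableau A f c = Some k \<and> P c}"
    then have c: "c \<in> A" "f c = (k, snd (f c))" "P c"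
      by (auto simp: fst_tableau_def prod_eq_iff split: if_splits)
    then have g: "g (k, snd (f c)) = c" "(k, snd (f c)) \<in> cells delta gamma" using p(1,2) by metis+
    then show "c \<in> (\<lambda>q. g (k, q)) ` {q. gamma k < q \<and> q \<le> delta k \<and> P (g (k, q))}"
      using c(3) g(2)[unfolded mem_cells] by (intro image_eqI[of _ _ "snd (f c)"]) simp_all
  next
    fix c assume "c \<in> (\<lambda>q. g (k, q)) ` {q. gamma k < q \<and> q \<le> delta k \<and> P (g (k, q))}"
    then obtain q where q: "(k, q) \<in> cells delta gamma" "P (g (k, q))" "c = g (k, q)" by auto
    then show "c \<in> {c. fst_tableau A f c = Some k \<and> P c}"
      using p(3,4)[OF q(1)] by (simp add: fst_tableau_def)
  qed
qed

lemma picture_inj: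
  assumes "picture A (cells delta gamma) f g"
  shows "inj_on (\<lambda>q. g (k, q)) {q. gamma k < q \<and> q \<le> delta k \<and> P q}"
proof (rule inj_onI)
  fix q q' assume "q \<in> {q. gamma k < q \<and> q \<le> delta k \<and> P q}" "q' \<in> {q. gamma k < q \<and> q \<le> delta k \<and> P q}"
    "g (k, q) = g (k, q')"
  then have "(k, q) \<in> cells delta gamma" "(k, q') \<in> cells delta gamma" "g (k, q) = g (k, q')" by auto
  then have "(k, q) = (k, q')" using pictureD(4)[OF assms] by metis
  then show "q = q'" by simp
qed

lemma content_fst_tableau:
  assumes "picture A (cells delta gamma) f g"
  shows "content (fst_tableau A f) k = delta k - gamma k"
proof -
  have "content (fst_tableau A f) k = card {q. gamma k < q \<and> q \<le> delta k \<and> True}"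
    unfolding content_def using picture_letters[OF assms, of k "\<lambda>_. True"]
      card_image[OF picture_inj[OF assms, of k "\<lambda>_. True"]] by simp
  also have "{q. gamma k < q \<and> q \<le> delta k \<and> True} = {gamma k<..delta k}" by auto
  finally show ?thesis by simp
qed

lemma picture_row_read:
  assumes "picture A B f g" "(k, q) \<in> B" "(k, q') \<in> B"
  shows "read_le (g (k, q)) (g (k, q')) \<longleftrightarrow> q \<le> q'"
proof -
  have *: "read_le (g (k, a)) (g (k, b)) \<and> \<not> read_le (g (k, b)) (g (k, a))"
    if "a < b" "(k, a) \<in> B" "(k, b) \<in> B" for a b
    using monotone_pictureD(1,2)[OF pictureD(6)[OF assms(1)] that(2,3,1)] by (auto simp: read_le_def)
  show ?thesis using *[of q q'] *[of q' q] assms(2,3) by (cases q q' rule: linorder_cases) auto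
qed

text \<open>Along row \<open>fst (f c)\<close> of the target, \<open>g\<close> runs in reading
  order, so the second coordinate of a picture counts letters. Hence the tableau determines the
  picture.\<close>

lemma letters_read_fst_tableau:
  assumes "picture A (cells delta gamma) f g" "c \<in> A"
  shows "gamma (fst (f c)) + letters_read (fst_tableau A f) (fst (f c)) c = snd (f c)"
proof -
  let ?k = "fst (f c)" and ?q = "snd (f c)"
  have fc: "(?k, ?q) \<in> cells delta gamma" "g (?k, ?q) = c" using pictureD(1,2)[OF assms] by auto
  have q: "gamma ?k < ?q" "?q \<le> delta ?k" using fc(1) unfolding mem_cells by blast+
  have "letters_read (fst_tableau A f) ?k c = card {q. gamma ?k < q \<and> q \<le> delta ?k \<and> read_le (g (?k, q)) c}"
    unfolding letters_read_def picture_letters[OF assms(1)]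
    by (rule card_image[OF picture_inj[OF assms(1)]])
  also have "{q. gamma ?k < q \<and> q \<le> delta ?k \<and> read_le (g (?k, q)) c} = {gamma ?k<..?q}"
    using picture_row_read[OF assms(1), of ?k _ ?q] fc q by auto
  finally show ?thesis using q by simp
qed

lemma rec_map_fst_tableau:
  assumes "picture A (cells delta gamma) f g" "c \<in> A"
  shows "rec_map gamma (fst_tableau A f) c = f c"
  using letters_read_fst_tableau[OF assms] assms(2) by (simp add: rec_map_def fst_tableau_def)

text \<open>If the letter belonging to \<open>(i + 1, q)\<close> has been read and
  \<open>q > gamma i\<close>, then \<open>(i, q)\<close> lies in the target too and its letter was
  read earlier. The columns up to \<open>gamma i\<close> are paid for by the difference of the
  starting values.\<close>

lemma dominated_fst_tableau:
  assumes "picture A (cells delta gamma) f g" "is_partition gamma" "is_partition delta"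
  shows "dominated gamma (fst_tableau A f)"
  unfolding dominated_def
proof (intro ballI allI impI)
  fix c i assume i: "1 \<le> (i::nat)"
  let ?Q = "\<lambda>i. {q. gamma i < q \<and> q \<le> delta i \<and> read_le (g (i, q)) c}"
  have cnt: "letters_read (fst_tableau A f) i c = card (?Q i)" for i
    unfolding letters_read_def picture_letters[OF assms(1)]
    by (rule card_image[OF picture_inj[OF assms(1)]])
  have fin: "finite (?Q i)" for i by (rule finite_subset[of _ "{..delta i}"]) auto
  have part: "gamma (i + 1) \<le> gamma i" "delta (i + 1) \<le> delta i"
    using is_partitionD assms(2,3) i by auto
  have "?Q (i + 1) \<subseteq> {gamma (i + 1)<..gamma i} \<union> ?Q i"
  proof
    fix q assume q: "q \<in> ?Q (i + 1)"
    show "q \<in> {gamma (i + 1)<..gamma i} \<union> ?Q i"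
    proof (cases "q \<le> gamma i")
      case False
      then have "fst (g (i, q)) < fst (g (i + 1, q))"
        using q part by (intro monotone_pictureD(3)[OF pictureD(6)[OF assms(1)]]) auto
      then have "read_le (g (i, q)) (g (i + 1, q))" by (simp add: read_le_def)
      then show ?thesis using q False part by (auto intro: read_le_trans)
    qed (use q in auto)
  qed
  then have "card (?Q (i + 1)) \<le> card ({gamma (i + 1)<..gamma i} \<union> ?Q i)"
    by (rule card_mono[rotated]) (use fin in auto)
  also have "\<dots> \<le> (gamma i - gamma (i + 1)) + card (?Q i)"
    using card_Un_le[of "{gamma (i + 1)<..gamma i}" "?Q i"] by simp
  finally show "gamma (i + 1) + letters_read (fst_tableau A f) (i + 1) c
      \<le> gamma i + letters_read (fst_tableau A f) i c"
    using part unfolding cnt by simp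
qed

lemma count_word_of:
  "distinct L \<Longrightarrow> set L \<subseteq> dom T \<Longrightarrow> count_list (word_of T L) k = card {c \<in> set L. T c = Some k}"
proof (induction L)
  case (Cons c L)
  have "{a \<in> set (c # L). T a = Some k} = (if T c = Some k then {c} else {}) \<union> {a \<in> set L. T a = Some k}"
    by auto
  then show ?case using Cons by auto
qed simp

text \<open>A nonempty suffix of the row word consists of the cells read up to its first cell. The
  empty suffix yields the condition on \<open>g\<close> that \<open>dominated\<close> omits.\<close>

lemma dominant_row_reading:
  assumes "row_reading (dom T) L"
  shows "dominant g (word_of T L) \<longleftrightarrow> (\<forall>i\<ge>1. g (i + 1) \<le> g i) \<and> dominated g T"
proof -
  have dist: "distinct L" using row_reading_reading[OF assms] by (simp add: reading_def)
  have L: "set L = dom T" "sorted_wrt row_less L" using assms by (auto simp: row_reading_def)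
  have cnt: "count_list (word_of T (c # v)) i = letters_read T i c" if "L = u @ c # v" for u c v i
  proof -
    have "{a \<in> set (c # v). T a = Some i} = {a. T a = Some i \<and> read_le a c}"
    proof -
      have "a \<in> set (c # v) \<longleftrightarrow> read_le a c" if "a \<in> dom T" for a
      proof -
        have "a \<in> set u \<union> set (c # v)" using that L(1) \<open>L = u @ c # v\<close> by auto
        moreover have "row_less a c" if "a \<in> set u"
          using that L(2) \<open>L = u @ c # v\<close> by (auto simp: sorted_wrt_append)
        moreover have "row_less c a" if "a \<in> set v"
          using that L(2) \<open>L = u @ c # v\<close> by (auto simp: sorted_wrt_append)
        moreover have "\<not> (row_less a c \<and> row_less c a)" "\<not> row_less c c"
          by (auto simp: row_less_def)
        ultimately show ?thesis unfolding read_le_iff by auto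
      qed
      then show ?thesis by blast
    qed
    then show ?thesis unfolding letters_read_def
      using count_word_of[of "c # v" T i] dist L(1) that by (auto simp del: count_list.simps)
  qed
  show ?thesis
  proof
    assume *: "dominant g (word_of T L)"
    show "(\<forall>i\<ge>1. g (i + 1) \<le> g i) \<and> dominated g T" unfolding dominated_def
    proof (intro conjI ballI allI impI)
      fix i :: nat assume "1 \<le> i"
      then show "g (i + 1) \<le> g i" using dominant_antimono[of g "word_of T L" "[]" i "i + 1"] * by simp
    next
      fix c and i :: nat assume c: "c \<in> dom T" and i: "1 \<le> i"
      then obtain u v where L': "L = u @ c # v" using L(1) by (metis split_list)
      then have "word_of T L = word_of T u @ word_of T (c # v)" by simp
      then show "g (i + 1) + letters_read T (i + 1) c \<le> g i + letters_read T i c"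
        using dominant_antimono[of g "word_of T u" "word_of T (c # v)" i "i + 1"] * i cnt[OF L']
        by (metis le_add1)
    qed
  next
    assume *: "(\<forall>i\<ge>1. g (i + 1) \<le> g i) \<and> dominated g T"
    show "dominant g (word_of T L)" unfolding dominant_def
    proof (intro allI impI)
      fix a b i assume ab: "word_of T L = a @ b" and i: "1 \<le> (i::nat)"
      then obtain u v where uv: "L = u @ v" "b = word_of T v" by (auto simp: map_eq_append_conv)
      show "g (i + 1) + count_list b (i + 1) \<le> g i + count_list b i"
      proof (cases v)
        case Nil
        then show ?thesis using uv * i by simp
      next
        case (Cons c v')
        then have "c \<in> dom T" using uv L(1) by auto
        then show ?thesis using * i cnt[of u c v'] uv Cons by (auto simp: dominated_def)
      qed
    qed
  qed
qed

section \<open>Companions and evacuation\<close>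

definition box_cells :: "nat \<Rightarrow> nat \<Rightarrow> (nat \<times> nat) list" where
  "box_cells d m = concat (map (\<lambda>i. map (Pair i) [1..<m + 1]) (rev [1..<d + 1]))"

lemma set_box_cells: "set (box_cells d m) = {1..d} \<times> {1..m}"
  by (force simp: box_cells_def simp del: upt_Suc)

lemma sorted_box_cells: "sorted_wrt row_less (box_cells d m)"
proof (induction d)
  case (Suc d)
  have "sorted_wrt row_less (map (Pair (Suc d)) [1..<m + 1])"
    unfolding sorted_wrt_map row_less_def using sorted_wrt_upt[of 1 "m + 1"] by (simp del: upt_Suc)
  moreover have "box_cells (Suc d) m = map (Pair (Suc d)) [1..<m + 1] @ box_cells d m"
    by (simp add: box_cells_def)
  ultimately show ?case using Suc by (auto simp: sorted_wrt_append set_box_cells row_less_def[of "(_, _)"])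
qed (simp add: box_cells_def)

lemma row_word_filter: "row_word d m T = word_of T (filter (\<lambda>c. c \<in> dom T) (box_cells d m))"
  unfolding row_word_def box_cells_def filter_concat map_concat map_map o_def
proof (intro arg_cong[of _ _ concat] map_cong refl)
  fix i
  show "concat (map (\<lambda>j. if (i, j) \<in> dom T then [the (T (i, j))] else []) [1..<m + 1])
      = word_of T (filter (\<lambda>c. c \<in> dom T) (map (Pair i) [1..<m + 1]))"
  proof -
    have "concat (map (\<lambda>j. if (i, j) \<in> dom T then [the (T (i, j))] else []) xs)
      = word_of T (filter (\<lambda>c. c \<in> dom T) (map (Pair i) xs))" for xs
      by (induction xs) auto
    then show ?thesis .
  qed
qed

lemma row_reading_box: "S \<subseteq> {1..d} \<times> {1..m} \<Longrightarrow> row_reading S (filter (\<lambda>c. c \<in> S) (box_cells d m))"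
  by (auto simp: row_reading_def sorted_wrt_filter sorted_box_cells set_box_cells)

lemma row_word_eq:
  "dom T \<subseteq> {1..d} \<times> {1..m} \<Longrightarrow> row_reading (dom T) L \<Longrightarrow> row_word d m T = word_of T L"
  using row_reading_box row_reading_unique by (metis row_word_filter)

lemma set_row_word:
  assumes "ssyt d S T" "S \<subseteq> {1..d} \<times> {1..m}"
  shows "set (row_word d m T) \<subseteq> {1..d}"
proof
  fix x assume "x \<in> set (row_word d m T)"
  then obtain c where "c \<in> dom T" "x = the (T c)" unfolding row_word_filter by auto
  then show "x \<in> {1..d}" using ssytD(1,3)[OF assms(1)] by blast
qed

lemma count_row_word:
  assumes "dom T \<subseteq> {1..d} \<times> {1..m}"
  shows "count_list (row_word d m T) k = content T k"
proof -
  note r = row_reading_box[OF assms]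
  show ?thesis
    unfolding row_word_eq[OF assms r] content_def
    using count_word_of[of "filter (\<lambda>c. c \<in> dom T) (box_cells d m)" T k] row_reading_reading[OF r]
    by (auto simp: reading_def intro!: arg_cong[of _ _ card])
qed

lemma yamanouchi_rev: "yamanouchi (rev w) \<longleftrightarrow> dominant (\<lambda>_. 0) w"
proof
  assume *: "yamanouchi (rev w)"
  show "dominant (\<lambda>_. 0) w" unfolding dominant_def
  proof (intro allI impI)
    fix u v i assume "w = u @ v" "1 \<le> (i::nat)"
    then show "0 + count_list v (i + 1) \<le> 0 + count_list v i"
      using *[unfolded yamanouchi_def, THEN spec[of _ "length v"], rule_format, of i] by simp
  qed
next
  assume *: "dominant (\<lambda>_. 0) w"
  show "yamanouchi (rev w)" unfolding yamanouchi_def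
  proof (intro allI impI)
    fix k i assume "1 \<le> (i::nat)"
    moreover have "w = take (length w - k) w @ drop (length w - k) w" by simp
    ultimately have "0 + count_list (drop (length w - k) w) (i + 1) \<le> 0 + count_list (drop (length w - k) w) i"
      using * unfolding dominant_def by blast
    then show "count_list (take k (rev w)) (i + 1) \<le> count_list (take k (rev w)) i"
      by (simp add: take_rev)
  qed
qed

lemma cells_subset_box:
  assumes "partition_in d m lam"
  shows "cells lam mu \<subseteq> {1..d} \<times> {1..m}"
proof clarify
  fix i j assume "(i, j) \<in> cells lam mu"
  then show "i \<in> {1..d} \<and> j \<in> {1..m}"
    using partition_inD(3)[OF assms, of i] partition_inD(4)[OF assms, of i] by (cases "i \<in> {1..d}") auto
qed

lemma normal_shape_subset_box: "partition_in d m nu \<Longrightarrow> normal_shape nu \<subseteq> {1..d} \<times> {1..m}"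
  unfolding normal_shape_def by (rule cells_subset_box)

lemma dominant_row_word:
  assumes "dom T \<subseteq> {1..d} \<times> {1..m}" "is_partition g"
  shows "dominant g (row_word d m T) \<longleftrightarrow> dominated g T"
  unfolding row_word_eq[OF assms(1) row_reading_box[OF assms(1)]]
    dominant_row_reading[OF row_reading_box[OF assms(1)]]
  using assms(2) by (auto intro: is_partitionD)

definition skew_box :: "nat \<Rightarrow> nat \<Rightarrow> (nat \<Rightarrow> nat) \<Rightarrow> (nat \<Rightarrow> nat) \<Rightarrow> (nat \<Rightarrow> nat) \<Rightarrow> bool" where
  "skew_box d m lam mu nu \<longleftrightarrow> partition_in d m lam \<and> partition_in d m mu \<and> (\<forall>i. mu i \<le> lam i) \<and>
     partition_in d m nu"

lemma is_partition_0 [simp]: "is_partition (\<lambda>_. 0)"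
  by (simp add: is_partition_def)

lemma mem_LR_tableaux:
  "T \<in> LR_tableaux d m lam mu nu \<longleftrightarrow> skew_box d m lam mu nu \<and> ssyt d (cells lam mu) T \<and>
     dominated (\<lambda>_. 0) T \<and> content T = nu"
proof -
  have "yamanouchi (rev (row_word d m T)) \<longleftrightarrow> dominated (\<lambda>_. 0) T"
    if "partition_in d m lam" "ssyt d (cells lam mu) T"
    using dominant_row_word[of T d m "\<lambda>_. 0"] cells_subset_box[OF that(1)] ssytD(1)[OF that(2)]
    by (simp add: yamanouchi_rev)
  then show ?thesis unfolding LR_tableaux_def skew_box_def by blast
qed

lemma LR_picture:
  assumes "T \<in> LR_tableaux d m lam mu nu"
  obtains f g where "picture (cells lam mu) (normal_shape nu) f g" "T = fst_tableau (cells lam mu) f"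
proof
  have T: "skew_box d m lam mu nu" "ssyt d (cells lam mu) T" "dominated (\<lambda>_. 0) T" "content T = nu"
    using assms by (auto simp: mem_LR_tableaux)
  show "picture (cells lam mu) (normal_shape nu) (rec_map (\<lambda>_. 0) T) (inv_into (cells lam mu) (rec_map (\<lambda>_. 0) T))"
    unfolding normal_shape_def
    using T partition_inD(1) by (intro picture_rec_map skew_cells) (auto simp: skew_box_def)
  show "T = fst_tableau (cells lam mu) (rec_map (\<lambda>_. 0) T)" using fst_tableau_rec_map[OF T(2)] by simp
qed

lemma LR_of_picture:
  assumes "skew_box d m lam mu nu" "picture (cells lam mu) (normal_shape nu) f g"
  shows "fst_tableau (cells lam mu) f \<in> LR_tableaux d m lam mu nu"
    (is "?T \<in> _")
  unfolding mem_LR_tableaux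
proof (intro conjI)
  have nu: "partition_in d m nu" using assms(1) by (simp add: skew_box_def)
  note p = assms(2)[unfolded normal_shape_def]
  show "ssyt d (cells lam mu) ?T"
    using normal_shape_subset_box[OF nu] by (intro ssyt_fst_tableau[OF assms(2)]) blast
  show "dominated (\<lambda>_. 0) ?T"
    using partition_inD(1)[OF nu] by (intro dominated_fst_tableau[OF p]) auto
  show "content ?T = nu" using content_fst_tableau[OF p] by auto
qed (rule assms(1))

text \<open>Both lists are weakly increasing with equal multiplicities; the right-hand one is
  increasing because \<open>g\<close> moves weakly downwards along a row of
  \<open>nu\<close>.\<close>

lemma rows_of_entry_of_picture:
  assumes "skew_box d m lam mu nu" "picture (cells lam mu) (normal_shape nu) f g"
  shows "rows_of_entry d (fst_tableau (cells lam mu) f) k = map (\<lambda>q. fst (g (k, q))) [1..<nu k + 1]"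
    (is "?l = ?r")
proof -
  let ?A = "cells lam mu" and ?B = "normal_shape nu"
  let ?T = "fst_tableau ?A f"
  note p = assms(2)[unfolded normal_shape_def]
  note pp = pictureD[OF assms(2)]
  have A: "?A \<subseteq> {1..d} \<times> {1..m}" using assms(1) cells_subset_box unfolding skew_box_def by blast
  have "sorted ?r"
    unfolding sorted_map
  proof (rule sorted_wrt_mono_rel[OF _ sorted_wrt_upt])
    fix q q' assume "q \<in> set [1..<nu k + 1]" "q' \<in> set [1..<nu k + 1]" "q < q'"
    then show "fst (g (k, q)) \<le> fst (g (k, q'))" by (intro monotone_pictureD(1)[OF pp(6)]) auto
  qed
  moreover have "sorted ?l"
  proof -
    have "sorted (concat (map (\<lambda>r. replicate (h r) r) [1..<e + 1]))" for h :: "nat \<Rightarrow> nat" and e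
      by (induction e) (auto simp: sorted_append)
    then show ?thesis unfolding rows_of_entry_def .
  qed
  moreover have "mset ?l = mset ?r"
  proof (rule multiset_eqI)
    fix r
    have "count_list ?l r = (if r \<in> {1..d} then card {j. ?T (r, j) = Some k} else 0)"
    proof -
      have "count_list (replicate n x) y = (if x = y then n else 0)" for n x and y :: nat
        by (induction n) auto
      then have "count_list (concat (map (\<lambda>r. replicate (h r) r) [1..<e + 1])) r = (if r \<in> {1..e} then h r else 0)"
        for h :: "nat \<Rightarrow> nat" and e
        by (induction e) auto
      then show ?thesis unfolding rows_of_entry_def .
    qed
    also have "\<dots> = card {j. ?T (r, j) = Some k}"
    proof -
      have "(r, j) \<in> ?A" if "?T (r, j) = Some k" for j
        using that by (simp add: fst_tableau_def split: if_splits)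
      then have "{j. ?T (r, j) = Some k} = {}" if "r \<notin> {1..d}" using that A by blast
      then show ?thesis by simp
    qed
    also have "\<dots> = card {c. ?T c = Some k \<and> fst c = r}"
    proof -
      have "{c. ?T c = Some k \<and> fst c = r} = Pair r ` {j. ?T (r, j) = Some k}" by auto
      then show ?thesis by (simp add: card_image inj_on_def)
    qed
    also have "\<dots> = card {q. 0 < q \<and> q \<le> nu k \<and> fst (g (k, q)) = r}"
      unfolding picture_letters[OF p]
      using card_image[OF picture_inj[OF p, of k "\<lambda>q. fst (g (k, q)) = r"]] by simp
    also have "\<dots> = count_list ?r r"
    proof -
      have "count_list (map h xs) r = length (filter (\<lambda>q. h q = r) xs)" for h :: "nat \<Rightarrow> nat" and xs
        by (induction xs) auto
      then have "count_list ?r r = length (filter (\<lambda>q. fst (g (k, q)) = r) [1..<nu k + 1])" .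
      also have "\<dots> = card (set (filter (\<lambda>q. fst (g (k, q)) = r) [1..<nu k + 1]))"
        by (rule distinct_card[symmetric]) simp
      also have "set (filter (\<lambda>q. fst (g (k, q)) = r) [1..<nu k + 1])
          = {q. 0 < q \<and> q \<le> nu k \<and> fst (g (k, q)) = r}" by auto
      finally show ?thesis by simp
    qed
    finally show "count (mset ?l) r = count (mset ?r) r" by (simp only: count_mset)
  qed
  ultimately show ?thesis by (metis properties_for_sort)
qed

lemma companion_of_picture:
  assumes "skew_box d m lam mu nu" "picture (cells lam mu) (normal_shape nu) f g"
  shows "companion d (fst_tableau (cells lam mu) f) = fst_tableau (normal_shape nu) g"
proof -
  let ?B = "normal_shape nu" and ?T = "fst_tableau (cells lam mu) f"
  have nu: "partition_in d m nu" using assms(1) by (simp add: skew_box_def)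
  note rows = rows_of_entry_of_picture[OF assms]
  show ?thesis
  proof (rule ext, clarify)
    fix k j
    show "companion d ?T (k, j) = fst_tableau ?B g (k, j)"
      using partition_inD(4)[OF nu, of k] unfolding companion_def rows Let_def
      by (auto simp: fst_tableau_def simp del: upt_Suc)
  qed
qed

text \<open>Membership in \<open>LR_companions\<close> in intrinsic form
  (\<open>mem_LR_companions\<close>), which can be tested on a Knuth class without reference to an
  LR tableau.\<close>

definition companion_tableau :: "nat \<Rightarrow> (nat \<Rightarrow> nat) \<Rightarrow> (nat \<Rightarrow> nat) \<Rightarrow> (nat \<Rightarrow> nat) \<Rightarrow> tableau \<Rightarrow> bool" where
  "companion_tableau d lam mu nu G \<longleftrightarrow>
     ssyt d (normal_shape nu) G \<and> dominated mu G \<and> (\<forall>i. lam i = mu i + content G i)"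

lemma companion_tableau_of_picture:
  assumes "skew_box d m lam mu nu" "picture (cells lam mu) (normal_shape nu) f g"
  shows "companion_tableau d lam mu nu (fst_tableau (normal_shape nu) g)"
    and "\<And>b. b \<in> normal_shape nu \<Longrightarrow> rec_map mu (fst_tableau (normal_shape nu) g) b = g b"
proof -
  note p = picture_sym[OF assms(2)]
  have box: "cells lam mu \<subseteq> {1..d} \<times> {1..m}" using assms(1) cells_subset_box unfolding skew_box_def by blast
  show "companion_tableau d lam mu nu (fst_tableau (normal_shape nu) g)" unfolding companion_tableau_def
  proof (intro conjI allI)
    show "ssyt d (normal_shape nu) (fst_tableau (normal_shape nu) g)"
      using box by (intro ssyt_fst_tableau[OF p]) blast
    show "dominated mu (fst_tableau (normal_shape nu) g)"
      using assms(1) partition_inD(1) by (intro dominated_fst_tableau[OF p]) (auto simp: skew_box_def)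
    show "lam i = mu i + content (fst_tableau (normal_shape nu) g) i" for i
      using content_fst_tableau[OF p] assms(1) by (auto simp: skew_box_def)
  qed
  show "rec_map mu (fst_tableau (normal_shape nu) g) b = g b" if "b \<in> normal_shape nu" for b
    using rec_map_fst_tableau[OF p that] .
qed

lemma picture_of_companion_tableau:
  assumes "skew_box d m lam mu nu" "companion_tableau d lam mu nu G"
  obtains f where "picture (cells lam mu) (normal_shape nu) f (rec_map mu G)"
    "G = fst_tableau (normal_shape nu) (rec_map mu G)"
proof
  let ?f = "inv_into (normal_shape nu) (rec_map mu G)"
  have G: "ssyt d (normal_shape nu) G" "dominated mu G" "\<And>i. lam i = mu i + content G i"
    using assms(2) by (auto simp: companion_tableau_def)
  have "skew (normal_shape nu)" unfolding normal_shape_def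
    using assms(1) partition_inD(1) by (intro skew_cells) (auto simp: skew_box_def)
  then show "picture (cells lam mu) (normal_shape nu) ?f (rec_map mu G)"
    using G by (intro picture_sym[OF picture_rec_map])
  show "G = fst_tableau (normal_shape nu) (rec_map mu G)" using fst_tableau_rec_map[OF G(1)] by simp
qed

lemma companion_LR:
  assumes "T \<in> LR_tableaux d m lam mu nu"
  shows "companion_tableau d lam mu nu (companion d T)"
proof -
  obtain f g where p: "picture (cells lam mu) (normal_shape nu) f g" "T = fst_tableau (cells lam mu) f"
    using LR_picture[OF assms] .
  have "skew_box d m lam mu nu" using assms by (simp add: mem_LR_tableaux)
  then show ?thesis using companion_tableau_of_picture(1)[OF _ p(1)] companion_of_picture[OF _ p(1)] p(2) by simp
qed

lemma LR_of_companion_tableau: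
  assumes "skew_box d m lam mu nu" "companion_tableau d lam mu nu G"
  obtains T where "T \<in> LR_tableaux d m lam mu nu" "companion d T = G"
  using picture_of_companion_tableau[OF assms] LR_of_picture[OF assms(1)] companion_of_picture[OF assms(1)]
  by metis

text \<open>Numbering the companion from \<open>mu\<close> recovers the inverse picture
  \<open>g\<close>, and \<open>g\<close> determines \<open>f\<close>.\<close>

lemma companion_inj:
  assumes "T \<in> LR_tableaux d m lam mu nu" "T' \<in> LR_tableaux d m lam mu nu" "companion d T = companion d T'"
  shows "T = T'"
proof -
  have sb: "skew_box d m lam mu nu" using assms(1) by (simp add: mem_LR_tableaux)
  obtain f g where p: "picture (cells lam mu) (normal_shape nu) f g" "T = fst_tableau (cells lam mu) f"
    using LR_picture[OF assms(1)] .
  obtain f' g' where p': "picture (cells lam mu) (normal_shape nu) f' g'" "T' = fst_tableau (cells lam mu) f'"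
    using LR_picture[OF assms(2)] .
  have "g b = g' b" if "b \<in> normal_shape nu" for b
    using companion_tableau_of_picture(2)[OF sb p(1) that] companion_tableau_of_picture(2)[OF sb p'(1) that]
      assms(3) companion_of_picture[OF sb p(1)] companion_of_picture[OF sb p'(1)] p(2) p'(2) by metis
  then have "f c = f' c" if "c \<in> cells lam mu" for c
    using pictureD(1,2)[OF p(1) that] pictureD(4)[OF p'(1)] by metis
  then show ?thesis unfolding p(2) p'(2) fst_tableau_def by auto
qed

lemma mem_LR_companions:
  "G \<in> LR_companions d m nu lam mu \<longleftrightarrow> skew_box d m lam mu nu \<and> companion_tableau d lam mu nu G"
  unfolding LR_companions_def image_iff
  using companion_LR LR_of_companion_tableau by (metis mem_LR_tableaux)

section \<open>Rotation of tableaux inside the box\<close>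

definition rot_cell :: "nat \<Rightarrow> nat \<Rightarrow> nat \<times> nat \<Rightarrow> nat \<times> nat" where
  "rot_cell d m = (\<lambda>(i, j). (d + 1 - i, m + 1 - j))"

lemma rot_cell_rot_cell: "c \<in> {1..d} \<times> {1..m} \<Longrightarrow> rot_cell d m (rot_cell d m c) = c"
  by (auto simp: rot_cell_def)

lemma rot_cell_box: "c \<in> {1..d} \<times> {1..m} \<Longrightarrow> rot_cell d m c \<in> {1..d} \<times> {1..m}"
  by (auto simp: rot_cell_def)

lemma rot_eq:
  "rot d m T c = (if c \<in> {1..d} \<times> {1..m} then map_option (\<lambda>x. d + 1 - x) (T (rot_cell d m c)) else None)"
  by (auto simp: rot_def rot_cell_def split: prod.splits)

lemma dom_rot:
  assumes "dom T \<subseteq> {1..d} \<times> {1..m}"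
  shows "dom (rot d m T) = rot_cell d m ` dom T"
proof (intro equalityI subsetI)
  fix c assume "c \<in> dom (rot d m T)"
  then have "c \<in> {1..d} \<times> {1..m}" "rot_cell d m c \<in> dom T"
    by (auto simp: rot_eq dom_def split: if_splits)
  then show "c \<in> rot_cell d m ` dom T" using rot_cell_rot_cell by (metis imageI)
next
  fix c assume "c \<in> rot_cell d m ` dom T"
  then obtain c' where c: "c' \<in> dom T" "c = rot_cell d m c'" by blast
  then have "c' \<in> {1..d} \<times> {1..m}" using assms by blast
  then show "c \<in> dom (rot d m T)" using c rot_cell_rot_cell rot_cell_box by (auto simp: rot_eq dom_def)
qed

lemma rot_rot:
  assumes "ssyt d S T" "S \<subseteq> {1..d} \<times> {1..m}"
  shows "rot d m (rot d m T) = T"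
proof
  fix c
  show "rot d m (rot d m T) c = T c"
  proof (cases "c \<in> {1..d} \<times> {1..m}")
    case True
    have "map_option (\<lambda>x. d + 1 - (d + 1 - x)) (T c) = T c"
    proof (cases "T c")
      case (Some x)
      then have "c \<in> S" using ssytD(1)[OF assms(1)] by blast
      then show ?thesis using Some ssytD(3)[OF assms(1), of c] by auto
    qed simp
    then show ?thesis using True rot_cell_box[OF True] rot_cell_rot_cell[OF True]
      by (simp add: rot_eq option.map_comp o_def)
  next
    case False
    then have "T c = None" using assms ssytD(1)[OF assms(1)] by blast
    then show ?thesis using False by (simp add: rot_eq)
  qed
qed

lemma ssyt_rot:
  assumes "ssyt d S T" "S \<subseteq> {1..d} \<times> {1..m}"
  shows "ssyt d (rot_cell d m ` S) (rot d m T)"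
proof -
  have T: "T c = Some x \<Longrightarrow> x \<in> {1..d}" for c x using ssytD(1)[OF assms(1)] ssytD(3)[OF assms(1), of c] by force
  have r: "\<exists>x'. T (d + 1 - i, m + 1 - j) = Some x' \<and> x = d + 1 - x' \<and> i \<in> {1..d} \<and> j \<in> {1..m}"
    if "rot d m T (i, j) = Some x" for i j x
    using that by (auto simp: rot_def split: if_splits)
  show ?thesis unfolding ssyt_def
  proof (intro conjI allI impI)
    show "dom (rot d m T) = rot_cell d m ` S" using dom_rot ssytD(1)[OF assms(1)] assms(2) by blast
    show "ran (rot d m T) \<subseteq> {1..d}"
    proof
      fix x assume "x \<in> ran (rot d m T)"
      then obtain i j where "rot d m T (i, j) = Some x" by (auto simp: ran_def)
      then show "x \<in> {1..d}" using r T by fastforce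
    qed
    fix i j j' x y assume *: "rot d m T (i, j) = Some x \<and> rot d m T (i, j') = Some y \<and> j < j'"
    obtain x' where x: "T (d + 1 - i, m + 1 - j) = Some x'" "x = d + 1 - x'" "j \<in> {1..m}" using * r by blast
    obtain y' where y: "T (d + 1 - i, m + 1 - j') = Some y'" "y = d + 1 - y'" "j' \<in> {1..m}" using * r by blast
    have "m + 1 - j' < m + 1 - j" using x(3) y(3) * by auto
    then have "y' \<le> x'" using assms(1) x(1) y(1) unfolding ssyt_def by blast
    then show "x \<le> y" using x y by simp
  next
    fix i i' j x y assume *: "rot d m T (i, j) = Some x \<and> rot d m T (i', j) = Some y \<and> i < i'"
    obtain x' where x: "T (d + 1 - i, m + 1 - j) = Some x'" "x = d + 1 - x'" "i \<in> {1..d}" using * r by blast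
    obtain y' where y: "T (d + 1 - i', m + 1 - j) = Some y'" "y = d + 1 - y'" "i' \<in> {1..d}" using * r by blast
    have "d + 1 - i' < d + 1 - i" using x(3) y(3) * by auto
    then have "y' < x'" using assms(1) x(1) y(1) unfolding ssyt_def by blast
    then show "x < y" using x y T[OF x(1)] by auto
  qed
qed

lemma row_word_rot:
  assumes "ssyt d S T" "S \<subseteq> {1..d} \<times> {1..m}"
  shows "row_word d m (rot d m T) = rev_compl d (row_word d m T)"
proof -
  have dT: "dom T \<subseteq> {1..d} \<times> {1..m}" using assms ssytD(1) by blast
  define L where "L = filter (\<lambda>c. c \<in> dom T) (box_cells d m)"
  have L: "row_reading (dom T) L" unfolding L_def by (rule row_reading_box[OF dT])
  have rL: "row_reading (dom (rot d m T)) (rev (map (rot_cell d m) L))"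
  proof -
    have "sorted_wrt (\<lambda>c c'. row_less (rot_cell d m c') (rot_cell d m c)) L"
    proof (rule sorted_wrt_mono_rel)
      show "sorted_wrt row_less L" using L by (simp add: row_reading_def)
      fix c c' assume "c \<in> set L" "c' \<in> set L" "row_less c c'"
      then have "c \<in> {1..d} \<times> {1..m}" "c' \<in> {1..d} \<times> {1..m}" using L dT unfolding row_reading_def by blast+
      then show "row_less (rot_cell d m c') (rot_cell d m c)" using \<open>row_less c c'\<close>
        by (auto simp: row_less_def rot_cell_def)
    qed
    then show ?thesis using L dom_rot[OF dT] by (auto simp: row_reading_def sorted_wrt_rev sorted_wrt_map)
  qed
  have "dom (rot d m T) \<subseteq> {1..d} \<times> {1..m}" unfolding dom_rot[OF dT]
    by (rule image_subsetI, rule rot_cell_box, rule subsetD[OF dT])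
  then have "row_word d m (rot d m T) = word_of (rot d m T) (rev (map (rot_cell d m) L))"
    by (rule row_word_eq) (rule rL)
  also have "\<dots> = rev_compl d (word_of T L)" unfolding rev_compl_def rev_map[symmetric] map_map
  proof (intro arg_cong[of _ _ rev] map_cong refl)
    fix c assume "c \<in> set L"
    then have "c \<in> dom T" using L by (simp add: row_reading_def)
    moreover have "rot_cell d m c \<in> {1..d} \<times> {1..m}" "rot_cell d m (rot_cell d m c) = c"
      using rot_cell_box[OF subsetD[OF dT calculation]] rot_cell_rot_cell[OF subsetD[OF dT calculation]] .
    ultimately show "((\<lambda>c. the (rot d m T c)) \<circ> rot_cell d m) c = ((\<lambda>x. d + 1 - x) \<circ> (\<lambda>c. the (T c))) c"
      by (auto simp: rot_eq)
  qed
  finally show ?thesis using row_word_eq[OF dT L] by simp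
qed

lemma complement_complement:
  assumes "partition_in d m p"
  shows "complement d m (complement d m p) = p"
proof
  fix i
  show "complement d m (complement d m p) i = p i"
    using partition_inD(3)[OF assms, of i] partition_inD(4)[OF assms, of i]
    by (cases "i \<in> {1..d}") (auto simp: complement_def)
qed

lemma partition_in_complement:
  assumes "partition_in d m p"
  shows "partition_in d m (complement d m p)"
  unfolding partition_in_def
proof (intro conjI allI impI)
  fix i j assume "1 \<le> i \<and> (i::nat) \<le> j"
  then show "complement d m p j \<le> complement d m p i"
    using partition_inD(2)[OF assms, of "d + 1 - j" "d + 1 - i"]
    by (auto simp: complement_def intro!: diff_le_mono2)
qed (auto simp: complement_def)

lemma complement_mono: "(\<And>i. mu i \<le> lam i) \<Longrightarrow> complement d m lam i \<le> complement d m mu i"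
  by (auto simp: complement_def intro: diff_le_mono2)

lemma skew_box_complement:
  "skew_box d m lam mu nu \<Longrightarrow> skew_box d m (complement d m mu) (complement d m lam) nu"
  by (auto simp: skew_box_def partition_in_complement complement_mono)

lemma rot_cell_image_cells:
  assumes "partition_in d m lam" "\<And>i. mu i \<le> lam i"
  shows "rot_cell d m ` cells lam mu = cells (complement d m mu) (complement d m lam)"
proof -
  have sub: "rot_cell d m ` cells lam mu \<subseteq> cells (complement d m mu) (complement d m lam)"
    if "partition_in d m lam" for lam mu
  proof
    fix c assume "c \<in> rot_cell d m ` cells lam mu"
    then obtain i j where ij: "(i, j) \<in> cells lam mu" "c = (d + 1 - i, m + 1 - j)"
      by (auto simp: rot_cell_def)
    then have "i \<in> {1..d}" "j \<in> {1..m}" "lam i \<le> m" using cells_subset_box[OF that] partition_inD(3)[OF that] by blast+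
    then show "c \<in> cells (complement d m mu) (complement d m lam)" using ij by (auto simp: complement_def)
  qed
  have mu: "mu i \<le> m" "i \<notin> {1..d} \<Longrightarrow> mu i = 0" for i
    using assms(2)[of i] partition_inD(3,4)[OF assms(1), of i] by auto
  have "cells (complement d m mu) (complement d m lam) \<subseteq> rot_cell d m ` cells lam mu"
  proof
    fix c assume "c \<in> cells (complement d m mu) (complement d m lam)"
    then obtain i j where ij: "(i, j) \<in> cells (complement d m mu) (complement d m lam)" "c = (i, j)" by (cases c) auto
    then have i: "i \<in> {1..d}" by (auto simp: complement_def split: if_splits)
    then have "m - lam (d + 1 - i) < j" "j \<le> m - mu (d + 1 - i)" using ij by (auto simp: complement_def)
    then have "(d + 1 - i, m + 1 - j) \<in> cells lam mu" "j \<le> m"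
      using partition_inD(3)[OF assms(1), of "d + 1 - i"] mu(1)[of "d + 1 - i"] by auto
    moreover have "c = rot_cell d m (d + 1 - i, m + 1 - j)" using i ij(2) \<open>j \<le> m\<close> by (auto simp: rot_cell_def)
    ultimately show "c \<in> rot_cell d m ` cells lam mu" by blast
  qed
  then show ?thesis using sub[OF assms(1)] by blast
qed

lemma rot_cell_image_normal_shape:
  "partition_in d m nu \<Longrightarrow> rot_cell d m ` normal_shape nu = antinormal_shape d m nu"
  unfolding normal_shape_def antinormal_shape_def
  by (subst rot_cell_image_cells) (auto simp: complement_def fun_eq_iff intro!: arg_cong2[of _ _ _ _ cells])

section \<open>Evacuation and the anti-normal form\<close>

lemma order_ideal_normal_shape:
  assumes "partition_in d m nu"
  shows "order_ideal (normal_shape nu)"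
  unfolding order_ideal_def
proof (intro conjI ballI)
  show "finite (normal_shape nu)" using normal_shape_subset_box[OF assms] by (rule finite_subset) simp
  fix c assume "c \<in> normal_shape nu"
  then obtain i j where c: "c = (i, j)" "0 < j" "j \<le> nu i" by (cases c) auto
  have "(i', j') \<in> normal_shape nu" if "i' \<in> {1..i}" "j' \<in> {1..j}" for i' j'
    using c that partition_inD(2)[OF assms, of i' i] by auto
  moreover have "1 \<le> i" using c partition_inD(4)[OF assms, of 0] by (cases i) auto
  ultimately show "case c of (i, j) \<Rightarrow> 1 \<le> i \<and> 1 \<le> j \<and> {1..i} \<times> {1..j} \<subseteq> normal_shape nu"
    using c by auto
qed

lemma row_word_reading:
  assumes "ssyt d S T" "S \<subseteq> {1..d} \<times> {1..m}"
  obtains L where "row_reading S L" "row_word d m T = word_of T L"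
  using row_reading_box[OF assms(2)] row_word_eq ssytD(1)[OF assms(1)] assms(2) by metis

lemma ssyt_normal_unique:
  assumes "ssyt d (normal_shape nu) T" "partition_in d m nu"
    and "ssyt d (normal_shape nu') T'" "partition_in d m nu'"
    and "knuth_equiv (row_word d m T) (row_word d m T')"
  shows "T = T'"
proof -
  obtain L where "row_reading (normal_shape nu) L" "row_word d m T = word_of T L"
    using row_word_reading[OF assms(1) normal_shape_subset_box[OF assms(2)]] .
  moreover obtain L' where "row_reading (normal_shape nu') L'" "row_word d m T' = word_of T' L'"
    using row_word_reading[OF assms(3) normal_shape_subset_box[OF assms(4)]] .
  ultimately show ?thesis
    using ssyt_unique[OF assms(1) order_ideal_normal_shape[OF assms(2)] row_reading_reading
        assms(3) order_ideal_normal_shape[OF assms(4)] row_reading_reading] assms(5) by simp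
qed

text \<open>Insertion yields a tableau of some shape. Reversed complements and Knuth moves keep the
  Greene invariants, so this shape is \<open>nu\<close> again and fits into the box.\<close>

lemma ex_evac:
  assumes "ssyt d (normal_shape nu) G" "partition_in d m nu"
  obtains E where "ssyt d (normal_shape nu) E" "knuth_equiv (rev_compl d (row_word d m G)) (row_word d m E)"
proof -
  have box: "normal_shape nu \<subseteq> {1..d} \<times> {1..m}" using normal_shape_subset_box[OF assms(2)] .
  obtain L where L: "row_reading (normal_shape nu) L" "row_word d m G = word_of G L"
    using row_word_reading[OF assms(1) box] .
  note w = set_row_word[OF assms(1) box]
  obtain S E M where E: "order_ideal S" "ssyt d S E" "row_reading S M"
    "knuth_equiv (rev_compl d (row_word d m G)) (word_of E M)"
    using ex_rectification[OF set_rev_compl[OF w]] by metis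
  have "normal_shape nu = S"
    by (rule greene_shape[OF assms(1) order_ideal_normal_shape[OF assms(2)] row_reading_reading[OF L(1)]
          E(2,1) row_reading_reading[OF E(3)]])
      (use greene_rev_compl[OF w] greene_knuth[OF E(4)] L(2) in simp)
  moreover have "row_word d m E = word_of E M"
    using row_word_eq[of E d m M] E(3) ssytD(1)[OF E(2)] box calculation by simp
  ultimately show ?thesis using that E by metis
qed

text \<open>One tableau \<open>E\<close> settles both definite descriptions: a candidate for the
  anti-normal form becomes, when rotated, a normal tableau whose word is Knuth equivalent to that of
  \<open>E\<close>.\<close>

lemma evac_eqI:
  assumes "ssyt d (normal_shape nu) G" "partition_in d m nu"
    and "ssyt d (normal_shape nu) E" "knuth_equiv (rev_compl d (row_word d m G)) (row_word d m E)"
  shows "evac d m G = E" "antinormal_form d m G = rot d m E"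
proof -
  note box = normal_shape_subset_box[OF assms(2)]
  show "evac d m G = E" unfolding evac_def normal_form_def row_word_rot[OF assms(1) box]
  proof (rule the_equality)
    show "(\<exists>nu. partition_in d m nu \<and> ssyt d (normal_shape nu) E) \<and>
        knuth_equiv (rev_compl d (row_word d m G)) (row_word d m E)" using assms by blast
    fix H assume "(\<exists>nu. partition_in d m nu \<and> ssyt d (normal_shape nu) H) \<and>
        knuth_equiv (rev_compl d (row_word d m G)) (row_word d m H)"
    then show "H = E" using ssyt_normal_unique assms knuth_equiv_trans knuth_equiv_sym by metis
  qed
  show "antinormal_form d m G = rot d m E" unfolding antinormal_form_def
  proof (rule the_equality)
    have w: "set (row_word d m G) \<subseteq> {1..d}" using set_row_word[OF assms(1) box] .
    have "knuth_equiv (row_word d m G) (row_word d m (rot d m E))"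
      using knuth_equiv_rev_compl[OF assms(4) set_rev_compl[OF w]]
      unfolding row_word_rot[OF assms(3) box] rev_compl_rev_compl[OF w] .
    then show "(\<exists>nu. partition_in d m nu \<and> ssyt d (antinormal_shape d m nu) (rot d m E)) \<and>
        knuth_equiv (row_word d m G) (row_word d m (rot d m E))"
      using assms(2) ssyt_rot[OF assms(3) box] rot_cell_image_normal_shape[OF assms(2)] by auto
    fix H assume "(\<exists>nu. partition_in d m nu \<and> ssyt d (antinormal_shape d m nu) H) \<and>
        knuth_equiv (row_word d m G) (row_word d m H)"
    then obtain nu' where nu': "partition_in d m nu'" "ssyt d (antinormal_shape d m nu') H"
      and k: "knuth_equiv (row_word d m G) (row_word d m H)" by blast
    note box' = normal_shape_subset_box[OF nu'(1)]
    have abox: "antinormal_shape d m nu' \<subseteq> {1..d} \<times> {1..m}"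
      unfolding rot_cell_image_normal_shape[OF nu'(1), symmetric]
      by (rule image_subsetI, rule rot_cell_box, rule subsetD[OF box'])
    have "rot_cell d m ` antinormal_shape d m nu' = normal_shape nu'"
      unfolding rot_cell_image_normal_shape[OF nu'(1), symmetric] image_image
      using rot_cell_rot_cell[OF subsetD[OF box']] by simp
    then have "ssyt d (normal_shape nu') (rot d m H)" using ssyt_rot[OF nu'(2) abox] by simp
    moreover have "knuth_equiv (row_word d m E) (row_word d m (rot d m H))"
      using knuth_equiv_rev_compl[OF k w] assms(4) knuth_equiv_trans knuth_equiv_sym
      unfolding row_word_rot[OF nu'(2) abox] by metis
    ultimately have "E = rot d m H" using ssyt_normal_unique[OF assms(3,2) _ nu'(1)] by blast
    then show "H = rot d m E" using rot_rot[OF nu'(2) abox] by simp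
  qed
qed

lemma evac_props:
  assumes "ssyt d (normal_shape nu) G" "partition_in d m nu"
  shows "ssyt d (normal_shape nu) (evac d m G)"
    and "knuth_equiv (rev_compl d (row_word d m G)) (row_word d m (evac d m G))"
    and "antinormal_form d m G = rot d m (evac d m G)"
    and "rot d m (antinormal_form d m G) = evac d m G"
    and "evac d m (evac d m G) = G"
proof -
  note box = normal_shape_subset_box[OF assms(2)]
  obtain E where E: "ssyt d (normal_shape nu) E" "knuth_equiv (rev_compl d (row_word d m G)) (row_word d m E)"
    using ex_evac[OF assms] .
  note e = evac_eqI[OF assms E]
  show "ssyt d (normal_shape nu) (evac d m G)"
    and "knuth_equiv (rev_compl d (row_word d m G)) (row_word d m (evac d m G))"
    and "antinormal_form d m G = rot d m (evac d m G)"
    and "rot d m (antinormal_form d m G) = evac d m G" using E e rot_rot[OF E(1) box] by simp_all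
  have w: "set (row_word d m G) \<subseteq> {1..d}" using set_row_word[OF assms(1) box] .
  have "knuth_equiv (rev_compl d (row_word d m E)) (row_word d m G)"
    using knuth_equiv_rev_compl[OF E(2) set_rev_compl[OF w]] knuth_equiv_sym
    unfolding rev_compl_rev_compl[OF w] by blast
  then show "evac d m (evac d m G) = G" using evac_eqI(1)[OF E(1) assms(2,1)] e by simp
qed

text \<open>Dominance passes to the reversed complement by \<open>dominant_rev_compl\<close> and
  from there to the rectification by Knuth invariance; rotation exchanges the roles of
  \<open>lam\<close> and \<open>mu\<close>.\<close>

lemma companion_tableau_evac:
  assumes "skew_box d m lam mu nu" "companion_tableau d lam mu nu G"
  shows "companion_tableau d (complement d m mu) (complement d m lam) nu (evac d m G)"
  unfolding companion_tableau_def
proof (intro conjI allI)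
  have G: "ssyt d (normal_shape nu) G" "dominated mu G" "\<And>i. lam i = mu i + content G i"
    using assms(2) by (auto simp: companion_tableau_def)
  have p: "partition_in d m lam" "partition_in d m mu" "partition_in d m nu" using assms(1) by (auto simp: skew_box_def)
  note E = evac_props[OF G(1) p(3)]
  note box = normal_shape_subset_box[OF p(3)]
  have dG: "dom G \<subseteq> {1..d} \<times> {1..m}" "dom (evac d m G) \<subseteq> {1..d} \<times> {1..m}"
    using ssytD(1)[OF G(1)] ssytD(1)[OF E(1)] box by auto
  note w = set_row_word[OF G(1) box]
  show "ssyt d (normal_shape nu) (evac d m G)" by (rule E(1))
  have "dominant mu (row_word d m G)" using dominant_row_word[OF dG(1) partition_inD(1)[OF p(2)]] G(2) by simp
  then have "dominant (complement d m lam) (rev_compl d (row_word d m G))"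
    using w G(3) partition_inD(3)[OF p(1)] count_row_word[OF dG(1)] by (intro dominant_rev_compl) auto
  then show "dominated (complement d m lam) (evac d m G)"
    using dominant_knuth[OF E(2)] dominant_row_word[OF dG(2) partition_inD(1)[OF partition_in_complement[OF p(1)]]]
    by simp
  fix i
  have cE: "content (evac d m G) i = count_list (rev_compl d (row_word d m G)) i"
    using knuth_equiv_count[OF E(2)] count_row_word[OF dG(2)] by simp
  show "complement d m mu i = complement d m lam i + content (evac d m G) i"
  proof (cases "i \<in> {1..d}")
    case True
    then show ?thesis
      using cE count_rev_compl[OF w True] count_row_word[OF dG(1)] G(3)[of "d + 1 - i"]
        partition_inD(3)[OF p(1), of "d + 1 - i"] by (simp add: complement_def)
  next
    case False
    then have "count_list (rev_compl d (row_word d m G)) i = 0"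
      using set_rev_compl[OF w] by (auto simp: count_list_0_iff)
    then show ?thesis using False cE by (auto simp: complement_def)
  qed
qed

section \<open>Reversal\<close>

text \<open>Before an entry \<open>k > 1\<close> some \<open>k - 1\<close> has to be read. In the
  same row only entries at least \<open>k\<close> are read earlier, so that \<open>k - 1\<close>
  lies in a higher row, and induction on the row gives the upper bound. The lower bound is column
  strictness.\<close>

lemma highest_weight_tableau:
  assumes E: "ssyt d S E" and S: "order_ideal S" and dom: "dominated (\<lambda>_. 0) E" and c: "(i, j) \<in> S"
  shows "the (E (i, j)) = i"
proof (rule antisym)
  have fin: "finite (dom E)" using order_ideal_finite[OF S] ssytD(1)[OF E] by simp
  show "the (E (i, j)) \<le> i" using c
  proof (induction i arbitrary: j rule: less_induct)
    case (less i)
    let ?k = "the (E (i, j))"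
    show ?case
    proof (cases "?k \<le> 1")
      case True
      then show ?thesis using order_idealD(1)[OF S less.prems] by simp
    next
      case False
      have "0 < letters_read E ?k (i, j)" unfolding letters_read_def card_gt_0_iff
      proof
        have "(i, j) \<in> {c'. E c' = Some ?k \<and> read_le c' (i, j)}" using ssytD(2)[OF E less.prems] by simp
        then show "{c'. E c' = Some ?k \<and> read_le c' (i, j)} \<noteq> {}" by blast
        show "finite {c'. E c' = Some ?k \<and> read_le c' (i, j)}" by (rule finite_subset[OF _ fin]) blast
      qed
      moreover have "0 + letters_read E ?k (i, j) \<le> 0 + letters_read E (?k - 1) (i, j)"
        using dominated_antimono[OF dom, of "(i, j)" "?k - 1" ?k] less.prems ssytD(1)[OF E] False by auto
      ultimately have "0 < letters_read E (?k - 1) (i, j)" by linarith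
      then have "{c'. E c' = Some (?k - 1) \<and> read_le c' (i, j)} \<noteq> {}"
        unfolding letters_read_def card_gt_0_iff by (rule conjunct1)
      then obtain a b where ab: "E (a, b) = Some (?k - 1)" "read_le (a, b) (i, j)" by auto
      then have abS: "(a, b) \<in> S" using ssytD(1)[OF E] by blast
      have "a < i"
      proof (rule ccontr)
        assume "\<not> a < i"
        then have "a = i" "j \<le> b" using ab(2) by (auto simp: read_le_def)
        then show False using ssytD(4)[OF E less.prems, of b] abS ab(1) False by auto
      qed
      then show ?thesis using less.IH[OF _ abS] ab(1) by auto
    qed
  qed
  show "i \<le> the (E (i, j))" using c
  proof (induction i)
    case (Suc i)
    show ?case
    proof (cases "i = 0")
      case True
      then show ?thesis using ssytD(3)[OF E Suc.prems] by simp
    next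
      case False
      then have "(i, j) \<in> S" using order_idealD(3)[OF S Suc.prems, of i j] order_idealD(2)[OF S Suc.prems] by simp
      then show ?thesis using Suc ssytD(5)[OF E, of i j "Suc i"] by simp
    qed
  qed simp
qed

text \<open>In the rectification of a Yamanouchi word every entry is its own row number. Hence the
  content fixes the shape, and the shape fixes the tableau.\<close>

lemma yamanouchi_knuth_equiv:
  assumes "set w \<subseteq> {1..d}" "dominant (\<lambda>_. 0) w" "dominant (\<lambda>_. 0) w'" "mset w = mset w'"
  shows "knuth_equiv w w'"
proof -
  have w': "set w' \<subseteq> {1..d}" using assms(1,4) by (metis set_mset_mset)
  obtain S E L where E: "order_ideal S" "ssyt d S E" "row_reading S L" "knuth_equiv w (word_of E L)"
    using ex_rectification[OF assms(1)] .
  obtain S' E' L' where E': "order_ideal S'" "ssyt d S' E'" "row_reading S' L'" "knuth_equiv w' (word_of E' L')"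
    using ex_rectification[OF w'] .
  have hw: "the (E c) = fst c" if "order_ideal S" "ssyt d S E" "row_reading S L" "knuth_equiv w (word_of E L)"
    "dominant (\<lambda>_. 0) w" "c \<in> S" for S E L w and c :: "nat \<times> nat"
  proof -
    have "dominated (\<lambda>_. 0) E"
      using dominant_knuth[OF that(4)] that(5) dominant_row_reading[of E L] that(3) ssytD(1)[OF that(2)] by simp
    then show ?thesis using highest_weight_tableau[OF that(2,1), of "fst c" "snd c"] that(6) by simp
  qed
  have card: "card {c \<in> S. fst c \<le> k} = length (filter (\<lambda>x. x \<le> k) (word_of E L))"
    if "row_reading S L" "\<And>c. c \<in> S \<Longrightarrow> the (E c) = fst c" for S E L k
  proof -
    have L: "set L = S" "distinct L" using row_reading_reading[OF that(1)] by (auto simp: reading_def)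
    have "word_of E L = map fst L" using that(2) L by auto
    then have "length (filter (\<lambda>x. x \<le> k) (word_of E L)) = length (filter (\<lambda>c. fst c \<le> k) L)"
      by (simp only: filter_map length_map o_def)
    also have "\<dots> = card (set (filter (\<lambda>c. fst c \<le> k) L))" using L(2) by (intro distinct_card[symmetric]) simp
    also have "set (filter (\<lambda>c. fst c \<le> k) L) = {c \<in> S. fst c \<le> k}" using L by auto
    finally show ?thesis by simp
  qed
  have m: "mset (word_of E L) = mset (word_of E' L')"
    using knuth_equiv_mset[OF E(4)] knuth_equiv_mset[OF E'(4)] assms(4) by simp
  have "S = S'"
  proof (rule order_ideal_eqI[OF E(1) E'(1)])
    fix k
    have "mset (filter (\<lambda>x. x \<le> k) (word_of E L)) = mset (filter (\<lambda>x. x \<le> k) (word_of E' L'))"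
      using m by simp
    then have "length (filter (\<lambda>x. x \<le> k) (word_of E L)) = length (filter (\<lambda>x. x \<le> k) (word_of E' L'))"
      by (metis size_mset)
    then show "card {c \<in> S. fst c \<le> k} = card {c \<in> S'. fst c \<le> k}"
      using card[OF E(3) hw[OF E assms(2)]] card[OF E'(3) hw[OF E' assms(3)]] by simp
  qed
  moreover have "L = L'" using row_reading_unique[OF E(3)] E'(3) calculation by blast
  moreover have "word_of E L = map fst L" "word_of E' L' = map fst L'"
    using hw[OF E assms(2)] hw[OF E' assms(3)] E(3) E'(3) by (auto simp: row_reading_def)
  ultimately show ?thesis using E(4) E'(4) knuth_equiv_trans knuth_equiv_sym by metis
qed

lemma LR_knuth_equiv:
  assumes "T \<in> LR_tableaux d m lam mu nu" "T' \<in> LR_tableaux d m lam' mu' nu"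
  shows "knuth_equiv (row_word d m T) (row_word d m T')"
proof -
  have *: "set (row_word d m T) \<subseteq> {1..d}" "dominant (\<lambda>_. 0) (row_word d m T)" "count_list (row_word d m T) = nu"
    if "T \<in> LR_tableaux d m lam mu nu" for T lam mu
  proof -
    have T: "partition_in d m lam" "ssyt d (cells lam mu) T" "dominated (\<lambda>_. 0) T" "content T = nu"
      using that by (auto simp: mem_LR_tableaux skew_box_def)
    note box = cells_subset_box[OF T(1), of mu]
    have dT: "dom T \<subseteq> {1..d} \<times> {1..m}" using ssytD(1)[OF T(2)] box by simp
    show "set (row_word d m T) \<subseteq> {1..d}" using set_row_word[OF T(2) box] .
    show "dominant (\<lambda>_. 0) (row_word d m T)" using dominant_row_word[OF dT] T(3) by simp
    show "count_list (row_word d m T) = nu" using count_row_word[OF dT] T(4) by auto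
  qed
  have "mset (row_word d m T) = mset (row_word d m T')"
    using *(3)[OF assms(1)] *(3)[OF assms(2)] by (intro multiset_eqI) (simp add: count_mset)
  then show ?thesis using yamanouchi_knuth_equiv * assms by blast
qed

section \<open>Cells in the order of their letters, and dual Knuth equivalence\<close>

definition letter_less :: "tableau \<Rightarrow> nat \<times> nat \<Rightarrow> nat \<times> nat \<Rightarrow> bool" where
  "letter_less T c c' \<longleftrightarrow> the (T c') < the (T c) \<or> the (T c) = the (T c') \<and> row_less c' c"

text \<open>The cells of \<open>T\<close> in the order of the row word of its companion: letters decreasing, and the
  cells with a given letter from top to bottom and from right to left.\<close>

definition letter_reading :: "nat \<Rightarrow> nat \<Rightarrow> tableau \<Rightarrow> (nat \<times> nat) list" where
  "letter_reading d m T = (let L = filter (\<lambda>c. c \<in> dom T) (box_cells d m)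
     in rev (map (\<lambda>p. L ! p) (sort_key (\<lambda>p. row_word d m T ! p) [0..<length L])))"

text \<open>Makes the stability of \<open>sort_key\<close> explicit, since standardization depends
  on the order of equal letters.\<close>

lemma sorted_wrt_sort_key:
  fixes f :: "nat \<Rightarrow> nat"
  assumes "sorted_wrt (<) xs"
  shows "sorted_wrt (\<lambda>p q. f p < f q \<or> f p = f q \<and> p < q) (sort_key f xs)"
proof -
  have ins: "sorted_wrt (\<lambda>p q. f p < f q \<or> f p = f q \<and> p < q) (insort_key f x l)"
    if "sorted_wrt (\<lambda>p q. f p < f q \<or> f p = f q \<and> p < q) l" "\<forall>y\<in>set l. x < y" for x l
    using that by (induction l) (auto simp: set_insort_key)
  show ?thesis using assms by (induction xs) (auto intro: ins)
qed

lemma letter_reading: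
  assumes "dom T \<subseteq> {1..d} \<times> {1..m}"
  shows "set (letter_reading d m T) = dom T" "sorted_wrt (letter_less T) (letter_reading d m T)"
proof -
  define L where "L = filter (\<lambda>c. c \<in> dom T) (box_cells d m)"
  let ?P = "sort_key (\<lambda>p. row_word d m T ! p) [0..<length L]"
  have L: "set L = dom T" "sorted_wrt row_less L"
    using row_reading_box[OF assms] by (auto simp: L_def row_reading_def)
  have w: "row_word d m T = word_of T L" by (simp add: row_word_filter L_def)
  have l: "letter_reading d m T = rev (map (\<lambda>p. L ! p) ?P)"
    by (simp add: letter_reading_def L_def Let_def)
  show "set (letter_reading d m T) = dom T"
    using L(1) arg_cong[OF map_nth, of set L] unfolding l by simp
  have "sorted_wrt (\<lambda>p q. letter_less T (L ! q) (L ! p)) ?P"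
  proof (rule sorted_wrt_mono_rel[OF _ sorted_wrt_sort_key])
    fix p q assume pq: "p \<in> set ?P" "q \<in> set ?P"
      "row_word d m T ! p < row_word d m T ! q \<or> row_word d m T ! p = row_word d m T ! q \<and> p < q"
    then have "p < length L" "q < length L" by auto
    then show "letter_less T (L ! q) (L ! p)"
      using pq(3) sorted_wrt_nth_less[OF L(2), of p q] unfolding w letter_less_def by auto
  qed simp
  then show "sorted_wrt (letter_less T) (letter_reading d m T)"
    unfolding l by (simp add: sorted_wrt_rev sorted_wrt_map)
qed

lemma letter_reading_unique:
  assumes "dom T \<subseteq> {1..d} \<times> {1..m}" "set L = dom T" "sorted_wrt (letter_less T) L"
  shows "letter_reading d m T = L"
  by (rule sorted_wrt_unique[OF letter_reading(2)[OF assms(1)] assms(3)])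
    (use letter_reading(1)[OF assms(1)] assms(2) in \<open>auto simp: letter_less_def row_less_def\<close>)

text \<open>\<open>inverse_std\<close> lists positions in the row word. Replacing a position by its
  complemented row is monotone, since the row word climbs from the bottom row to the top. Rows
  increase weakly, so positions in one row occur in increasing order, which is the hypothesis of
  both standardization lemmas. One map \<open>f\<close> serves both tableaux because they have the
  same cells.\<close>

lemma dual_knuth_equiv_iff:
  assumes "ssyt d S T" "ssyt d S R" "S \<subseteq> {1..d} \<times> {1..m}"
  shows "dual_knuth_equiv (row_word d m T) (row_word d m R) \<longleftrightarrow>
    knuth_equiv (rev_compl d (map fst (letter_reading d m T))) (rev_compl d (map fst (letter_reading d m R)))"
proof -
  define L where "L = filter (\<lambda>c. c \<in> S) (box_cells d m)"
  \<comment> \<open>Positions count from 1, hence \<open>q - 1\<close>; the value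
    \<open>d + 1\<close> behind the end of the word keeps \<open>f\<close> monotone on all
    numbers.\<close>
  define f where "f q = (if q \<le> length L then d + 1 - fst (L ! (q - 1)) else d + 1)" for q
  let ?inv = "\<lambda>T. map Suc (sort_key (\<lambda>p. row_word d m T ! p) [0..<length L])"
  have L: "set L = S" "sorted_wrt row_less L"
    using row_reading_box[OF assms(3)] by (auto simp: L_def row_reading_def)
  have "mono f"
  proof (rule monoI)
    fix p q :: nat assume "p \<le> q"
    show "f p \<le> f q"
    proof (cases "q \<le> length L \<and> p - 1 < q - 1")
      case True
      then have "row_less (L ! (p - 1)) (L ! (q - 1))"
        using sorted_wrt_nth_less[OF L(2), of "p - 1" "q - 1"] by linarith
      then show ?thesis using True \<open>p \<le> q\<close> by (auto simp: f_def row_less_def)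
    next
      case False
      then have "\<not> q \<le> length L \<or> p - 1 = q - 1" using \<open>p \<le> q\<close> by auto
      then show ?thesis using \<open>p \<le> q\<close> by (auto simp: f_def)
    qed
  qed
  have inv: "inverse_std (row_word d m U) = ?inv U"
    "rev_compl d (map fst (letter_reading d m U)) = map f (?inv U)"
    "sorted_wrt (\<lambda>a b. f a = f b \<longrightarrow> a < b) (?inv U)"
    if U: "ssyt d S U" for U
  proof -
    have w: "row_word d m U = word_of U L" by (simp add: row_word_filter L_def ssytD(1)[OF U])
    show "inverse_std (row_word d m U) = ?inv U" by (simp add: inverse_std_def w)
    show "rev_compl d (map fst (letter_reading d m U)) = map f (?inv U)"
      by (auto simp: rev_compl_def letter_reading_def ssytD(1)[OF U] L_def[symmetric] f_def rev_map)
    show "sorted_wrt (\<lambda>a b. f a = f b \<longrightarrow> a < b) (?inv U)" unfolding sorted_wrt_map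
    proof (rule sorted_wrt_mono_rel[OF _ sorted_wrt_sort_key])
      fix p q assume pq: "p \<in> set (sort_key (\<lambda>p. row_word d m U ! p) [0..<length L])"
        "q \<in> set (sort_key (\<lambda>p. row_word d m U ! p) [0..<length L])"
        "row_word d m U ! p < row_word d m U ! q \<or> row_word d m U ! p = row_word d m U ! q \<and> p < q"
      then have len: "p < length L" "q < length L" by auto
      show "f (Suc p) = f (Suc q) \<longrightarrow> Suc p < Suc q"
      proof (rule impI, rule ccontr)
        assume eq: "f (Suc p) = f (Suc q)" and "\<not> Suc p < Suc q"
        then have "q < p" using pq(3) by (cases "p = q") auto
        have S: "L ! p \<in> S" "L ! q \<in> S" using L(1) len by auto
        then have "L ! p \<in> {1..d} \<times> {1..m}" "L ! q \<in> {1..d} \<times> {1..m}" using assms(3) by blast+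
        then have "fst (L ! p) \<in> {1..d}" "fst (L ! q) \<in> {1..d}" by (simp_all only: mem_Times_iff)
        then have "fst (L ! p) = fst (L ! q)" using eq len by (auto simp: f_def)
        moreover have "row_less (L ! q) (L ! p)" using sorted_wrt_nth_less[OF L(2) \<open>q < p\<close> len(1)] .
        ultimately have "the (U (L ! q)) \<le> the (U (L ! p))"
          using ssytD(4)[OF U, of "fst (L ! q)" "snd (L ! q)" "snd (L ! p)"] S
          by (auto simp: row_less_def prod.collapse) (metis less_imp_le prod.collapse)
        then show False using pq(3) \<open>q < p\<close> len unfolding w by auto
      qed
    qed simp
  qed
  have m: "mset (?inv T) = mset (?inv R)" by simp
  show ?thesis
    unfolding dual_knuth_equiv_def inv(1,2)[OF assms(1)] inv(1,2)[OF assms(2)]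
    using knuth_destandardize[OF \<open>mono f\<close> _ inv(3)[OF assms(1)]]
      knuth_standardize[OF \<open>mono f\<close> _ m inv(3)[OF assms(1)] inv(3)[OF assms(2)]] by blast
qed

text \<open>The inverse picture carries row \<open>k\<close> of \<open>nu\<close>, from left to
  right, to the letters \<open>k\<close> of \<open>T\<close> in reading order. It therefore
  transports the row reading of the companion to the letter reading of \<open>T\<close>.\<close>

lemma letter_reading_LR:
  assumes "T \<in> LR_tableaux d m lam mu nu"
  shows "map fst (letter_reading d m T) = row_word d m (companion d T)"
proof -
  obtain f g where p: "picture (cells lam mu) (normal_shape nu) f g" "T = fst_tableau (cells lam mu) f"
    using LR_picture[OF assms] .
  have sb: "skew_box d m lam mu nu" using assms by (simp add: mem_LR_tableaux)
  then have nu: "partition_in d m nu" by (simp add: skew_box_def)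
  note pp = pictureD[OF p(1)]
  have G: "companion d T = fst_tableau (normal_shape nu) g"
    using companion_of_picture[OF sb p(1)] p(2) by simp
  have dG: "dom (companion d T) = normal_shape nu" unfolding G by (auto simp: fst_tableau_def split: if_splits)
  define L where "L = filter (\<lambda>c. c \<in> normal_shape nu) (box_cells d m)"
  have L: "set L = normal_shape nu" "sorted_wrt row_less L"
    using row_reading_box[OF normal_shape_subset_box[OF nu]] by (auto simp: L_def row_reading_def)
  have T: "dom T = cells lam mu" unfolding p(2) by (auto simp: fst_tableau_def split: if_splits)
  have "letter_reading d m T = map g L"
  proof (rule letter_reading_unique)
    show "dom T \<subseteq> {1..d} \<times> {1..m}" unfolding T using sb cells_subset_box unfolding skew_box_def by blast
    show "set (map g L) = dom T" using pp(1-4) L(1) unfolding T by (auto simp: image_iff) (metis pp(1,2))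
    show "sorted_wrt (letter_less T) (map g L)" unfolding sorted_wrt_map
    proof (rule sorted_wrt_mono_rel[OF _ L(2)])
      fix b b' assume b: "b \<in> set L" "b' \<in> set L" "row_less b b'"
      obtain k q k' q' where bb: "b = (k, q)" "b' = (k', q')" by fastforce
      have B: "(k, q) \<in> normal_shape nu" "(k', q') \<in> normal_shape nu" using b L(1) bb by auto
      have Tg: "the (T (g (k, q))) = k" "the (T (g (k', q'))) = k'"
        using pp(3,4)[OF B(1)] pp(3,4)[OF B(2)] unfolding p(2) fst_tableau_def by auto
      show "letter_less T (g b) (g b')"
      proof (cases "k = k'")
        case True
        then have "q < q'" using b(3) bb by (auto simp: row_less_def)
        then have "read_le (g (k, q)) (g (k', q'))" "\<not> read_le (g (k', q')) (g (k, q))"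
          using picture_row_read[OF picture_sym[OF picture_sym[OF p(1)]]] B True by auto
        then show ?thesis using Tg True bb unfolding letter_less_def read_le_iff by auto
      next
        case False
        then show ?thesis using b(3) bb Tg by (auto simp: letter_less_def row_less_def)
      qed
    qed
  qed
  then show ?thesis unfolding row_word_filter dG L_def[symmetric] using L(1) unfolding G
    by (auto simp: fst_tableau_def)
qed

lemma letter_reading_rot:
  assumes "ssyt d S T" "S \<subseteq> {1..d} \<times> {1..m}"
  shows "map fst (letter_reading d m (rot d m T)) = rev_compl d (map fst (letter_reading d m T))"
proof -
  have dT: "dom T \<subseteq> {1..d} \<times> {1..m}" "dom T = S" using assms ssytD(1) by blast+
  note l = letter_reading[OF dT(1)]
  have "letter_reading d m (rot d m T) = rev (map (rot_cell d m) (letter_reading d m T))"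
  proof (rule letter_reading_unique)
    show "dom (rot d m T) \<subseteq> {1..d} \<times> {1..m}" unfolding dom_rot[OF dT(1)]
      by (rule image_subsetI, rule rot_cell_box, rule subsetD[OF dT(1)])
    show "set (rev (map (rot_cell d m) (letter_reading d m T))) = dom (rot d m T)"
      using l(1) dom_rot[OF dT(1)] by simp
    have "sorted_wrt (\<lambda>c c'. letter_less (rot d m T) (rot_cell d m c') (rot_cell d m c)) (letter_reading d m T)"
    proof (rule sorted_wrt_mono_rel[OF _ l(2)])
      fix c c' assume c: "c \<in> set (letter_reading d m T)" "c' \<in> set (letter_reading d m T)" "letter_less T c c'"
      have *: "b \<in> {1..d} \<times> {1..m} \<and> the (rot d m T (rot_cell d m b)) = d + 1 - the (T b) \<and> the (T b) \<in> {1..d}"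
        if "b \<in> S" for b
      proof -
        have b: "b \<in> {1..d} \<times> {1..m}" using assms(2) that by blast
        show ?thesis using ssytD(2,3)[OF assms(1) that] b rot_cell_box[OF b] rot_cell_rot_cell[OF b]
          by (metis option.map_sel option.distinct(1) rot_eq)
      qed
      have r: "row_less (rot_cell d m c) (rot_cell d m c')" if "row_less c' c"
        using that *[of c] *[of c'] c l(1) dT(2) by (auto simp: row_less_def rot_cell_def)
      show "letter_less (rot d m T) (rot_cell d m c') (rot_cell d m c)"
        using *[of c] *[of c'] c(1,2) l(1) dT(2) r c(3) unfolding letter_less_def by auto
    qed
    then show "sorted_wrt (letter_less (rot d m T)) (rev (map (rot_cell d m) (letter_reading d m T)))"
      by (simp add: sorted_wrt_rev sorted_wrt_map)
  qed
  then show ?thesis by (auto simp: rev_compl_def rev_map rot_cell_def split: prod.splits)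
qed

text \<open>For uniqueness, let \<open>U\<close> be the rotation of a candidate \<open>R\<close>.
  Its word is Knuth equivalent to that of \<open>T\<close>, so \<open>U\<close> is again an LR
  tableau with content \<open>nu\<close>. Dual Knuth equivalence makes its companion Knuth
  equivalent to that of \<open>T'\<close>; normal tableaux in one Knuth class agree, and companions
  determine LR tableaux.\<close>

lemma reversal_eq:
  assumes T: "T \<in> LR_tableaux d m lam mu nu"
    and T': "T' \<in> LR_tableaux d m (complement d m mu) (complement d m lam) nu"
    and k: "knuth_equiv (rev_compl d (row_word d m (companion d T))) (row_word d m (companion d T'))"
  shows "reversal d m T = rot d m T'"
proof -
  let ?lam = "complement d m mu" and ?mu = "complement d m lam"
  have sb: "skew_box d m lam mu nu" "skew_box d m ?lam ?mu nu" using T T' by (auto simp: mem_LR_tableaux)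
  have p: "partition_in d m lam" "partition_in d m mu" "\<And>i. mu i \<le> lam i" "partition_in d m nu"
    "partition_in d m ?lam" "partition_in d m ?mu" "\<And>i. ?mu i \<le> ?lam i"
    using sb by (auto simp: skew_box_def)
  have sT: "ssyt d (cells lam mu) T" and sT': "ssyt d (cells ?lam ?mu) T'" using T T' by (auto simp: mem_LR_tableaux)
  note box = cells_subset_box[OF p(1), of mu] and box' = cells_subset_box[OF p(5), of ?mu]
  have im: "rot_cell d m ` cells lam mu = cells ?lam ?mu" using rot_cell_image_cells[OF p(1,3)] .
  have im': "rot_cell d m ` cells ?lam ?mu = cells lam mu"
    using rot_cell_image_cells[OF p(5,7)] complement_complement p(1,2) by simp
  have w: "set (row_word d m T) \<subseteq> {1..d}" "set (row_word d m T') \<subseteq> {1..d}"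
    using set_row_word sT sT' box box' by blast+
  have "companion_tableau d lam mu nu (companion d T)" using companion_LR[OF T] .
  then have wG: "set (row_word d m (companion d T)) \<subseteq> {1..d}"
    using set_row_word[OF _ normal_shape_subset_box[OF p(4)]] by (auto simp: companion_tableau_def)
  have sG': "ssyt d (normal_shape nu) (companion d T')"
    using companion_LR[OF T'] by (auto simp: companion_tableau_def)
  then have wG': "set (row_word d m (companion d T')) \<subseteq> {1..d}"
    using set_row_word[OF _ normal_shape_subset_box[OF p(4)]] by blast
  show ?thesis unfolding reversal_def
  proof (rule the_equality)
    have s: "ssyt d (cells lam mu) (rot d m T')" using ssyt_rot[OF sT' box'] im' by simp
    have "dual_knuth_equiv (row_word d m T) (row_word d m (rot d m T'))"
      unfolding dual_knuth_equiv_iff[OF sT s box] letter_reading_rot[OF sT' box'] letter_reading_LR[OF T]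
        letter_reading_LR[OF T'] rev_compl_rev_compl[OF wG'] by (rule k)
    moreover have "knuth_equiv (row_word d m (rot d m T)) (row_word d m (rot d m T'))"
      unfolding row_word_rot[OF sT box] row_word_rot[OF sT' box']
      using LR_knuth_equiv[OF T T'] w(1) by (rule knuth_equiv_rev_compl)
    ultimately show "ssyt d (dom T) (rot d m T') \<and> dual_knuth_equiv (row_word d m T) (row_word d m (rot d m T')) \<and>
        knuth_equiv (row_word d m (rot d m T)) (row_word d m (rot d m T'))"
      using s ssytD(1)[OF sT] by simp
    fix R assume "ssyt d (dom T) R \<and> dual_knuth_equiv (row_word d m T) (row_word d m R) \<and>
        knuth_equiv (row_word d m (rot d m T)) (row_word d m R)"
    then have R: "ssyt d (cells lam mu) R" "dual_knuth_equiv (row_word d m T) (row_word d m R)"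
      "knuth_equiv (rev_compl d (row_word d m T)) (row_word d m R)"
      using ssytD(1)[OF sT] row_word_rot[OF sT box] by auto
    define U where "U = rot d m R"
    have RU: "R = rot d m U" using rot_rot[OF R(1) box] by (simp add: U_def)
    have sU: "ssyt d (cells ?lam ?mu) U" using ssyt_rot[OF R(1) box] im by (simp add: U_def)
    have kU: "knuth_equiv (row_word d m T) (row_word d m U)"
      using knuth_equiv_rev_compl[OF R(3) set_rev_compl[OF w(1)]]
      unfolding rev_compl_rev_compl[OF w(1)] U_def row_word_rot[OF R(1) box] .
    have dU: "dom U \<subseteq> {1..d} \<times> {1..m}" "dom T \<subseteq> {1..d} \<times> {1..m}"
      using ssytD(1)[OF sU] box' ssytD(1)[OF sT] box by auto
    have U: "U \<in> LR_tableaux d m ?lam ?mu nu" unfolding mem_LR_tableaux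
    proof (intro conjI)
      have T0: "dominated (\<lambda>_. 0) T" "content T = nu" using T by (auto simp: mem_LR_tableaux)
      show "dominated (\<lambda>_. 0) U"
        using T0(1) dominant_knuth[OF kU] dominant_row_word[OF dU(1)] dominant_row_word[OF dU(2)] by simp
      show "content U = nu"
        using T0(2) knuth_equiv_count[OF kU] count_row_word[OF dU(1)] count_row_word[OF dU(2)] by (auto simp: fun_eq_iff)
    qed (fact sb sU)+
    have sGU: "ssyt d (normal_shape nu) (companion d U)"
      using companion_LR[OF U] by (auto simp: companion_tableau_def)
    then have wGU: "set (row_word d m (companion d U)) \<subseteq> {1..d}"
      using set_row_word[OF _ normal_shape_subset_box[OF p(4)]] by blast
    have "knuth_equiv (rev_compl d (row_word d m (companion d T))) (row_word d m (companion d U))"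
      using R(2) unfolding dual_knuth_equiv_iff[OF sT R(1) box] letter_reading_LR[OF T]
      unfolding RU letter_reading_rot[OF sU box'] letter_reading_LR[OF U] rev_compl_rev_compl[OF wGU] .
    then have "companion d U = companion d T'"
      using ssyt_normal_unique[OF sGU p(4) sG' p(4)] k knuth_equiv_trans knuth_equiv_sym by metis
    then show "R = rot d m T'" using companion_inj[OF U T'] RU by simp
  qed
qed

section \<open>Opposite companions under rotation\<close>

lemma rows_of_entry_rot:
  assumes "ssyt d S T" "S \<subseteq> {1..d} \<times> {1..m}" "k \<in> {1..d}"
  shows "rows_of_entry d (rot d m T) k = rev_compl d (rows_of_entry d T (d + 1 - k))"
proof -
  let ?h = "\<lambda>r. card {j. T (r, j) = Some (d + 1 - k)}"
  have "card {j. rot d m T (r, j) = Some k} = ?h (d + 1 - r)" if r: "r \<in> {1..d}" for r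
  proof -
    have T: "j \<in> {1..m} \<and> x \<in> {1..d}" if "T (i, j) = Some x" for i j x
      using that ssytD(1)[OF assms(1)] ssytD(3)[OF assms(1), of "(i, j)"] assms(2) by force
    have "{j. rot d m T (r, j) = Some k} = (\<lambda>j. m + 1 - j) ` {j. T (d + 1 - r, j) = Some (d + 1 - k)}"
    proof (intro equalityI subsetI)
      fix j assume "j \<in> {j. rot d m T (r, j) = Some k}"
      then obtain x where x: "j \<in> {1..m}" "T (d + 1 - r, m + 1 - j) = Some x" "k = d + 1 - x"
        by (auto simp: rot_def split: if_splits)
      then have "T (d + 1 - r, m + 1 - j) = Some (d + 1 - k)" using T[OF x(2)] by auto
      then show "j \<in> (\<lambda>j. m + 1 - j) ` {j. T (d + 1 - r, j) = Some (d + 1 - k)}"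
        using x(1) by (intro image_eqI[of _ _ "m + 1 - j"]) auto
    next
      fix j assume "j \<in> (\<lambda>j. m + 1 - j) ` {j. T (d + 1 - r, j) = Some (d + 1 - k)}"
      then obtain j' where j: "j = m + 1 - j'" "T (d + 1 - r, j') = Some (d + 1 - k)" by blast
      then show "j \<in> {j. rot d m T (r, j) = Some k}" using T[OF j(2)] r assms(3) by (auto simp: rot_def)
    qed
    moreover have "inj_on (\<lambda>j. m + 1 - j) {j. T (d + 1 - r, j) = Some (d + 1 - k)}"
      using T by (auto simp: inj_on_def) (metis Suc_diff_le diff_diff_cancel le_SucI nat.inject)
    ultimately show ?thesis by (simp add: card_image)
  qed
  then have "rows_of_entry d (rot d m T) k = concat (map (\<lambda>r. replicate (?h (d + 1 - r)) r) [1..<d + 1])"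
    unfolding rows_of_entry_def by (intro arg_cong[of _ _ concat] map_cong) auto
  also have "\<dots> = concat (map (\<lambda>r. replicate (?h r) (d + 1 - r)) (map (\<lambda>r. d + 1 - r) [1..<d + 1]))"
    unfolding map_map by (intro arg_cong[of _ _ concat] map_cong) (auto simp del: upt_Suc)
  also have "map (\<lambda>r. d + 1 - r) [1..<d + 1] = rev [1..<d + 1]"
    by (rule nth_equalityI) (auto simp: rev_nth simp del: upt_Suc)
  also have "concat (map (\<lambda>r. replicate (?h r) (d + 1 - r)) (rev [1..<d + 1]))
      = rev_compl d (rows_of_entry d T (d + 1 - k))"
    unfolding rev_compl_def rows_of_entry_def rev_concat map_concat map_map rev_map[symmetric]
    by (intro arg_cong[of _ _ concat] map_cong) auto
  finally show ?thesis .
qed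

text \<open>Rotation turns left-justified rows into right-justified ones; the bound on the lengths
  prevents truncation in \<open>m - length L\<close>.\<close>

lemma opposite_companion_rot:
  assumes "ssyt d S T" "S \<subseteq> {1..d} \<times> {1..m}" "\<And>k. length (rows_of_entry d T k) \<le> m"
  shows "opposite_companion d m (rot d m T) = rot d m (companion d T)"
proof (rule ext, clarify)
  fix k j
  show "opposite_companion d m (rot d m T) (k, j) = rot d m (companion d T) (k, j)"
  proof (cases "k \<in> {1..d}")
    case True
    let ?L = "rows_of_entry d T (d + 1 - k)"
    have L: "length ?L \<le> m" by (rule assms(3))
    have "rev_compl d ?L ! (j - (m - length ?L) - 1) = d + 1 - ?L ! (m - j)"
      if "m - length ?L < j" "j \<le> m"
    proof -
      have "length ?L - Suc (j - (m - length ?L) - 1) = m - j" using that L by linarith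
      then show ?thesis using that L by (simp add: rev_compl_def rev_nth)
    qed
    then show ?thesis
      unfolding opposite_companion_def Let_def split rows_of_entry_rot[OF assms(1,2) True]
      using True L by (auto simp: rot_def companion_def rev_compl_def Let_def)
  qed (auto simp: opposite_companion_def rot_def)
qed

section \<open>Orthogonal transposition\<close>

lemma conjugate_iff:
  assumes "partition_in d m p" "1 \<le> j"
  shows "{i. j \<le> p i} = {1..conjugate p j}"
proof -
  have sub: "{i. j \<le> p i} \<subseteq> {1..d}"
  proof
    fix i assume "i \<in> {i. j \<le> p i}"
    then show "i \<in> {1..d}" using partition_inD(4)[OF assms(1), of i] assms(2) by (cases "i \<in> {1..d}") auto
  qed
  then have fin: "finite {i. j \<le> p i}" by (rule finite_subset) simp
  have "{i. j \<le> p i} = {1..card {i. j \<le> p i}}"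
  proof (cases "{i. j \<le> p i} = {}")
    case False
    then obtain M where M: "j \<le> p M" "\<And>i. j \<le> p i \<Longrightarrow> i \<le> M"
      using Max_in[OF fin False] Max_ge[OF fin] by blast
    have "{i. j \<le> p i} = {1..M}"
    proof (intro equalityI subsetI)
      fix i assume "i \<in> {i. j \<le> p i}"
      then show "i \<in> {1..M}" using sub M(2) by auto
    next
      fix i assume "i \<in> {1..M}"
      then show "i \<in> {i. j \<le> p i}" using M(1) partition_inD(2)[OF assms(1), of i M] by auto
    qed
    then show ?thesis by simp
  qed simp
  then show ?thesis using assms(2) by (simp add: conjugate_def)
qed

lemma le_conjugate_iff:
  assumes "partition_in d m p" "1 \<le> i" "1 \<le> j"
  shows "i \<le> conjugate p j \<longleftrightarrow> j \<le> p i"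
  using eqset_imp_iff[OF conjugate_iff[OF assms(1,3)], of i] assms(2) by simp

lemma partition_in_conjugate:
  assumes "partition_in d m p"
  shows "partition_in m d (conjugate p)"
  unfolding partition_in_def
proof (intro conjI allI impI)
  have le: "conjugate p j \<le> d" for j
  proof (cases "j = 0")
    case False
    show ?thesis
    proof (cases "conjugate p j = 0")
      case c: False
      then have "j \<le> p (conjugate p j)" using le_conjugate_iff[OF assms, of "conjugate p j" j] False by simp
      then show ?thesis using partition_inD(4)[OF assms, of "conjugate p j"] False
        by (cases "conjugate p j \<in> {1..d}") auto
    qed simp
  qed (simp add: conjugate_def)
  then show "conjugate p j \<le> d" for j .
  show "conjugate p j \<le> conjugate p i" if "1 \<le> i \<and> i \<le> j" for i j
  proof (cases "conjugate p j = 0")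
    case False
    then have "j \<le> p (conjugate p j)" using le_conjugate_iff[OF assms, of "conjugate p j" j] that by simp
    then show ?thesis using le_conjugate_iff[OF assms, of "conjugate p j" i] that False by simp
  qed simp
  show "conjugate p i = 0" if "i \<notin> {1..m}" for i
  proof (cases "i = 0")
    case False
    then show ?thesis
      using le_conjugate_iff[OF assms, of "conjugate p i" i] partition_inD(3)[OF assms, of "conjugate p i"] that
      by (cases "conjugate p i = 0") auto
  qed (simp add: conjugate_def)
qed

text \<open>Evacuation and orthogonal transposition each contribute a rotation. This identity
  cancels the two, so that the shape of the transposer is the plain transpose.\<close>

lemma complement_conjugate:
  assumes "partition_in d m p"
  shows "complement m d (conjugate (complement d m p)) = conjugate p"
proof
  fix j
  note pc = partition_in_complement[OF assms]
  show "complement m d (conjugate (complement d m p)) j = conjugate p j"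
  proof (cases "j \<in> {1..m}")
    case True
    let ?c = "conjugate (complement d m p) (m + 1 - j)"
    have c: "?c \<le> d" "conjugate p j \<le> d"
      using partition_inD(3)[OF partition_in_conjugate[OF pc]] partition_inD(3)[OF partition_in_conjugate[OF assms]] by blast+
    have "i \<le> conjugate p j \<longleftrightarrow> i \<le> d - ?c" if i: "i \<in> {1..d}" for i
    proof -
      have "d + 1 - i \<le> ?c \<longleftrightarrow> m + 1 - j \<le> m - p i"
      proof -
        have "complement d m p (d + 1 - i) = m - p i" using i by (auto simp: complement_def)
        moreover have "1 \<le> d + 1 - i" "1 \<le> m + 1 - j" using i True by auto
        ultimately show ?thesis using le_conjugate_iff[OF pc, of "d + 1 - i" "m + 1 - j"] by simp
      qed
      also have "\<dots> \<longleftrightarrow> \<not> j \<le> p i" using True partition_inD(3)[OF assms, of i] by auto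
      finally show ?thesis using le_conjugate_iff[OF assms, of i j] i True c(1) by auto
    qed
    note iff = this
    have "conjugate p j = d - ?c"
    proof (rule antisym)
      show "conjugate p j \<le> d - ?c"
        using iff[of "conjugate p j"] c(2) by (cases "conjugate p j = 0") simp_all
      show "d - ?c \<le> conjugate p j"
        using iff[of "d - ?c"] by (cases "d - ?c = 0") simp_all
    qed
    then show ?thesis using True by (simp add: complement_def)
  next
    case False
    then show ?thesis using partition_inD(4)[OF partition_in_conjugate[OF assms]] by (auto simp: complement_def)
  qed
qed

lemma skew_box_conjugate:
  assumes "skew_box d m lam mu nu"
  shows "skew_box m d (complement m d (conjugate mu)) (complement m d (conjugate lam)) (conjugate nu)"
proof -
  have p: "partition_in d m lam" "partition_in d m mu" "\<And>i. mu i \<le> lam i" "partition_in d m nu"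
    using assms by (auto simp: skew_box_def)
  have "conjugate mu j \<le> conjugate lam j" for j
  proof (cases "j = 0 \<or> conjugate mu j = 0")
    case False
    then show ?thesis
      using le_conjugate_iff[OF p(2), of "conjugate mu j" j] le_conjugate_iff[OF p(1), of "conjugate mu j" j]
        p(3)[of "conjugate mu j"] by auto
  qed (auto simp: conjugate_def)
  then have "skew_box m d (conjugate lam) (conjugate mu) (conjugate nu)"
    using p partition_in_conjugate by (simp add: skew_box_def)
  then show ?thesis by (rule skew_box_complement)
qed

section \<open>Orthogonal transposition of pictures\<close>

definition ot_cell :: "nat \<Rightarrow> nat \<Rightarrow> nat \<times> nat \<Rightarrow> nat \<times> nat" where
  "ot_cell d m = (\<lambda>(i, j). (m + 1 - j, d + 1 - i))"

lemma mem_ot_cells: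
  assumes "skew_box d m lam mu nu"
  shows "(r, c) \<in> cells (complement m d (conjugate mu)) (complement m d (conjugate lam)) \<longleftrightarrow>
     r \<in> {1..m} \<and> c \<in> {1..d} \<and> (d + 1 - c, m + 1 - r) \<in> cells lam mu"
proof -
  have p: "partition_in d m lam" "partition_in d m mu" using assms by (auto simp: skew_box_def)
  have le: "conjugate lam (m + 1 - r) \<le> d" "conjugate mu (m + 1 - r) \<le> d"
    using partition_inD(3)[OF partition_in_conjugate] p by blast+
  show ?thesis
  proof (cases "r \<in> {1..m} \<and> c \<in> {1..d}")
    case True
    have "d + 1 - c \<le> conjugate lam (m + 1 - r) \<longleftrightarrow> m + 1 - r \<le> lam (d + 1 - c)"
      "d + 1 - c \<le> conjugate mu (m + 1 - r) \<longleftrightarrow> m + 1 - r \<le> mu (d + 1 - c)"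
      using True le_conjugate_iff[OF p(1), of "d + 1 - c" "m + 1 - r"]
        le_conjugate_iff[OF p(2), of "d + 1 - c" "m + 1 - r"] by auto
    then show ?thesis
      unfolding mem_cells complement_def
      using True le by (simp add: le_diff_conv2) linarith
  next
    case False
    have "r \<in> {1..m} \<and> c \<in> {1..d}"
      if "(r, c) \<in> cells (complement m d (conjugate mu)) (complement m d (conjugate lam))"
    proof -
      have c: "0 < c" "c \<le> complement m d (conjugate mu) r" using that unfolding mem_cells by linarith+
      show ?thesis
      proof (cases "r \<in> {1..m}")
        case True
        then show ?thesis using c unfolding complement_def if_P[OF True] by simp
      next
        case False
        then show ?thesis using c unfolding complement_def if_not_P[OF False] by simp
      qed
    qed
    then show ?thesis using False by blast
  qed
qed

lemma mem_normal_shape_conjugate: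
  assumes "partition_in d m nu"
  shows "(q, k) \<in> normal_shape (conjugate nu) \<longleftrightarrow> (k, q) \<in> normal_shape nu"
proof (cases "q = 0 \<or> k = 0")
  case True
  then show ?thesis using partition_inD(4)[OF assms, of 0] by (auto simp: conjugate_def)
next
  case False
  then show ?thesis using le_conjugate_iff[OF assms, of k q] by auto
qed

definition ot_map :: "nat \<Rightarrow> nat \<Rightarrow> (nat \<times> nat \<Rightarrow> nat \<times> nat) \<Rightarrow> nat \<times> nat \<Rightarrow> nat \<times> nat" where
  "ot_map d m f = (\<lambda>(r, c). prod.swap (f (d + 1 - c, m + 1 - r)))"

definition ot_inv :: "nat \<Rightarrow> nat \<Rightarrow> (nat \<times> nat \<Rightarrow> nat \<times> nat) \<Rightarrow> nat \<times> nat \<Rightarrow> nat \<times> nat" where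
  "ot_inv d m g = (\<lambda>(q, k). ot_cell d m (g (k, q)))"

text \<open>The source is reflected in the antidiagonal and the target in the diagonal. This
  exchanges the row condition of a picture with its column condition, strict and weak inequalities
  included.\<close>

lemma picture_ot:
  assumes sb: "skew_box d m lam mu nu" and p: "picture (cells lam mu) (normal_shape nu) f g"
  shows "picture (cells (complement m d (conjugate mu)) (complement m d (conjugate lam)))
    (normal_shape (conjugate nu)) (ot_map d m f) (ot_inv d m g)"
    (is "picture ?A ?B ?f ?g")
proof -
  have nu: "partition_in d m nu" and lam: "partition_in d m lam" using sb by (auto simp: skew_box_def)
  note pp = pictureD[OF p]
  note mA = mem_ot_cells[OF sb] and mB = mem_normal_shape_conjugate[OF nu]
  have box: "fst c \<in> {1..d} \<and> snd c \<in> {1..m}" if "c \<in> cells lam mu" for c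
    using cells_subset_box[OF lam, of mu] that by (auto dest!: subsetD simp: mem_Times_iff)
  show ?thesis unfolding picture_def
  proof (intro conjI ballI)
    fix a assume "a \<in> ?A"
    then obtain r c where a: "a = (r, c)" "r \<in> {1..m}" "c \<in> {1..d}" "(d + 1 - c, m + 1 - r) \<in> cells lam mu"
      using mA by (cases a) blast
    show "?f a \<in> ?B" using pp(1)[OF a(4)] a(1) mB by (cases "f (d + 1 - c, m + 1 - r)") (simp add: ot_map_def del: mem_normal_shape)
    show "?g (?f a) = a" using pp(2)[OF a(4)] a
      by (auto simp: ot_map_def ot_inv_def ot_cell_def split: prod.splits)
  next
    fix b assume "b \<in> ?B"
    then obtain q k where b: "b = (q, k)" "(k, q) \<in> normal_shape nu" using mB by (cases b) blast
    obtain i j where ij: "g (k, q) = (i, j)" by fastforce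
    have inA: "(i, j) \<in> cells lam mu" "f (i, j) = (k, q)" using pp(3,4)[OF b(2)] ij by auto
    have bx: "i \<in> {1..d}" "j \<in> {1..m}" using box[OF inA(1)] by auto
    have e: "d + 1 - (d + 1 - i) = i" "m + 1 - (m + 1 - j) = j" using bx by auto
    show "?g b \<in> ?A" unfolding ot_inv_def b(1) split ij ot_cell_def mA e using inA bx by auto
    show "?f (?g b) = b" unfolding ot_inv_def ot_map_def b(1) split ij ot_cell_def e inA(2) by simp
  next
    show "monotone_picture ?A ?f" unfolding monotone_picture_def
    proof (intro conjI allI impI)
      fix r c c' assume *: "(r, c) \<in> ?A" "(r, c') \<in> ?A" "c < c'"
      then have "(d + 1 - c, m + 1 - r) \<in> cells lam mu" "(d + 1 - c', m + 1 - r) \<in> cells lam mu" "d + 1 - c' < d + 1 - c"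
        unfolding mA by (blast, blast, fastforce)
      then show "fst (?f (r, c)) \<le> fst (?f (r, c'))" "snd (?f (r, c')) < snd (?f (r, c))"
        using monotone_pictureD(3,4)[OF pp(5)] by (auto simp: ot_map_def simp del: mem_cells)
    next
      fix r r' c assume *: "(r, c) \<in> ?A" "(r', c) \<in> ?A" "r < r'"
      then have "(d + 1 - c, m + 1 - r) \<in> cells lam mu" "(d + 1 - c, m + 1 - r') \<in> cells lam mu" "m + 1 - r' < m + 1 - r"
        unfolding mA by (blast, blast, fastforce)
      then show "fst (?f (r, c)) < fst (?f (r', c))" "snd (?f (r', c)) \<le> snd (?f (r, c))"
        using monotone_pictureD(1,2)[OF pp(5)] by (auto simp: ot_map_def simp del: mem_cells)
    qed
    show "monotone_picture ?B ?g" unfolding monotone_picture_def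
    proof (intro conjI allI impI)
      fix q k k' assume *: "(q, k) \<in> ?B" "(q, k') \<in> ?B" "k < k'"
      then have B: "(k, q) \<in> normal_shape nu" "(k', q) \<in> normal_shape nu" using mB by blast+
      show "fst (?g (q, k)) \<le> fst (?g (q, k'))" "snd (?g (q, k')) < snd (?g (q, k))"
        using monotone_pictureD(3,4)[OF pp(6) B *(3)] box[OF pp(3)[OF B(1)]] box[OF pp(3)[OF B(2)]]
        by (auto simp: ot_inv_def ot_cell_def split: prod.splits)
    next
      fix q q' k assume *: "(q, k) \<in> ?B" "(q', k) \<in> ?B" "q < q'"
      then have B: "(k, q) \<in> normal_shape nu" "(k, q') \<in> normal_shape nu" using mB by blast+
      show "fst (?g (q, k)) < fst (?g (q', k))" "snd (?g (q', k)) \<le> snd (?g (q, k))"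
        using monotone_pictureD(1,2)[OF pp(6) B *(3)] box[OF pp(3)[OF B(1)]] box[OF pp(3)[OF B(2)]]
        by (auto simp: ot_inv_def ot_cell_def split: prod.splits)
    qed
  qed
qed

lemma otrans_picture:
  assumes sb: "skew_box d m lam mu nu" and p: "picture (cells lam mu) (normal_shape nu) f g"
  shows "otrans d m (fst_tableau (cells lam mu) f) =
    fst_tableau (cells (complement m d (conjugate mu)) (complement m d (conjugate lam))) (ot_map d m f)"
    (is "otrans d m ?T = ?R")
proof (rule ext, clarify)
  fix r c
  let ?c = "(d + 1 - c, m + 1 - r)"
  have cnt: "card {(i', j'). ?T (i', j') = Some (fst (f ?c)) \<and> (i' < d + 1 - c \<or> i' = d + 1 - c \<and> m + 1 - r \<le> j')}
      = snd (f ?c)" if "?c \<in> cells lam mu"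
  proof -
    have "{(i', j'). ?T (i', j') = Some (fst (f ?c)) \<and> (i' < d + 1 - c \<or> i' = d + 1 - c \<and> m + 1 - r \<le> j')}
      = {c'. ?T c' = Some (fst (f ?c)) \<and> read_le c' ?c}" by (auto simp: read_le_def)
    then show ?thesis
      using letters_read_fst_tableau[OF p[unfolded normal_shape_def] that] by (simp add: letters_read_def)
  qed
  show "otrans d m ?T (r, c) = ?R (r, c)"
    using cnt mem_ot_cells[OF sb, of r c]
    by (auto simp: otrans_def fst_tableau_def ot_map_def Let_def simp del: mem_cells)
qed

lemma otrans_LR:
  assumes "T \<in> LR_tableaux d m lam mu nu"
  shows "otrans d m T \<in> LR_tableaux m d (complement m d (conjugate mu)) (complement m d (conjugate lam)) (conjugate nu)"
    and "companion m (otrans d m T) = otrans_companion d m lam (companion d T)"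
    and "otrans m d (otrans d m T) = T"
proof -
  have sb: "skew_box d m lam mu nu" using assms by (simp add: mem_LR_tableaux)
  obtain f g where p: "picture (cells lam mu) (normal_shape nu) f g" "T = fst_tableau (cells lam mu) f"
    using LR_picture[OF assms] .
  have part: "partition_in d m lam" "partition_in d m mu" "partition_in d m nu" using sb by (auto simp: skew_box_def)
  note sb' = skew_box_conjugate[OF sb] and p' = picture_ot[OF sb p(1)]
  have oT: "otrans d m T = fst_tableau (cells (complement m d (conjugate mu)) (complement m d (conjugate lam))) (ot_map d m f)"
    using otrans_picture[OF sb p(1)] p(2) by simp
  show "otrans d m T \<in> LR_tableaux m d (complement m d (conjugate mu)) (complement m d (conjugate lam)) (conjugate nu)"
    unfolding oT by (rule LR_of_picture[OF sb' p'])
  have G: "companion d T = fst_tableau (normal_shape nu) g" using companion_of_picture[OF sb p(1)] p(2) by simp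
  show "companion m (otrans d m T) = otrans_companion d m lam (companion d T)"
    unfolding oT companion_of_picture[OF sb' p'] G
  proof (rule ext, clarify)
    fix q k
    show "fst_tableau (normal_shape (conjugate nu)) (ot_inv d m g) (q, k)
        = otrans_companion d m lam (fst_tableau (normal_shape nu) g) (q, k)"
    proof (cases "(k, q) \<in> normal_shape nu")
      case True
      obtain i j where ij: "g (k, q) = (i, j)" by fastforce
      have inA: "(i, j) \<in> cells lam mu" "f (i, j) = (k, q)" using pictureD(3,4)[OF p(1) True] ij by auto
      have i: "i \<in> {1..d}" using cells_subset_box[OF part(1), of mu] inA(1) by blast
      note ps = picture_sym[OF p(1)]
      have "{(r', c'). fst_tableau (normal_shape nu) g (c', r') = Some i \<and> r' \<le> q}
          = prod.swap ` {b. fst_tableau (normal_shape nu) g b = Some i \<and> snd b \<le> q}"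
        by (auto simp: image_iff)
      then have "card {(r', c'). fst_tableau (normal_shape nu) g (c', r') = Some i \<and> r' \<le> q}
          = card {b. fst_tableau (normal_shape nu) g b = Some i \<and> snd b \<le> q}"
        by (simp add: card_image)
      also have "\<dots> = card {j'. mu i < j' \<and> j' \<le> lam i \<and> snd (f (i, j')) \<le> q}"
        unfolding picture_letters[OF ps]
        using card_image[OF picture_inj[OF ps, of i "\<lambda>j'. snd (f (i, j')) \<le> q"]] by simp
      \<comment> \<open>Along row \<open>i\<close> of \<open>lam/mu\<close> the second coordinate of
        \<open>f\<close> falls strictly, so the part of the strip down to row \<open>q\<close> comes
        from the columns \<open>j\<close> to \<open>lam i\<close>. Their number
        \<open>lam i + 1 - j\<close>, added to \<open>m - lam i\<close>, is
        \<open>m + 1 - j\<close>, the row of the reflected cell.\<close>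
      also have "{j'. mu i < j' \<and> j' \<le> lam i \<and> snd (f (i, j')) \<le> q} = {j..lam i}"
      proof -
        have "snd (f (i, j')) \<le> q \<longleftrightarrow> j \<le> j'" if "(i, j') \<in> cells lam mu" for j'
          using monotone_pictureD(2)[OF pictureD(5)[OF p(1)], of i j j']
            monotone_pictureD(2)[OF pictureD(5)[OF p(1)], of i j' j] that inA
          by (cases j j' rule: linorder_cases) auto
        then show ?thesis using inA(1) by auto
      qed
      finally have cnt: "card {(r', c'). fst_tableau (normal_shape nu) g (c', r') = Some i \<and> r' \<le> q} = Suc (lam i) - j"
        by simp
      have "complement d m lam (d + 1 - i) = m - lam i" using i by (auto simp: complement_def)
      then show ?thesis
        using True mem_normal_shape_conjugate[OF part(3), of q k] ij cnt partition_inD(3)[OF part(1), of i] inA(1)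
        by (simp add: fst_tableau_def otrans_companion_def ot_inv_def ot_cell_def del: mem_normal_shape)
    next
      case False
      then show ?thesis using mem_normal_shape_conjugate[OF part(3), of q k]
        by (simp add: fst_tableau_def otrans_companion_def del: mem_normal_shape)
    qed
  qed
  show "otrans m d (otrans d m T) = T"
  proof (rule ext, clarify)
    fix i j
    have "(i, j) \<in> cells (complement d m (conjugate (complement m d (conjugate lam))))
          (complement d m (conjugate (complement m d (conjugate mu)))) \<longleftrightarrow> (i, j) \<in> cells lam mu"
      using cells_subset_box[OF part(1), of mu] unfolding mem_ot_cells[OF sb'] mem_ot_cells[OF sb]
      by (auto simp del: mem_cells) fastforce+
    moreover have "ot_map m d (ot_map d m f) (i, j) = f (i, j)" if "(i, j) \<in> cells lam mu"
    proof -
      have "i \<in> {1..d}" "j \<in> {1..m}" using cells_subset_box[OF part(1), of mu] that by blast+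
      then have "d + 1 - (d + 1 - i) = i" "m + 1 - (m + 1 - j) = j" by auto
      then show ?thesis by (simp add: ot_map_def del: diff_diff_right)
    qed
    ultimately show "otrans m d (otrans d m T) (i, j) = T (i, j)"
      unfolding oT otrans_picture[OF sb' p'] unfolding p(2) by (simp add: fst_tableau_def del: mem_cells)
  qed
qed

text \<open>The rectification of any reading word is the tableau itself, by
  \<open>ssyt_unique\<close> for arbitrary readings, and a word is Knuth equivalent to the row word
  of its rectification.\<close>

lemma reading_knuth_equiv:
  assumes "ssyt d S T" "order_ideal S" "reading S L" "row_reading S L'"
  shows "knuth_equiv (word_of T L) (word_of T L')"
proof -
  have "set (word_of T L) \<subseteq> {1..d}"
    using ssytD(3)[OF assms(1)] assms(3) by (auto simp: reading_def)
  then obtain S' E M where E: "order_ideal S'" "ssyt d S' E" "row_reading S' M" "knuth_equiv (word_of T L) (word_of E M)"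
    by (rule ex_rectification)
  have "T = E"
    using ssyt_unique[OF assms(1-3) E(2,1) row_reading_reading[OF E(3)] E(4)] .
  moreover have "S = S'" using ssytD(1)[OF assms(1)] ssytD(1)[OF E(2)] calculation by simp
  ultimately show ?thesis using E(3,4) row_reading_unique[OF assms(4)] by metis
qed

lemma col_word_word_of:
  assumes "\<And>u b v. L = u @ b # v \<Longrightarrow> h b = g (the (T b)) + count_list (word_of T v) (the (T b)) + 1"
  shows "col_word g (word_of T L) = map h L"
  using assms
proof (induction L)
  case (Cons b L)
  have "col_word g (word_of T L) = map h L"
    by (rule Cons.IH) (use Cons.prems in \<open>metis append_Cons\<close>)
  then show ?case using Cons.prems[of "[]" b L] by simp
qed simp

text \<open>\<open>L\<close> is the column reading of \<open>nu\<close>: columns from left to right,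
  each from bottom to top. The cells with one entry form a horizontal strip, on which column reading
  and row reading agree; so the columns computed by \<open>col_word\<close> are the second
  coordinates of \<open>rec_map\<close>.\<close>

lemma row_word_otrans_companion:
  assumes sb: "skew_box d m lam mu nu" and H: "companion_tableau d lam mu nu H"
    and L': "row_reading (normal_shape (conjugate nu)) L'"
  defines "L \<equiv> rev (map prod.swap L')"
  shows "row_word m d (otrans_companion d m lam H) = ot_word m mu (word_of H L)"
    and "reading (normal_shape nu) L"
proof -
  have nu: "partition_in d m nu" using sb by (simp add: skew_box_def)
  let ?B = "normal_shape nu" and ?B' = "normal_shape (conjugate nu)"
  define g where "g = rec_map mu H"
  obtain f where p: "picture (cells lam mu) ?B f g" "H = fst_tableau ?B g"
    using picture_of_companion_tableau[OF sb H] unfolding g_def .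
  define T where "T = fst_tableau (cells lam mu) f"
  have T: "T \<in> LR_tableaux d m lam mu nu" "companion d T = H"
    using LR_of_picture[OF sb p(1)] companion_of_picture[OF sb p(1)] p(2) by (simp_all add: T_def)
  have X: "otrans_companion d m lam H = fst_tableau ?B' (ot_inv d m g)"
    using otrans_LR(2)[OF T(1)] T(2) companion_of_picture[OF skew_box_conjugate[OF sb] picture_ot[OF sb p(1)]]
      otrans_picture[OF sb p(1)] unfolding T_def by simp
  have mB: "(q, k) \<in> ?B' \<longleftrightarrow> (k, q) \<in> ?B" for q k by (rule mem_normal_shape_conjugate[OF nu])
  have setL: "set L = ?B"
  proof -
    have "set L = prod.swap ` ?B'" using L' by (simp add: L_def row_reading_def)
    also have "\<dots> = ?B" using mB by (force simp: image_iff simp del: mem_normal_shape)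
    finally show ?thesis .
  qed
  let ?col = "\<lambda>c c'. snd c < snd c' \<or> snd c = snd c' \<and> fst (c' :: nat \<times> nat) < (fst c :: nat)"
  have sorted: "sorted_wrt ?col L"
    unfolding L_def sorted_wrt_rev sorted_wrt_map
    by (rule sorted_wrt_mono_rel[of _ row_less]) (use L' in \<open>auto simp: row_reading_def row_less_def\<close>)
  have dist: "distinct L"
    using row_reading_reading[OF L'] by (simp add: L_def distinct_map reading_def)
  show "reading ?B L" unfolding reading_def
  proof (intro conjI dist setL)
    show "sorted_wrt (\<lambda>(i, j) (i', j'). (i = i' \<longrightarrow> j < j') \<and> (j = j' \<longrightarrow> i' < i)) L"
      by (rule sorted_wrt_mono_rel[OF _ sorted]) auto
  qed
  have "col_word mu (word_of H L) = map (\<lambda>b. snd (g b)) L"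
  proof (rule col_word_word_of)
    fix u b v assume L: "L = u @ b # v"
    then have bB: "b \<in> ?B" using setL by auto
    define i where "i = the (H b)"
    have Hg: "H c = Some (fst (g c))" if "c \<in> ?B" for c using that p(2) by (simp add: fst_tableau_def)
    have dH: "dom H = ?B" using H by (auto simp: companion_tableau_def dest: ssytD(1))
    note ps = picture_sym[OF p(1)]
    have gb: "g b = (i, snd (g b))" using Hg[OF bB] by (simp add: i_def prod_eq_iff)
    \<comment> \<open>Along row \<open>i\<close> of \<open>lam/mu\<close> the picture moves strictly
      to the left in \<open>nu\<close>. Among the cells with entry \<open>i\<close>, standing behind
      \<open>b\<close> in the column reading is therefore the same as being read before
      \<open>b\<close>.\<close>
    have iff: "read_le b' b \<longleftrightarrow> b' = b \<or> b' \<in> set v" if b': "H b' = Some i" for b'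
    proof (cases "b' = b")
      case False
      have b'B: "b' \<in> ?B" using that dH by blast
      have gb': "g b' = (i, snd (g b'))" using Hg[OF b'B] b' by (simp add: prod_eq_iff)
      let ?j = "snd (g b)" and ?j' = "snd (g b')"
      have A: "(i, ?j) \<in> cells lam mu" "f (i, ?j) = b" "(i, ?j') \<in> cells lam mu" "f (i, ?j') = b'"
        using pictureD(3,4)[OF p(1) bB] pictureD(3,4)[OF p(1) b'B] gb gb' by metis+
      then have ne: "?j \<noteq> ?j'" using False by metis
      have r: "read_le b' b \<longleftrightarrow> ?j' \<le> ?j" using picture_row_read[OF ps A(3,1)] A(2,4) by simp
      have "?j < ?j' \<Longrightarrow> snd b' < snd b" "?j' < ?j \<Longrightarrow> snd b < snd b'"
        using monotone_pictureD(2)[OF pictureD(5)[OF p(1)] A(1,3)] monotone_pictureD(2)[OF pictureD(5)[OF p(1)] A(3,1)]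
          A(2,4) by auto
      moreover have "b' \<in> set u \<or> b' \<in> set v" using b'B setL L False by auto
      moreover have "b' \<in> set u \<Longrightarrow> ?col b' b" "b' \<in> set v \<Longrightarrow> ?col b b'"
        using sorted L by (auto simp: sorted_wrt_append)
      ultimately show ?thesis using r ne False by (cases "?j < ?j'") auto
    qed simp
    have "{b'. H b' = Some i \<and> read_le b' b} = insert b {b' \<in> set v. H b' = Some i}"
      using iff Hg[OF bB] gb by (auto simp: prod_eq_iff)
    moreover have "b \<notin> set v" using dist L by auto
    ultimately have "letters_read H i b = Suc (card {b' \<in> set v. H b' = Some i})"
      by (simp add: letters_read_def)
    also have "card {b' \<in> set v. H b' = Some i} = count_list (word_of H v) i"
    proof (rule count_word_of[symmetric])
      show "distinct v" using dist L by simp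
      show "set v \<subseteq> dom H" unfolding dH setL[symmetric] L by auto
    qed
    finally show "snd (g b) = mu (the (H b)) + count_list (word_of H v) (the (H b)) + 1"
      by (simp add: g_def rec_map_def i_def)
  qed
  then have "ot_word m mu (word_of H L) = map (\<lambda>b. m + 1 - snd (g (prod.swap b))) L'"
    by (simp add: ot_word_def rev_compl_def L_def rev_map)
  moreover have "row_word m d (otrans_companion d m lam H) = map (\<lambda>b. m + 1 - snd (g (prod.swap b))) L'"
  proof -
    have dX: "dom (otrans_companion d m lam H) = ?B'" unfolding X by (auto simp: fst_tableau_def split: if_splits)
    have "row_word m d (otrans_companion d m lam H) = word_of (otrans_companion d m lam H) L'"
      using normal_shape_subset_box[OF partition_in_conjugate[OF nu]] L' unfolding dX[symmetric]
      by (rule row_word_eq)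
    also have "\<dots> = map (\<lambda>b. m + 1 - snd (g (prod.swap b))) L'"
      unfolding X using L' by (auto simp: row_reading_def fst_tableau_def ot_inv_def ot_cell_def split: prod.splits simp del: mem_normal_shape)
    finally show ?thesis .
  qed
  ultimately show "row_word m d (otrans_companion d m lam H) = ot_word m mu (word_of H L)" by simp
qed

lemma otrans_companion_mem:
  assumes "skew_box d m lam mu nu" "companion_tableau d lam mu nu H"
  shows "otrans_companion d m lam H
    \<in> LR_companions m d (conjugate nu) (complement m d (conjugate mu)) (complement m d (conjugate lam))"
proof -
  obtain T where "T \<in> LR_tableaux d m lam mu nu" "companion d T = H"
    using LR_of_companion_tableau[OF assms] .
  then show ?thesis using otrans_LR(1,2)[of T d m lam mu nu] unfolding LR_companions_def by (metis imageI)
qed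

text \<open>On column words transposition is \<open>ot_word\<close>. It carries one reversed
  complement into the other by \<open>ot_word_rev_compl\<close>, the starting shape changing from
  \<open>mu\<close> to the complement of \<open>lam\<close>, and it respects the Knuth equivalence
  that defines the evacuation of \<open>H\<close>. The resulting equivalence is the one that
  characterizes the evacuation of the transposed companion.\<close>

lemma evac_otrans_companion:
  assumes sb: "skew_box d m lam mu nu" and H: "companion_tableau d lam mu nu H"
  shows "evac m d (otrans_companion d m lam H) = otrans_companion d m (complement d m mu) (evac d m H)"
proof -
  let ?lam = "complement d m mu" and ?mu = "complement d m lam"
  let ?E = "evac d m H"
  note sb' = skew_box_complement[OF sb] and E = companion_tableau_evac[OF sb H]
  have p: "partition_in d m lam" "partition_in d m mu" "partition_in d m nu" "partition_in d m ?lam" "partition_in d m ?mu"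
    using sb sb' by (auto simp: skew_box_def)
  note pc = partition_in_conjugate[OF p(3)]
  have sH: "ssyt d (normal_shape nu) H" and sE: "ssyt d (normal_shape nu) ?E"
    using H E by (auto simp: companion_tableau_def)
  have sX: "ssyt m (normal_shape (conjugate nu)) (otrans_companion d m lam H)"
    using otrans_companion_mem[OF sb H] by (auto simp: mem_LR_companions companion_tableau_def)
  have sY: "ssyt m (normal_shape (conjugate nu)) (otrans_companion d m ?lam ?E)"
    using otrans_companion_mem[OF sb' E] by (auto simp: mem_LR_companions companion_tableau_def)
  define L' where "L' = filter (\<lambda>c. c \<in> normal_shape (conjugate nu)) (box_cells m d)"
  have L': "row_reading (normal_shape (conjugate nu)) L'"
    unfolding L'_def by (rule row_reading_box[OF normal_shape_subset_box[OF pc]])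
  define L where "L = rev (map prod.swap L')"
  note X = row_word_otrans_companion[OF sb H L', folded L_def]
  note Y = row_word_otrans_companion[OF sb' E L', folded L_def]
  note box = normal_shape_subset_box[OF p(3)]
  have k: "knuth_equiv (word_of F L) (row_word d m F)" if F: "ssyt d (normal_shape nu) F" for F
  proof -
    obtain M where M: "row_reading (normal_shape nu) M" "row_word d m F = word_of F M"
      using row_word_reading[OF F box] .
    show ?thesis unfolding M(2)
      by (rule reading_knuth_equiv[OF F order_ideal_normal_shape[OF p(3)] X(2) M(1)])
  qed
  have w: "set (word_of H L) \<subseteq> {1..d}"
    using knuth_equiv_set[OF k[OF sH]] set_row_word[OF sH box] by simp
  have cH: "count_list (word_of H L) x = content H x" for x
    using knuth_equiv_count[OF k[OF sH]] count_row_word[of H d m x] ssytD(1)[OF sH] box by simp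
  have lam: "lam x = mu x + content H x" for x using H by (simp add: companion_tableau_def)
  have kE: "knuth_equiv (rev_compl d (word_of H L)) (word_of ?E L)"
    using knuth_equiv_rev_compl[OF k[OF sH] w] evac_props(2)[OF sH p(3)] k[OF sE]
      knuth_equiv_trans knuth_equiv_sym by metis
  have "rev_compl m (row_word m d (otrans_companion d m lam H)) = ot_word m ?mu (rev_compl d (word_of H L))"
    unfolding X(1)
  proof (rule ot_word_rev_compl[symmetric, OF w])
    fix x assume "x \<in> set (word_of H L)"
    then have "x \<in> {1..d}" using w by blast
    then show "mu x + count_list (word_of H L) x \<le> m \<and>
        ?mu (d + 1 - x) = m - (mu x + count_list (word_of H L) x)"
      using partition_inD(3)[OF p(1), of x] unfolding cH lam[symmetric] by (auto simp: complement_def)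
  qed
  moreover have "knuth_equiv (ot_word m ?mu (rev_compl d (word_of H L))) (ot_word m ?mu (word_of ?E L))"
  proof (rule ot_word_knuth[OF kE])
    have "dominant ?mu (row_word d m ?E)"
      using E dominant_row_word[OF _ partition_inD(1)[OF p(5)], of ?E d m] box ssytD(1)[OF sE]
      by (simp add: companion_tableau_def)
    then show "dominant ?mu (rev_compl d (word_of H L))"
      using dominant_knuth[OF k[OF sE]] dominant_knuth[OF kE] by simp
    show "0 \<notin> set (rev_compl d (word_of H L))" using set_rev_compl[OF w] by auto
    fix x
    have "count_list (rev_compl d (word_of H L)) x = content ?E x"
      using knuth_equiv_count[OF kE] knuth_equiv_count[OF k[OF sE]] count_row_word[of ?E d m x] ssytD(1)[OF sE] box
      by simp
    moreover have "?lam x = ?mu x + content ?E x" using E by (simp add: companion_tableau_def)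
    ultimately show "?mu x + count_list (rev_compl d (word_of H L)) x \<le> m"
      using partition_inD(3)[OF p(4), of x] by simp
  qed
  ultimately have "knuth_equiv (rev_compl m (row_word m d (otrans_companion d m lam H)))
      (row_word m d (otrans_companion d m ?lam ?E))"
    unfolding Y(1) by simp
  then show ?thesis by (rule evac_eqI(1)[OF sX pc sY])
qed

text \<open>The composite is an involution because its two factors commute and are
  involutions.\<close>

lemma otrans_companion_LR_companions:
  assumes "skew_box d m lam mu nu" "companion_tableau d lam mu nu H"
  shows "otrans_companion d m (complement d m mu) (evac d m H)
      \<in> LR_companions m d (conjugate nu) (conjugate lam) (conjugate mu)"
    and "otrans_companion m d (complement m d (conjugate mu))
      (evac m d (otrans_companion d m (complement d m mu) (evac d m H))) = H"
proof -
  have p: "partition_in d m lam" "partition_in d m mu" "partition_in d m nu" using assms(1) by (auto simp: skew_box_def)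
  show "otrans_companion d m (complement d m mu) (evac d m H)
      \<in> LR_companions m d (conjugate nu) (conjugate lam) (conjugate mu)"
    using otrans_companion_mem[OF skew_box_complement[OF assms(1)] companion_tableau_evac[OF assms]]
    by (simp add: complement_conjugate p)
  obtain T where T: "T \<in> LR_tableaux d m lam mu nu" "companion d T = H"
    using LR_of_companion_tableau[OF assms] .
  have "ssyt m (normal_shape (conjugate nu)) (otrans_companion d m lam H)"
    using otrans_companion_mem[OF assms] by (auto simp: mem_LR_companions companion_tableau_def)
  then have "evac m d (evac m d (otrans_companion d m lam H)) = otrans_companion d m lam H"
    by (rule evac_props(5)[OF _ partition_in_conjugate[OF p(3)]])
  then show "otrans_companion m d (complement m d (conjugate mu))
      (evac m d (otrans_companion d m (complement d m mu) (evac d m H))) = H"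
    using evac_otrans_companion[OF assms] otrans_LR(2,3)[OF T(1)] otrans_LR(2)[OF otrans_LR(1)[OF T(1)]] T(2)
    by simp
qed

text \<open>The commuted tableau \<open>T'\<close> is obtained from its companion, the evacuation of
  that of \<open>T\<close>; only then does \<open>reversal_eq\<close> identify the reversal as its
  rotation.\<close>

lemma LR_commuter_eq:
  assumes "T \<in> LR_tableaux d m lam mu nu"
  shows "LR_commuter d m T \<in> LR_tableaux d m (complement d m mu) (complement d m lam) nu"
    and "companion d (LR_commuter d m T) = evac d m (companion d T)"
    and "opposite_companion d m (reversal d m T) = antinormal_form d m (companion d T)"
proof -
  have sb: "skew_box d m lam mu nu" using assms by (simp add: mem_LR_tableaux)
  have p: "partition_in d m nu" "partition_in d m (complement d m mu)"
    using sb skew_box_complement[OF sb] by (auto simp: skew_box_def)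
  have G: "companion_tableau d lam mu nu (companion d T)" using companion_LR[OF assms] .
  then have sG: "ssyt d (normal_shape nu) (companion d T)" by (simp add: companion_tableau_def)
  obtain T' where T': "T' \<in> LR_tableaux d m (complement d m mu) (complement d m lam) nu"
    "companion d T' = evac d m (companion d T)"
    using LR_of_companion_tableau[OF skew_box_complement[OF sb] companion_tableau_evac[OF sb G]] .
  have sT': "ssyt d (cells (complement d m mu) (complement d m lam)) T'" using T'(1) by (simp add: mem_LR_tableaux)
  note box = cells_subset_box[OF p(2), of "complement d m lam"]
  have rev: "reversal d m T = rot d m T'"
    using reversal_eq[OF assms T'(1)] evac_props(2)[OF sG p(1)] T'(2) by simp
  have com: "LR_commuter d m T = T'" unfolding LR_commuter_def rev by (rule rot_rot[OF sT' box])
  show "LR_commuter d m T \<in> LR_tableaux d m (complement d m mu) (complement d m lam) nu"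
    and "companion d (LR_commuter d m T) = evac d m (companion d T)" unfolding com by (fact T')+
  obtain f g where fg: "picture (cells (complement d m mu) (complement d m lam)) (normal_shape nu) f g"
    "T' = fst_tableau (cells (complement d m mu) (complement d m lam)) f"
    using LR_picture[OF T'(1)] .
  have "length (rows_of_entry d T' k) \<le> m" for k
    unfolding fg(2) rows_of_entry_of_picture[OF skew_box_complement[OF sb] fg(1)]
    using partition_inD(3)[OF p(1), of k] by simp
  then show "opposite_companion d m (reversal d m T) = antinormal_form d m (companion d T)"
    unfolding rev evac_props(3)[OF sG p(1)] T'(2)[symmetric] by (rule opposite_companion_rot[OF sT' box])
qed

theorem theorem5p11:
  fixes n d m :: nat and lam mu nu :: "nat \<Rightarrow> nat" and T G :: tableau
  assumes "d \<le> n" and "m = n - d"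
    and "T \<in> LR_tableaux d m lam mu nu"
    and "G = companion d T"
  shows
    \<comment> \<open>(a)\<close>
    "(opposite_companion d m (reversal d m T) = antinormal_form d m G \<and>
      companion d (LR_commuter d m T) = companion d (rot d m (reversal d m T)) \<and>
      companion d (rot d m (reversal d m T)) = rot d m (antinormal_form d m G) \<and>
      rot d m (antinormal_form d m G) = evac d m G \<and>
      companion m (LR_transposer d m T) = companion m (otrans d m (rot d m (reversal d m T))) \<and>
      companion m (otrans d m (rot d m (reversal d m T)))
        = otrans_companion d m (complement d m mu) (evac d m G))
    \<comment> \<open>(b), commuter\<close>
    \<and> ((\<forall>H \<in> LR_companions d m nu lam mu.
          evac d m H \<in> LR_companions d m nu (complement d m mu) (complement d m lam) \<and>
          evac d m (evac d m H) = H) \<and>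
       evac d m (companion d T) = companion d (LR_commuter d m T))
    \<comment> \<open>(b), transposer\<close>
    \<and> ((\<forall>H \<in> LR_companions d m nu lam mu.
          otrans_companion d m (complement d m mu) (evac d m H)
            \<in> LR_companions m d (conjugate nu) (conjugate lam) (conjugate mu) \<and>
          otrans_companion d m (complement d m mu) (evac d m H)
            = evac m d (otrans_companion d m lam H) \<and>
          otrans_companion m d (complement m d (conjugate mu))
            (evac m d (otrans_companion d m (complement d m mu) (evac d m H))) = H) \<and>
       evac m d (otrans_companion d m lam (companion d T)) = companion m (LR_transposer d m T))"
proof -
  have sb: "skew_box d m lam mu nu" using assms(3) by (simp add: mem_LR_tableaux)
  then have nu: "partition_in d m nu" by (simp add: skew_box_def)
  have G: "companion_tableau d lam mu nu G" using companion_LR[OF assms(3)] assms(4) by simp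
  then have sG: "ssyt d (normal_shape nu) G" by (simp add: companion_tableau_def)
  note com = LR_commuter_eq[OF assms(3), folded assms(4)]
  have rot: "rot d m (reversal d m T) = LR_commuter d m T" by (simp add: LR_commuter_def)
  have tr: "companion m (otrans d m (LR_commuter d m T)) = otrans_companion d m (complement d m mu) (evac d m G)"
    using otrans_LR(2)[OF com(1)] com(2) by simp
  have b: "evac d m H \<in> LR_companions d m nu (complement d m mu) (complement d m lam) \<and> evac d m (evac d m H) = H"
    if "H \<in> LR_companions d m nu lam mu" for H
    using that companion_tableau_evac[OF sb] evac_props(5)[OF _ nu] skew_box_complement[OF sb]
    by (auto simp: mem_LR_companions companion_tableau_def)
  have c: "otrans_companion d m (complement d m mu) (evac d m H)
            \<in> LR_companions m d (conjugate nu) (conjugate lam) (conjugate mu) \<and>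
          otrans_companion d m (complement d m mu) (evac d m H) = evac m d (otrans_companion d m lam H) \<and>
          otrans_companion m d (complement m d (conjugate mu))
            (evac m d (otrans_companion d m (complement d m mu) (evac d m H))) = H"
    if "H \<in> LR_companions d m nu lam mu" for H
    using that otrans_companion_LR_companions[OF sb] evac_otrans_companion[OF sb]
    by (auto simp: mem_LR_companions)
  have "companion d (LR_commuter d m T) = rot d m (antinormal_form d m G)"
    using com(2) evac_props(4)[OF sG nu] by simp
  moreover have "evac m d (otrans_companion d m lam G) = companion m (otrans d m (LR_commuter d m T))"
    using tr evac_otrans_companion[OF sb G] by simp
  ultimately show ?thesis
    unfolding rot assms(4)[symmetric] LR_transposer_def
    using b c com(3) com(2)[symmetric] tr evac_props(4)[OF sG nu] by blast
qed

end
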